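(* Let $\{Z_i, i\ge 1\}$ be independent random variables with $E Z_i=0$ and finite positive variances $\operatorname{Var} Z_i=\sigma_i^2$, $i\ge 1$, and put $s_0^2:=0$, $s_m^2:=\sum_{i=1}^m\sigma_i^2$, $m\ge 1$. Assume the Lindeberg condition: for each $\varepsilon>0$, $s_n^{-2}\sum_{i=1}^n E\left(Z_i^2\mathbb{1}_{\{|Z_i|\ge \varepsilon s_n\}}\right)\to 0$ as $n\to\infty$. Let $\widetilde T_n^t(Z_1,\ldots,Z_n)$, $0\le t\le 1$, be the Student process with data-based time function $\widetilde K_n(t)$, and let $K_n(t)$ be the variance-based time function, both as defined in the context. Then, as $n\to\infty$: (a) $\widetilde T_n^{t_0}(Z_1,\ldots,Z_n)\xrightarrow{\mathcal D} N(0,t_0)$ for $t_0\in(0,1]$; (b) $\widetilde T_n^{t}(Z_1,\ldots,Z_n)\xrightarrow{\mathcal D} W(t)$ on $(D[0,1],\rho)$; (c) the sequence $\{Z_i,i\ge 1\}$ can be redefined on a richer probability space together with a sequence of independent standard normal random variables $\{Y_i,i\ge1\}$ such that $$\sup_{0\le t\le 1}\left|\widetilde T_n^t(Z_1,\ldots,Z_n)-s_n^{-1}\sum_{i=1}^{K_n(t)}\sigma_iY_i\right|=o_P(1).$$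
   Context: Notation: $\overline Z:=n^{-1}\sum_{i=1}^n Z_i$; $\mathbb{1}_A$ is the indicator of $A$; empty sums $\sum_{i=1}^0$ are $0$; $o_P(1)$ denotes a sequence of random variables converging to zero in probability as $n\to\infty$. Time functions, for $0\le t\le1$: $K_n(t)$ is the largest integer $m\in\{0,1,\ldots,n\}$ with $s_m^2\le t\,s_n^2$; $\widetilde K_n(t)$ is the largest integer $m\in\{0,1,\ldots,n\}$ with $\sum_{i=1}^m(Z_i-\overline Z)^2\le t\sum_{i=1}^n(Z_i-\overline Z)^2$. Student process: $$\widetilde T_n^t(Z_1,\ldots,Z_n):=\frac{\sum_{i=1}^{\widetilde K_n(t)}Z_i/\sqrt n}{\left(\sum_{i=1}^n(Z_i-\overline Z)^2/(n-1)\right)^{1/2}},\quad 0\le t\le 1.$$ $\{W(t),0\le t\le1\}$ is a standard Wiener process, $D[0,1]$ is the space of right-continuous functions with left limits (càdlàg) on $[0,1]$, $\rho$ is the sup-norm metric on $D[0,1]$, and $\mathcal D$ is the sigma-field of subsets of $D[0,1]$ generated by its finite-dimensional subsets. For processes $X_n$ in $D[0,1]$, "$X_n(t)\xrightarrow{\mathcal D}W(t)$ on $(D[0,1],\rho)$" means that $h(X_n(\cdot))\xrightarrow{\mathcal D}h(W(\cdot))$ for all functionals $h:D[0,1]\to\mathbb R$ that are $\mathcal D$-measurable and $\rho$-continuous, or $\rho$-continuous except at points forming a set of Wiener measure zero on $(D[0,1],\mathcal D)$. "Redefined on a richer probability space" means: there is a probability space carrying a sequence with the same joint law as $\{Z_i,i\ge1\}$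 (again denoted $\{Z_i\}$) together with the sequence $\{Y_i\}$. *)

theory Defs
  imports "HOL-Probability.Probability"
begin

text \<open>
  Sequences are indexed by \<open>{1..}\<close>; the value of a sequence at index \<open>0\<close> plays no role.
\<close>

definition sum_var :: "'a measure \<Rightarrow> (nat \<Rightarrow> 'a \<Rightarrow> real) \<Rightarrow> nat \<Rightarrow> real" where
  "sum_var M Z m = (\<Sum>i=1..m. prob_space.variance M (Z i))"

definition lindeberg :: "'a measure \<Rightarrow> (nat \<Rightarrow> 'a \<Rightarrow> real) \<Rightarrow> bool" where
  "lindeberg M Z \<longleftrightarrow>
     (\<forall>\<epsilon>>0. (\<lambda>n. (\<Sum>i=1..n. prob_space.expectation M
                (\<lambda>\<omega>. (Z i \<omega>)\<^sup>2 * indicator {\<omega>. \<bar>Z i \<omega>\<bar> \<ge> \<epsilon> * sqrt (sum_var M Z n)} \<omega>))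
              / sum_var M Z n) \<longlonglongrightarrow> 0)"

text \<open>
  The time functions and the Student process are defined for one realisation \<open>z\<close> of the sequence.
\<close>

definition sample_mean :: "nat \<Rightarrow> (nat \<Rightarrow> real) \<Rightarrow> real" where
  "sample_mean n z = (\<Sum>i=1..n. z i) / real n"

definition time_var :: "'a measure \<Rightarrow> (nat \<Rightarrow> 'a \<Rightarrow> real) \<Rightarrow> nat \<Rightarrow> real \<Rightarrow> nat" where
  "time_var M Z n t = Max {m \<in> {0..n}. sum_var M Z m \<le> t * sum_var M Z n}"

definition time_data :: "nat \<Rightarrow> (nat \<Rightarrow> real) \<Rightarrow> real \<Rightarrow> nat" where
  "time_data n z t =
     Max {m \<in> {0..n}. (\<Sum>i=1..m. (z i - sample_mean n z)\<^sup>2)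
                      \<le> t * (\<Sum>i=1..n. (z i - sample_mean n z)\<^sup>2)}"

text \<open>
  If \<open>n \<le> 1\<close> or \<open>z 1 = \<dots> = z n\<close>, the denominator vanishes and the process is \<open>0\<close>
  by \<open>x / 0 = 0\<close>. Under the Lindeberg condition the probability of this tends to \<open>0\<close>.
\<close>

definition student :: "nat \<Rightarrow> (nat \<Rightarrow> real) \<Rightarrow> real \<Rightarrow> real" where
  "student n z t =
     (\<Sum>i=1..time_data n z t. z i / sqrt (real n))
       / sqrt ((\<Sum>i=1..n. (z i - sample_mean n z)\<^sup>2) / (real n - 1))"

text \<open>
  Elements of \<open>D[0,1]\<close> are represented by functions that are \<open>undefined\<close> outside \<open>{0..1}\<close>.
\<close>

definition D01 :: "(real \<Rightarrow> real) set" where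
  "D01 = {f \<in> extensional {0..1}.
            (\<forall>t\<in>{0..<1}. (f \<longlongrightarrow> f t) (at_right t)) \<and>
            (\<forall>t\<in>{0<..1}. \<exists>l. (f \<longlongrightarrow> l) (at_left t))}"

definition D01_algebra :: "(real \<Rightarrow> real) measure" where
  "D01_algebra =
     sigma D01 {{f \<in> D01. restrict f J \<in> B} | J B.
                  finite J \<and> J \<subseteq> {0..1} \<and> B \<in> sets (Pi\<^sub>M J (\<lambda>_. borel))}"

definition rho :: "(real \<Rightarrow> real) \<Rightarrow> (real \<Rightarrow> real) \<Rightarrow> real" where
  "rho f g = (SUP t\<in>{0..1}. \<bar>f t - g t\<bar>)"

definition rho_continuous_at :: "((real \<Rightarrow> real) \<Rightarrow> real) \<Rightarrow> (real \<Rightarrow> real) \<Rightarrow> bool" where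
  "rho_continuous_at h f \<longleftrightarrow>
     (\<forall>\<epsilon>>0. \<exists>\<delta>>0. \<forall>g\<in>D01. rho g f < \<delta> \<longrightarrow> \<bar>h g - h f\<bar> < \<epsilon>)"

definition wiener_process :: "'b measure \<Rightarrow> (real \<Rightarrow> 'b \<Rightarrow> real) \<Rightarrow> bool" where
  "wiener_process N W \<longleftrightarrow>
     prob_space N \<and>
     (\<forall>t\<in>{0..1}. W t \<in> borel_measurable N) \<and>
     (AE \<omega> in N. W 0 \<omega> = 0) \<and>
     (\<forall>s t. 0 \<le> s \<and> s < t \<and> t \<le> 1 \<longrightarrow>
        distributed N lborel (\<lambda>\<omega>. W t \<omega> - W s \<omega>) (normal_density 0 (sqrt (t - s)))) \<and>
     (\<forall>k (t :: nat \<Rightarrow> real). mono_on {..k} t \<and> t ` {..k} \<subseteq> {0..1} \<longrightarrow>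
        prob_space.indep_vars N (\<lambda>_. borel) (\<lambda>i \<omega>. W (t (Suc i)) \<omega> - W (t i) \<omega>) {..<k}) \<and>
     (\<forall>\<omega>\<in>space N. (\<lambda>t\<in>{0..1}. W t \<omega>) \<in> D01) \<and>
     (AE \<omega> in N. continuous_on {0..1} (\<lambda>t. W t \<omega>))"

text \<open>
  \<open>X n\<close> and \<open>Y\<close> map outcomes to paths in \<open>D01\<close>. The law of \<open>Y\<close> on \<open>D01_algebra\<close> is Wiener
  measure when \<open>Y\<close> is the path map of a Wiener process. Functionals that are continuous
  everywhere are included in the almost everywhere condition.
\<close>

definition conv_distr_D01 ::
  "'a measure \<Rightarrow> (nat \<Rightarrow> 'a \<Rightarrow> real \<Rightarrow> real) \<Rightarrow> 'b measure \<Rightarrow> ('b \<Rightarrow> real \<Rightarrow> real) \<Rightarrow> bool" where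
  "conv_distr_D01 M X N Y \<longleftrightarrow>
     (\<forall>h \<in> borel_measurable D01_algebra.
        (AE f in distr N D01_algebra Y. rho_continuous_at h f) \<longrightarrow>
        weak_conv_m (\<lambda>n. distr M borel (\<lambda>\<omega>. h (X n \<omega>))) (distr N borel (\<lambda>\<omega>. h (Y \<omega>))))"

definition conv_prob_0 :: "'a measure \<Rightarrow> (nat \<Rightarrow> 'a \<Rightarrow> real) \<Rightarrow> bool" where
  "conv_prob_0 M X \<longleftrightarrow>
     (\<forall>n. X n \<in> borel_measurable M) \<and>
     (\<forall>\<epsilon>>0. (\<lambda>n. measure M {\<omega> \<in> space M. \<bar>X n \<omega>\<bar> > \<epsilon>}) \<longlonglongrightarrow> 0)"

end

theory Submission
  imports Defs
begin

text \<open>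
  Choose blocks \<open>{r k<..r (k+1)}\<close> along which \<open>s\<^sup>2\<close> grows by factors tending to \<open>1\<close> so slowly
  that the blocks themselves still satisfy the Lindeberg condition. The normalised block sums then
  converge to the normal law together with their second moments, and Skorohod's theorem couples them
  with normal variables at a mean square distance tending to \<open>0\<close>. To obtain a coupling of the full
  sequences, the block sums are rounded to a grid: two probability spaces carrying a discrete variable
  with the same law are glued by an explicit density, so no regular conditional distributions are
  needed.

  The differences of coupled block sums are independent and centred, so Ottaviani's inequality
  controls their partial sums. By the same inequality, a large oscillation inside a block is as
  unlikely as a large block sum, and the latter is close to a normal variable, whose fourth moment
  makes the bounds for all blocks negligible in total. Raikov's theorem, uniformly in the summation
  index, replaces the data-based clock by the variance-based one, up to the modulus of continuity of
  the normal partial sums.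

  For the functional limit theorem, the event that the path lies in \<open>h -` F\<close>, \<open>F\<close> closed, is compared
  with sup-norm neighbourhoods of that set, through the increments of the Wiener process on
  the grid of the variance-based clock.
\<close>

section \<open>Maximal inequalities\<close>

text \<open>The length of the blocks is a compromise. A block must be long enough to obey the
  central limit theorem on its own, so that its sum can be coupled with small relative mean square
  error. It must also carry a vanishing share of the total variance, because nothing is coupled
  inside a block and the oscillation there has to be bounded separately. With \<open>w k\<close> the
  variance of block \<open>k\<close>, coupling errors add up to the sum of
  \<open>\<eta> k * w k\<close>, and oscillations to that of the squares of \<open>w k\<close>. A
  second moment bound on oscillations would only give the sum of \<open>w k\<close>, which is not
  small. The Lindeberg condition provides no fourth moment of \<open>Z\<close>, hence the detour
  through the normal partner of the block sum. Statements on laws are proved for the coupled copy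
  and carried back, since they depend only on the joint law of the sequence. In the functional
  theorem the Wiener increments for all \<open>n\<close> come from one process, so that a limsup of
  events and path continuity can take the place of a tightness argument.\<close>

lemma LIMSEQ_eventuallyI:
  fixes X :: "nat \<Rightarrow> 'a::real_normed_vector"
  assumes "\<And>e. e > 0 \<Longrightarrow> eventually (\<lambda>n. norm (X n - L) < e) sequentially"
  shows "X \<longlonglongrightarrow> L"
  using assms by (intro tendstoI) (simp add: dist_norm)

context prob_space
begin

lemma indep_vars_rv: "indep_vars N X I \<Longrightarrow> i \<in> I \<Longrightarrow> random_variable (N i) (X i)"
  unfolding indep_vars_def by auto

text \<open>Centred independent variables are orthogonal: at each insertion the cross term
  \<open>X j * ?S\<close> integrates to a product of two vanishing means. Integrability is carried
  along because both the induction and the later Chebyshev bounds need it.\<close>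

lemma indep_sum_second_moment:
  fixes X :: "'i \<Rightarrow> 'a \<Rightarrow> real"
  assumes "finite I" "indep_vars (\<lambda>_. borel) X I"
    and "\<And>i. i \<in> I \<Longrightarrow> expectation (X i) = 0"
    and "\<And>i. i \<in> I \<Longrightarrow> integrable M (\<lambda>\<omega>. (X i \<omega>)\<^sup>2)"
  shows "integrable M (\<lambda>\<omega>. (\<Sum>i\<in>I. X i \<omega>)\<^sup>2) \<and>
    expectation (\<lambda>\<omega>. (\<Sum>i\<in>I. X i \<omega>)\<^sup>2) = (\<Sum>i\<in>I. expectation (\<lambda>\<omega>. (X i \<omega>)\<^sup>2))"
  using assms
proof (induction I rule: finite_induct)
  case empty
  then show ?case by simp
next
  case (insert j I)
  let ?S = "\<lambda>\<omega>. \<Sum>i\<in>I. X i \<omega>"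
  have ind: "indep_vars (\<lambda>_. borel) X I"
    using indep_vars_subset[OF insert.prems(1)] by auto
  have IH: "integrable M (\<lambda>\<omega>. (?S \<omega>)\<^sup>2)"
    "expectation (\<lambda>\<omega>. (?S \<omega>)\<^sup>2) = (\<Sum>i\<in>I. expectation (\<lambda>\<omega>. (X i \<omega>)\<^sup>2))"
    using insert.IH[OF ind] insert.prems by auto
  have rv: "random_variable borel (X i)" if "i \<in> insert j I" for i
    using indep_vars_rv[OF insert.prems(1) that] .
  have int: "integrable M (X i)" if "i \<in> insert j I" for i
    using square_integrable_imp_integrable[OF rv[OF that]] insert.prems(3)[OF that] by auto
  have S: "integrable M ?S" "expectation ?S = 0"
    using int insert.prems(2) by (auto simp: Bochner_Integration.integral_sum)
  have iv: "indep_var borel (X j) borel ?S"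
    by (rule indep_vars_sum[OF insert.hyps(1,2) insert.prems(1)])
  have P: "integrable M (\<lambda>\<omega>. X j \<omega> * ?S \<omega>)" "expectation (\<lambda>\<omega>. X j \<omega> * ?S \<omega>) = 0"
    using indep_var_integrable[OF iv] indep_var_lebesgue_integral[OF iv] int S by auto
  have eq: "(\<lambda>\<omega>. (\<Sum>i\<in>insert j I. X i \<omega>)\<^sup>2) = (\<lambda>\<omega>. (X j \<omega>)\<^sup>2 + (2 * (X j \<omega> * ?S \<omega>) + (?S \<omega>)\<^sup>2))"
    using insert.hyps by (auto simp: power2_eq_square algebra_simps)
  show ?case
    unfolding eq using IH P insert.prems(3) insert.hyps by simp
qed

lemma second_moment_tail:
  fixes X :: "'a \<Rightarrow> real"
  assumes [measurable]: "random_variable borel X" and "integrable M (\<lambda>\<omega>. (X \<omega>)\<^sup>2)" "a > 0"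
  shows "prob {\<omega>\<in>space M. \<bar>X \<omega>\<bar> > a} \<le> expectation (\<lambda>\<omega>. (X \<omega>)\<^sup>2) / a\<^sup>2"
proof -
  have "prob {\<omega>\<in>space M. \<bar>X \<omega>\<bar> > a} \<le> prob {\<omega>\<in>space M. (X \<omega>)\<^sup>2 \<ge> a\<^sup>2}"
    using assms(3) by (intro finite_measure_mono) (auto simp: abs_le_square_iff[symmetric])
  also have "\<dots> \<le> expectation (\<lambda>\<omega>. (X \<omega>)\<^sup>2) / a\<^sup>2"
    using assms by (intro integral_Markov_inequality_measure[where A="{}"]) auto
  finally show ?thesis .
qed

text \<open>First passage argument: decompose by the first index at which the partial sum exceeds
  \<open>2 * a\<close> in modulus. If the remaining sum then stays within \<open>a\<close>, the full
  sum still exceeds \<open>a\<close>; the remainder is independent of the past, which costs the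
  factor \<open>1 - c\<close>. The bound is a tail of the full sum, so every tail estimate for that
  sum extends to the maximum.\<close>

lemma ottaviani:
  fixes X :: "nat \<Rightarrow> 'a \<Rightarrow> real"
  assumes ind: "indep_vars (\<lambda>_. borel) X {p<..q}"
    and c: "\<And>m. m \<in> {p..q} \<Longrightarrow> prob {\<omega>\<in>space M. \<bar>\<Sum>i\<in>{m<..q}. X i \<omega>\<bar> > a} \<le> c"
  shows "(1 - c) * prob {\<omega>\<in>space M. \<exists>m\<in>{p..q}. \<bar>\<Sum>i\<in>{p<..m}. X i \<omega>\<bar> > 2 * a}
    \<le> prob {\<omega>\<in>space M. \<bar>\<Sum>i\<in>{p<..q}. X i \<omega>\<bar> > a}"
proof -
  define T where "T m \<omega> = (\<Sum>i\<in>{p<..m}. X i \<omega>)" for m \<omega>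
  define R where "R m \<omega> = (\<Sum>i\<in>{m<..q}. X i \<omega>)" for m \<omega>
  define A where "A m = {\<omega>\<in>space M. \<bar>T m \<omega>\<bar> > 2 * a \<and> (\<forall>j\<in>{p..<m}. \<bar>T j \<omega>\<bar> \<le> 2 * a)}" for m
  define B where "B m = {\<omega>\<in>space M. \<bar>R m \<omega>\<bar> \<le> a}" for m
  have rv[measurable]: "random_variable borel (X i)" if "i \<in> {p<..q}" for i
    using indep_vars_rv[OF ind that] .
  have T_rv[measurable]: "random_variable borel (T m)" if "m \<in> {p..q}" for m
    unfolding T_def using that by (intro borel_measurable_sum rv) auto
  have R_rv[measurable]: "random_variable borel (R m)" if "m \<in> {p..q}" for m
    unfolding R_def using that by (intro borel_measurable_sum rv) auto
  have A_ev: "A m \<in> events" if "m \<in> {p..q}" for m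
  proof -
    have "{\<omega>\<in>space M. \<bar>T m \<omega>\<bar> > 2 * a} \<in> events"
      using T_rv[OF that] by measurable
    moreover have "{\<omega>\<in>space M. \<forall>j\<in>{p..<m}. \<bar>T j \<omega>\<bar> \<le> 2 * a} \<in> events"
    proof (rule sets.sets_Collect_finite_All)
      fix j assume "j \<in> {p..<m}"
      then have "T j \<in> borel_measurable M" using that T_rv by auto
      then show "{\<omega>\<in>space M. \<bar>T j \<omega>\<bar> \<le> 2 * a} \<in> events" by measurable
    qed auto
    moreover have "A m = {\<omega>\<in>space M. \<bar>T m \<omega>\<bar> > 2 * a} \<inter> {\<omega>\<in>space M. \<forall>j\<in>{p..<m}. \<bar>T j \<omega>\<bar> \<le> 2 * a}"
      by (auto simp: A_def)
    ultimately show ?thesis by (simp only: sets.Int)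
  qed
  have B_ev: "B m \<in> events" if "m \<in> {p..q}" for m
    unfolding B_def using R_rv[OF that] by measurable
  \<comment> \<open>\<open>A m\<close> is a condition on the coordinates in \<open>{p<..m}\<close>,
    \<open>B m\<close> one on those in \<open>{m<..q}\<close>. Both are pulled back from these
    disjoint sets of coordinates.\<close>
  have indAB: "prob (A m \<inter> B m) = prob (A m) * prob (B m)" if m: "m \<in> {p..q}" for m
  proof -
    let ?PA = "Pi\<^sub>M {p<..m} (\<lambda>_. borel :: real measure)"
    let ?PB = "Pi\<^sub>M {m<..q} (\<lambda>_. borel :: real measure)"
    define XA where "XA = {x\<in>space ?PA. \<bar>\<Sum>i\<in>{p<..m}. x i\<bar> > 2 * a \<and>
      (\<forall>j\<in>{p..<m}. \<bar>\<Sum>i\<in>{p<..j}. x i\<bar> \<le> 2 * a)}"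
    define XB where "XB = {x\<in>space ?PB. \<bar>\<Sum>i\<in>{m<..q}. x i\<bar> \<le> a}"
    have iv: "indep_var ?PA (\<lambda>\<omega>. restrict (\<lambda>i. X i \<omega>) {p<..m}) ?PB (\<lambda>\<omega>. restrict (\<lambda>i. X i \<omega>) {m<..q})"
      by (rule indep_var_restrict[OF ind]) (use m in auto)
    have [measurable]: "(\<lambda>x. \<Sum>i\<in>{p<..j}. x i) \<in> borel_measurable ?PA" if "j \<in> {p..m}" for j
      using that by (intro borel_measurable_sum measurable_component_singleton) auto
    have [measurable]: "(\<lambda>x. \<Sum>i\<in>{m<..q}. x i) \<in> borel_measurable ?PB"
      by (intro borel_measurable_sum measurable_component_singleton) auto
    have XB: "XB \<in> sets ?PB" unfolding XB_def by measurable
    have "{x\<in>space ?PA. \<bar>\<Sum>i\<in>{p<..m}. x i\<bar> > 2 * a} \<in> sets ?PA"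
      using m by measurable
    moreover have "{x\<in>space ?PA. \<forall>j\<in>{p..<m}. \<bar>\<Sum>i\<in>{p<..j}. x i\<bar> \<le> 2 * a} \<in> sets ?PA"
      by (rule sets.sets_Collect_finite_All) (use m in measurable)
    moreover have "XA = {x\<in>space ?PA. \<bar>\<Sum>i\<in>{p<..m}. x i\<bar> > 2 * a} \<inter>
      {x\<in>space ?PA. \<forall>j\<in>{p..<m}. \<bar>\<Sum>i\<in>{p<..j}. x i\<bar> \<le> 2 * a}"
      by (auto simp: XA_def)
    ultimately have XA: "XA \<in> sets ?PA" by (simp only: sets.Int)
    have Aeq: "A m = (\<lambda>\<omega>. restrict (\<lambda>i. X i \<omega>) {p<..m}) -` XA \<inter> space M"
      unfolding A_def XA_def T_def by (auto simp: space_PiM restrict_def)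
    have Beq: "B m = (\<lambda>\<omega>. restrict (\<lambda>i. X i \<omega>) {m<..q}) -` XB \<inter> space M"
      unfolding B_def XB_def R_def by (auto simp: space_PiM)
    show ?thesis
      using indep_varD[OF iv XA XB] unfolding Aeq Beq
      by (auto simp: vimage_def Int_def conj_ac intro!: arg_cong2[where f="(=)"] arg_cong[where f=prob])
  qed
  have Bc: "prob (B m) \<ge> 1 - c" if m: "m \<in> {p..q}" for m
  proof -
    have "prob (space M - B m) = 1 - prob (B m)" using prob_compl[OF B_ev[OF m]] .
    moreover have "space M - B m = {\<omega>\<in>space M. \<bar>\<Sum>i\<in>{m<..q}. X i \<omega>\<bar> > a}"
      by (auto simp: B_def R_def)
    ultimately show ?thesis using c[OF m] by simp
  qed
  have disj: "disjoint_family_on A {p..q}"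
    unfolding disjoint_family_on_def
  proof (intro ballI impI)
    fix m n assume "m \<in> {p..q}" "n \<in> {p..q}" "m \<noteq> n"
    then consider "m < n" | "n < m" by linarith
    then show "A m \<inter> A n = {}"
      using \<open>m \<in> _\<close> \<open>n \<in> _\<close> by cases (force simp: A_def)+
  qed
  have un: "{\<omega>\<in>space M. \<exists>m\<in>{p..q}. \<bar>\<Sum>i\<in>{p<..m}. X i \<omega>\<bar> > 2 * a} = (\<Union>m\<in>{p..q}. A m)"
  proof (intro equalityI subsetI)
    fix \<omega> assume "\<omega> \<in> {\<omega>\<in>space M. \<exists>m\<in>{p..q}. \<bar>\<Sum>i\<in>{p<..m}. X i \<omega>\<bar> > 2 * a}"
    then obtain m0 where m0: "\<omega> \<in> space M" "p \<le> m0 \<and> m0 \<le> q \<and> \<bar>T m0 \<omega>\<bar> > 2 * a"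
      by (auto simp: T_def)
    define m where "m = (LEAST m. p \<le> m \<and> m \<le> q \<and> \<bar>T m \<omega>\<bar> > 2 * a)"
    have "p \<le> m \<and> m \<le> q \<and> \<bar>T m \<omega>\<bar> > 2 * a"
      unfolding m_def by (rule LeastI) (rule m0(2))
    moreover have "\<bar>T j \<omega>\<bar> \<le> 2 * a" if "j \<in> {p..<m}" for j
      using not_less_Least[of j "\<lambda>m. p \<le> m \<and> m \<le> q \<and> \<bar>T m \<omega>\<bar> > 2 * a"] that calculation
      unfolding m_def[symmetric] by auto
    ultimately show "\<omega> \<in> (\<Union>m\<in>{p..q}. A m)" using m0(1) by (auto simp: A_def)
  qed (auto simp: A_def T_def)
  have "(1 - c) * prob (\<Union>m\<in>{p..q}. A m) = (\<Sum>m\<in>{p..q}. (1 - c) * prob (A m))"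
    using A_ev disj by (subst finite_measure_finite_Union) (auto simp: sum_distrib_left)
  also have "\<dots> \<le> (\<Sum>m\<in>{p..q}. prob (A m \<inter> B m))"
    using Bc by (intro sum_mono) (auto simp: indAB mult.commute[of "1 - c"] intro!: mult_left_mono)
  also have "\<dots> = prob (\<Union>m\<in>{p..q}. A m \<inter> B m)"
  proof (rule finite_measure_finite_Union[symmetric])
    show "disjoint_family_on (\<lambda>m. A m \<inter> B m) {p..q}"
      using disj unfolding disjoint_family_on_def by blast
  qed (use A_ev B_ev in auto)
  also have "\<dots> \<le> prob {\<omega>\<in>space M. \<bar>\<Sum>i\<in>{p<..q}. X i \<omega>\<bar> > a}"
  proof (rule finite_measure_mono)
    show "(\<Union>m\<in>{p..q}. A m \<inter> B m) \<subseteq> {\<omega>\<in>space M. \<bar>\<Sum>i\<in>{p<..q}. X i \<omega>\<bar> > a}"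
    proof
      fix \<omega> assume "\<omega> \<in> (\<Union>m\<in>{p..q}. A m \<inter> B m)"
      then obtain m where m: "m \<in> {p..q}" "\<omega> \<in> A m" "\<omega> \<in> B m" by auto
      have "{p<..q} = {p<..m} \<union> {m<..q}" using m(1) by auto
      then have "(\<Sum>i\<in>{p<..q}. X i \<omega>) = T m \<omega> + R m \<omega>"
        unfolding T_def R_def by (simp add: sum.union_disjoint)
      then show "\<omega> \<in> {\<omega>\<in>space M. \<bar>\<Sum>i\<in>{p<..q}. X i \<omega>\<bar> > a}"
        using m by (auto simp: A_def B_def)
    qed
    have "{\<omega>\<in>space M. \<bar>R p \<omega>\<bar> > a} \<in> events" if "p \<le> q"
    proof -
      have [measurable]: "R p \<in> borel_measurable M" using R_rv[of p] that by simp
      show ?thesis by measurable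
    qed
    then show "{\<omega>\<in>space M. \<bar>\<Sum>i\<in>{p<..q}. X i \<omega>\<bar> > a} \<in> events"
      unfolding R_def by (cases "p \<le> q") auto
  qed
  finally show ?thesis unfolding un .
qed

text \<open>Chebyshev's inequality gives \<open>c = 1/2\<close>, whence the factor 2. The variance
  of every remainder is at most the total variance, so one condition on \<open>a\<close> covers all
  of them.\<close>

lemma ottaviani_second_moment:
  fixes X :: "nat \<Rightarrow> 'a \<Rightarrow> real"
  assumes ind: "indep_vars (\<lambda>_. borel) X {p<..q}"
    and mean: "\<And>i. i \<in> {p<..q} \<Longrightarrow> expectation (X i) = 0"
    and sq: "\<And>i. i \<in> {p<..q} \<Longrightarrow> integrable M (\<lambda>\<omega>. (X i \<omega>)\<^sup>2)"
    and a: "a > 0" "(\<Sum>i\<in>{p<..q}. expectation (\<lambda>\<omega>. (X i \<omega>)\<^sup>2)) \<le> a\<^sup>2 / 2"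
  shows "prob {\<omega>\<in>space M. \<exists>m\<in>{p..q}. \<bar>\<Sum>i\<in>{p<..m}. X i \<omega>\<bar> > 2 * a}
    \<le> 2 * prob {\<omega>\<in>space M. \<bar>\<Sum>i\<in>{p<..q}. X i \<omega>\<bar> > a}"
proof -
  have "(1 - 1/2) * prob {\<omega>\<in>space M. \<exists>m\<in>{p..q}. \<bar>\<Sum>i\<in>{p<..m}. X i \<omega>\<bar> > 2 * a}
    \<le> prob {\<omega>\<in>space M. \<bar>\<Sum>i\<in>{p<..q}. X i \<omega>\<bar> > a}"
  proof (rule ottaviani[OF ind])
    fix m assume m: "m \<in> {p..q}"
    have sub: "{m<..q} \<subseteq> {p<..q}" using m by auto
    have mom: "integrable M (\<lambda>\<omega>. (\<Sum>i\<in>{m<..q}. X i \<omega>)\<^sup>2) \<and>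
      expectation (\<lambda>\<omega>. (\<Sum>i\<in>{m<..q}. X i \<omega>)\<^sup>2) = (\<Sum>i\<in>{m<..q}. expectation (\<lambda>\<omega>. (X i \<omega>)\<^sup>2))"
      using sub mean sq by (intro indep_sum_second_moment indep_vars_subset[OF ind]) auto
    have "prob {\<omega>\<in>space M. \<bar>\<Sum>i\<in>{m<..q}. X i \<omega>\<bar> > a} \<le> expectation (\<lambda>\<omega>. (\<Sum>i\<in>{m<..q}. X i \<omega>)\<^sup>2) / a\<^sup>2"
      using mom sub indep_vars_rv[OF ind] by (intro second_moment_tail a borel_measurable_sum) auto
    also have "\<dots> \<le> (\<Sum>i\<in>{p<..q}. expectation (\<lambda>\<omega>. (X i \<omega>)\<^sup>2)) / a\<^sup>2"
      using mom sub by (auto intro!: divide_right_mono sum_mono2)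
    also have "\<dots> \<le> (a\<^sup>2 / 2) / a\<^sup>2"
      using a by (intro divide_right_mono) auto
    also have "\<dots> = 1/2" using a by simp
    finally show "prob {\<omega>\<in>space M. \<bar>\<Sum>i\<in>{m<..q}. X i \<omega>\<bar> > a} \<le> 1/2" .
  qed
  then show ?thesis by simp
qed

end

section \<open>Couplings\<close>

text \<open>Given the common value of \<open>f\<close> and \<open>g\<close>, the two points are
  drawn independently. As the values are countable, this conditioning is a density:
  \<open>1 / p n\<close> on the pairs with common value \<open>n\<close>.\<close>

lemma discrete_coupling:
  fixes f :: "'a \<Rightarrow> 'c::countable" and g :: "'b \<Rightarrow> 'c"
  assumes "prob_space A" "prob_space B"
    and f[measurable]: "f \<in> A \<rightarrow>\<^sub>M count_space UNIV" and g[measurable]: "g \<in> B \<rightarrow>\<^sub>M count_space UNIV"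
    and eq: "distr A (count_space UNIV) f = distr B (count_space UNIV) g"
  obtains C where "prob_space C" "sets C = sets (A \<Otimes>\<^sub>M B)"
    "distr C A fst = A" "distr C B snd = B" "AE x in C. f (fst x) = g (snd x)"
proof -
  interpret A: prob_space A by fact
  interpret B: prob_space B by fact
  interpret AB: pair_prob_space A B ..
  define p where "p n = emeasure B (g -` {n} \<inter> space B)" for n
  have pA: "p n = emeasure A (f -` {n} \<inter> space A)" for n
    using arg_cong[OF eq, of "\<lambda>D. emeasure D {n}"] by (simp add: emeasure_distr p_def)
  have p_fin: "p n \<noteq> \<infinity>" for n by (simp add: p_def B.emeasure_eq_measure)
  have pinv: "p n * (1 / p n) = 1" if "p n \<noteq> 0" for n
    using that p_fin[of n] by (simp add: ennreal_times_divide ennreal_divide_self less_top)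
  \<comment> \<open>Values of mass 0 have to be excluded: there \<open>1 / p\<close> is infinite,
    and the inner integrals \<open>m1\<close> and \<open>m2\<close> are 0 instead of 1. By
    countability the excluded points form a null set.\<close>
  have posA: "AE x in A. p (f x) \<noteq> 0"
  proof -
    have "AE x in A. \<forall>n. p n = 0 \<longrightarrow> f x \<noteq> n"
      unfolding AE_all_countable
    proof
      fix n show "AE x in A. p n = 0 \<longrightarrow> f x \<noteq> n"
        by (cases "p n = 0") (auto simp: pA intro!: AE_I'[of "f -` {n} \<inter> space A"])
    qed
    then show ?thesis by auto
  qed
  have posB: "AE x in B. p (g x) \<noteq> 0"
  proof -
    have "AE x in B. \<forall>n. p n = 0 \<longrightarrow> g x \<noteq> n"
      unfolding AE_all_countable
    proof
      fix n show "AE x in B. p n = 0 \<longrightarrow> g x \<noteq> n"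
        by (cases "p n = 0") (auto simp: p_def intro!: AE_I'[of "g -` {n} \<inter> space B"])
    qed
    then show ?thesis by auto
  qed
  define h where "h = (\<lambda>z. if f (fst z) = g (snd z) then 1 / p (f (fst z)) else 0)"
  have pf[measurable]: "(\<lambda>z. p (f (fst z))) \<in> borel_measurable (A \<Otimes>\<^sub>M B)"
    by measurable
  have [measurable]: "h \<in> borel_measurable (A \<Otimes>\<^sub>M B)"
    unfolding h_def by measurable
  define C where "C = density (A \<Otimes>\<^sub>M B) h"
  have sC[measurable_cong]: "sets C = sets (A \<Otimes>\<^sub>M B)" by (simp add: C_def)
  have m1: "(\<integral>\<^sup>+ y. h (x, y) \<partial>B) = (1 / p (f x)) * p (f x)" if "x \<in> space A" for x
  proof -
    have "(\<integral>\<^sup>+ y. h (x, y) \<partial>B) = (\<integral>\<^sup>+ y. (1 / p (f x)) * indicator (g -` {f x} \<inter> space B) y \<partial>B)"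
      by (intro nn_integral_cong) (auto simp: h_def split: split_indicator)
    also have "\<dots> = (1 / p (f x)) * p (f x)"
      by (subst nn_integral_cmult_indicator) (auto simp: p_def)
    finally show ?thesis .
  qed
  have m2: "(\<integral>\<^sup>+ x. h (x, y) \<partial>A) = (1 / p (g y)) * p (g y)" if "y \<in> space B" for y
  proof -
    have "(\<integral>\<^sup>+ x. h (x, y) \<partial>A) = (\<integral>\<^sup>+ x. (1 / p (g y)) * indicator (f -` {g y} \<inter> space A) x \<partial>A)"
      by (intro nn_integral_cong) (auto simp: h_def split: split_indicator)
    also have "\<dots> = (1 / p (g y)) * p (g y)"
      by (subst nn_integral_cmult_indicator) (auto simp: pA)
    finally show ?thesis .
  qed
  have dA: "distr C A fst = A"
  proof (rule measure_eqI)
    fix S assume "S \<in> sets (distr C A fst)"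
    then have S[measurable]: "S \<in> sets A" by simp
    have "emeasure (distr C A fst) S = (\<integral>\<^sup>+ z. h z * indicator S (fst z) \<partial>(A \<Otimes>\<^sub>M B))"
      by (subst emeasure_distr) (auto simp: C_def emeasure_density space_pair_measure
        intro!: nn_integral_cong split: split_indicator)
    also have "\<dots> = (\<integral>\<^sup>+ x. (\<integral>\<^sup>+ y. h (x, y) * indicator S x \<partial>B) \<partial>A)"
      by (subst B.nn_integral_fst[symmetric]) auto
    also have "\<dots> = (\<integral>\<^sup>+ x. (1 / p (f x)) * p (f x) * indicator S x \<partial>A)"
      by (intro nn_integral_cong) (simp add: nn_integral_multc m1)
    also have "\<dots> = (\<integral>\<^sup>+ x. indicator S x \<partial>A)"
      using posA by (intro nn_integral_cong_AE) (auto simp: pinv mult.commute[of "1 / _"] elim!: eventually_mono)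
    finally show "emeasure (distr C A fst) S = emeasure A S" by simp
  qed simp
  have dB: "distr C B snd = B"
  proof (rule measure_eqI)
    fix S assume "S \<in> sets (distr C B snd)"
    then have S[measurable]: "S \<in> sets B" by simp
    have "emeasure (distr C B snd) S = (\<integral>\<^sup>+ z. h z * indicator S (snd z) \<partial>(A \<Otimes>\<^sub>M B))"
      by (subst emeasure_distr) (auto simp: C_def emeasure_density space_pair_measure
        intro!: nn_integral_cong split: split_indicator)
    also have "\<dots> = (\<integral>\<^sup>+ y. (\<integral>\<^sup>+ x. h (x, y) * indicator S y \<partial>A) \<partial>B)"
      by (subst AB.nn_integral_snd[symmetric]) (auto simp: split_beta')
    also have "\<dots> = (\<integral>\<^sup>+ y. (1 / p (g y)) * p (g y) * indicator S y \<partial>B)"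
      by (intro nn_integral_cong) (simp add: nn_integral_multc m2)
    also have "\<dots> = (\<integral>\<^sup>+ y. indicator S y \<partial>B)"
      using posB by (intro nn_integral_cong_AE) (auto simp: pinv mult.commute[of "1 / _"] elim!: eventually_mono)
    finally show "emeasure (distr C B snd) S = emeasure B S" by simp
  qed simp
  have "prob_space (distr C A fst)" unfolding dA by fact
  then have "prob_space C" by (rule prob_space_distrD[rotated]) measurable
  moreover have "AE x in C. f (fst x) = g (snd x)"
    unfolding C_def by (subst AE_density) (auto simp: h_def)
  ultimately show ?thesis using that sC dA dB by blast
qed

lemma floor_divide_dist:
  fixes a b w :: real
  assumes "\<lfloor>a / w\<rfloor> = \<lfloor>b / w\<rfloor>" "w > 0"
  shows "\<bar>a - b\<bar> \<le> w"
proof -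
  have "\<bar>a / w - b / w\<bar> \<le> 1" using assms(1) by linarith
  then show ?thesis using assms(2) by (simp add: diff_divide_distrib[symmetric] abs_divide divide_le_eq)
qed

text \<open>A third space \<open>\<Omega>\<close> carries copies \<open>U'\<close> and
  \<open>V'\<close> that are close to each other. Gluing \<open>A\<close> to \<open>\<Omega>\<close>
  along the grid cell of \<open>U\<close>, and the result to \<open>B\<close> along the cell of
  \<open>V\<close>, transports this closeness with a loss of one grid width per gluing. The
  constants come from bounding the square of \<open>\<bar>a\<bar> + 2 * w\<close> by
  \<open>2 * a^2 + 8 * w^2\<close>.\<close>

lemma coupling_of_functions:
  fixes U :: "'a \<Rightarrow> real" and V :: "'b \<Rightarrow> real" and U' V' :: "'c \<Rightarrow> real"
  assumes "prob_space A" "prob_space B" "prob_space \<Omega>"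
    and [measurable]: "U \<in> borel_measurable A" "V \<in> borel_measurable B"
    and [measurable]: "U' \<in> borel_measurable \<Omega>" "V' \<in> borel_measurable \<Omega>"
    and eqU: "distr A borel U = distr \<Omega> borel U'" and eqV: "distr B borel V = distr \<Omega> borel V'"
    and int: "integrable \<Omega> (\<lambda>x. (U' x - V' x)\<^sup>2)" and w: "w > 0"
  obtains C where "prob_space C" "sets C = sets (A \<Otimes>\<^sub>M B)"
    "distr C A fst = A" "distr C B snd = B"
    "integrable C (\<lambda>z. (U (fst z) - V (snd z))\<^sup>2)"
    "(\<integral>z. (U (fst z) - V (snd z))\<^sup>2 \<partial>C) \<le> 2 * (\<integral>x. (U' x - V' x)\<^sup>2 \<partial>\<Omega>) + 8 * w\<^sup>2"
proof -
  interpret \<Omega>: prob_space \<Omega> by fact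
  let ?b = "\<lambda>x::real. \<lfloor>x / w\<rfloor>"
  have b[measurable]: "?b \<in> borel \<rightarrow>\<^sub>M count_space UNIV" by measurable
  have "distr A (count_space UNIV) (?b \<circ> U) = distr \<Omega> (count_space UNIV) (?b \<circ> U')"
    by (subst (1 2) distr_distr[symmetric, OF b]) (auto simp: eqU)
  then obtain C1 where C1: "prob_space C1" "sets C1 = sets (A \<Otimes>\<^sub>M \<Omega>)"
    "distr C1 A fst = A" "distr C1 \<Omega> snd = \<Omega>" "AE x in C1. (?b \<circ> U) (fst x) = (?b \<circ> U') (snd x)"
    by (rule discrete_coupling[OF assms(1,3), rotated 2]) (auto simp: comp_def)
  note C1(2)[measurable_cong]
  interpret C1: prob_space C1 by fact
  \<comment> \<open>Second gluing: \<open>V'\<close> is regarded as a function on the first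
    coupling, whose second component still has the law \<open>\<Omega>\<close>.\<close>
  have "distr C1 (count_space UNIV) (?b \<circ> (V' \<circ> snd)) = distr (distr (distr C1 \<Omega> snd) borel V') (count_space UNIV) ?b"
    by (subst (1 2) distr_distr) (auto simp: comp_def)
  also have "\<dots> = distr (distr B borel V) (count_space UNIV) ?b" by (simp add: C1(4) eqV)
  also have "\<dots> = distr B (count_space UNIV) (?b \<circ> V)"
    by (subst distr_distr) auto
  finally obtain C2 where C2: "prob_space C2" "sets C2 = sets (C1 \<Otimes>\<^sub>M B)"
    "distr C2 C1 fst = C1" "distr C2 B snd = B" "AE x in C2. (?b \<circ> (V' \<circ> snd)) (fst x) = (?b \<circ> V) (snd x)"
    by (rule discrete_coupling[OF C1(1) assms(2), rotated 2]) (auto simp: comp_def)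
  interpret C2: prob_space C2 by fact
  have sC2[measurable_cong]: "sets C2 = sets ((A \<Otimes>\<^sub>M \<Omega>) \<Otimes>\<^sub>M B)"
    using C2(2) C1(2) by (simp cong: sets_pair_measure_cong)
  \<comment> \<open>The auxiliary component is dropped; the two outer components keep their
    laws.\<close>
  let ?q = "\<lambda>z :: ('a \<times> 'c) \<times> 'b. (fst (fst z), snd z)"
  have q[measurable]: "?q \<in> C2 \<rightarrow>\<^sub>M A \<Otimes>\<^sub>M B" by measurable
  define C where "C = distr C2 (A \<Otimes>\<^sub>M B) ?q"
  have "prob_space C" unfolding C_def by (rule C2.prob_space_distr) measurable
  moreover have "sets C = sets (A \<Otimes>\<^sub>M B)" by (simp add: C_def)
  moreover have "distr C A fst = A"
  proof -
    have "distr C A fst = distr (distr C2 C1 fst) A fst"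
      unfolding C_def by (subst (1 2) distr_distr) (auto simp: comp_def)
    then show ?thesis by (simp add: C2 C1)
  qed
  moreover have "distr C B snd = B"
  proof -
    have "distr C B snd = distr C2 B snd"
      unfolding C_def by (subst distr_distr) (auto simp: comp_def)
    then show ?thesis by (simp add: C2)
  qed
  moreover have *: "integrable C2 (\<lambda>z. (U (fst (fst z)) - V (snd z))\<^sup>2) \<and>
    (\<integral>z. (U (fst (fst z)) - V (snd z))\<^sup>2 \<partial>C2) \<le> 2 * (\<integral>x. (U' x - V' x)\<^sup>2 \<partial>\<Omega>) + 8 * w\<^sup>2"
  proof -
    have d: "distr C2 \<Omega> (\<lambda>z. snd (fst z)) = \<Omega>"
    proof -
      have "distr C2 \<Omega> (\<lambda>z. snd (fst z)) = distr (distr C2 C1 fst) \<Omega> snd"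
        by (subst distr_distr) (auto simp: comp_def)
      then show ?thesis by (simp add: C2 C1)
    qed
    have sm[measurable]: "(\<lambda>z. snd (fst z)) \<in> C2 \<rightarrow>\<^sub>M \<Omega>" by measurable
    have int2: "integrable C2 (\<lambda>z. (U' (snd (fst z)) - V' (snd (fst z)))\<^sup>2)"
      using int integrable_distr[OF sm, of "\<lambda>x. (U' x - V' x)\<^sup>2"] by (simp add: d)
    have eq2: "(\<integral>z. (U' (snd (fst z)) - V' (snd (fst z)))\<^sup>2 \<partial>C2) = (\<integral>x. (U' x - V' x)\<^sup>2 \<partial>\<Omega>)"
      using integral_distr[OF sm, of "\<lambda>x. (U' x - V' x)\<^sup>2"] by (simp add: d)
    have "AE z in C2. (?b \<circ> U) (fst (fst z)) = (?b \<circ> U') (snd (fst z))"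
      using C1(5) by (subst (asm) C2(3)[symmetric]) (rule AE_distrD[rotated], auto)
    with C2(5) have le: "AE z in C2. (U (fst (fst z)) - V (snd z))\<^sup>2 \<le>
      2 * (U' (snd (fst z)) - V' (snd (fst z)))\<^sup>2 + 8 * w\<^sup>2"
    proof eventually_elim
      case (elim z)
      have 1: "\<bar>V' (snd (fst z)) - V (snd z)\<bar> \<le> w" "\<bar>U (fst (fst z)) - U' (snd (fst z))\<bar> \<le> w"
        using elim w by (auto intro!: floor_divide_dist)
      define a where "a = U' (snd (fst z)) - V' (snd (fst z))"
      have "\<bar>U (fst (fst z)) - V (snd z)\<bar> \<le> \<bar>\<bar>a\<bar> + 2 * w\<bar>" using 1 unfolding a_def by linarith
      then have "(U (fst (fst z)) - V (snd z))\<^sup>2 \<le> (\<bar>a\<bar> + 2 * w)\<^sup>2" by (simp add: abs_le_square_iff)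
      also have "\<dots> \<le> 2 * \<bar>a\<bar>\<^sup>2 + 8 * w\<^sup>2"
        using sum_squares_bound[of "\<bar>a\<bar>" "2 * w"] by (simp add: power2_sum power_mult_distrib)
      finally show ?case by (simp add: a_def)
    qed
    have I: "integrable C2 (\<lambda>z. (U (fst (fst z)) - V (snd z))\<^sup>2)"
      by (rule Bochner_Integration.integrable_bound[where
            f="\<lambda>z. 2 * (U' (snd (fst z)) - V' (snd (fst z)))\<^sup>2 + 8 * w\<^sup>2"])
         (use int2 le in \<open>auto elim!: eventually_mono\<close>)
    have "(\<integral>z. (U (fst (fst z)) - V (snd z))\<^sup>2 \<partial>C2) \<le>
      (\<integral>z. 2 * (U' (snd (fst z)) - V' (snd (fst z)))\<^sup>2 + 8 * w\<^sup>2 \<partial>C2)"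
      by (rule integral_mono_AE[OF I _ le]) (use int2 in auto)
    also have "\<dots> = 2 * (\<integral>x. (U' x - V' x)\<^sup>2 \<partial>\<Omega>) + 8 * w\<^sup>2"
      using int2 by (subst Bochner_Integration.integral_add) (auto simp: eq2 C2.prob_space)
    finally show ?thesis using I by auto
  qed
  moreover have "integrable C (\<lambda>z. (U (fst z) - V (snd z))\<^sup>2)"
    using * unfolding C_def by (subst integrable_distr_eq) auto
  moreover have "(\<integral>z. (U (fst z) - V (snd z))\<^sup>2 \<partial>C) \<le> 2 * (\<integral>x. (U' x - V' x)\<^sup>2 \<partial>\<Omega>) + 8 * w\<^sup>2"
    using * unfolding C_def by (subst integral_distr) auto
  ultimately show ?thesis using that by blast
qed

text \<open>Pointwise convergence and equal second moments give convergence in mean square. Fatou's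
  lemma is applied to the nonnegative functions \<open>?g n\<close>, whose integrals are
  \<open>4 * c - d n\<close> and whose pointwise limit has the integral \<open>4 * c\<close>; hence
  \<open>d n\<close> cannot stay away from 0.\<close>

lemma Skorohod_L2:
  fixes \<mu> :: "nat \<Rightarrow> real measure"
  assumes \<mu>: "\<And>n. real_distribution (\<mu> n)" and M: "real_distribution M"
    and conv: "weak_conv_m \<mu> M"
    and sq: "\<And>n. integrable (\<mu> n) (\<lambda>x. x\<^sup>2)" "integrable M (\<lambda>x. x\<^sup>2)"
    and eq: "\<And>n. (\<integral>x. x\<^sup>2 \<partial>\<mu> n) = (\<integral>x. x\<^sup>2 \<partial>M)"
  obtains \<Omega> :: "real measure" and Y :: "nat \<Rightarrow> real \<Rightarrow> real" and Y' :: "real \<Rightarrow> real"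
  where "prob_space \<Omega>" "\<And>n. Y n \<in> borel_measurable \<Omega>" "Y' \<in> borel_measurable \<Omega>"
    "\<And>n. distr \<Omega> borel (Y n) = \<mu> n" "distr \<Omega> borel Y' = M"
    "\<And>n. integrable \<Omega> (\<lambda>x. (Y n x - Y' x)\<^sup>2)" "(\<lambda>n. \<integral>x. (Y n x - Y' x)\<^sup>2 \<partial>\<Omega>) \<longlonglongrightarrow> 0"
proof -
  obtain \<Omega> :: "real measure" and Y Y' where P: "prob_space \<Omega>"
    and Y[measurable]: "\<And>n::nat. Y n \<in> borel_measurable \<Omega>" and Y': "Y' \<in> \<Omega> \<rightarrow>\<^sub>M lborel"
    and dY: "\<And>n. distr \<Omega> borel (Y n) = \<mu> n" and dY': "distr \<Omega> borel Y' = M"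
    and lim: "\<And>x. x \<in> space \<Omega> \<Longrightarrow> (\<lambda>n. Y n x) \<longlonglongrightarrow> Y' x"
    using Skorohod[OF \<mu> M conv] by blast
  have Y'm[measurable]: "Y' \<in> borel_measurable \<Omega>" using Y' by simp
  interpret \<Omega>: prob_space \<Omega> by fact
  define c where "c = (\<integral>x. x\<^sup>2 \<partial>M)"
  have iY: "integrable \<Omega> (\<lambda>x. (Y n x)\<^sup>2)" and eY: "(\<integral>x. (Y n x)\<^sup>2 \<partial>\<Omega>) = c" for n
    using sq(1)[of n] eq[of n] unfolding dY[symmetric] c_def
    by (auto simp: integrable_distr_eq integral_distr)
  have iY': "integrable \<Omega> (\<lambda>x. (Y' x)\<^sup>2)" and eY': "(\<integral>x. (Y' x)\<^sup>2 \<partial>\<Omega>) = c"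
    using sq(2) unfolding dY'[symmetric] c_def
    by (auto simp: integrable_distr_eq integral_distr)
  have le: "(Y n x - Y' x)\<^sup>2 \<le> 2 * (Y n x)\<^sup>2 + 2 * (Y' x)\<^sup>2" for n x
    using zero_le_power2[of "Y n x + Y' x"] by (simp add: power2_sum power2_diff)
  have iD: "integrable \<Omega> (\<lambda>x. (Y n x - Y' x)\<^sup>2)" for n
    by (rule Bochner_Integration.integrable_bound[where f="\<lambda>x. 2 * (Y n x)\<^sup>2 + 2 * (Y' x)\<^sup>2"])
       (use iY iY' le in auto)
  define d where "d n = (\<integral>x. (Y n x - Y' x)\<^sup>2 \<partial>\<Omega>)" for n
  have d0: "d n \<ge> 0" for n by (simp add: d_def)
  let ?g = "\<lambda>n x. 2 * (Y n x)\<^sup>2 + 2 * (Y' x)\<^sup>2 - (Y n x - Y' x)\<^sup>2"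
  have g: "(\<integral>\<^sup>+x. ennreal (?g n x) \<partial>\<Omega>) = ennreal (4 * c - d n)" for n
    using iY iY' iD le by (subst nn_integral_eq_integral) (auto simp: eY eY' d_def)
  have "ennreal (4 * c) = (\<integral>\<^sup>+x. ennreal (4 * (Y' x)\<^sup>2) \<partial>\<Omega>)"
    using iY' by (subst nn_integral_eq_integral) (auto simp: eY')
  also have "\<dots> = (\<integral>\<^sup>+x. liminf (\<lambda>n. ennreal (?g n x)) \<partial>\<Omega>)"
  proof (rule nn_integral_cong)
    fix x assume x: "x \<in> space \<Omega>"
    have "(\<lambda>n. ennreal (?g n x)) \<longlonglongrightarrow> ennreal (2 * (Y' x)\<^sup>2 + 2 * (Y' x)\<^sup>2 - (Y' x - Y' x)\<^sup>2)"
      by (intro tendsto_intros lim x)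
    then show "ennreal (4 * (Y' x)\<^sup>2) = liminf (\<lambda>n. ennreal (?g n x))"
      by (intro lim_imp_Liminf[symmetric]) auto
  qed
  also have "\<dots> \<le> liminf (\<lambda>n. \<integral>\<^sup>+x. ennreal (?g n x) \<partial>\<Omega>)"
    by (rule nn_integral_liminf) measurable
  finally have lf: "ennreal (4 * c) \<le> liminf (\<lambda>n. ennreal (4 * c - d n))" by (simp only: g)
  have "d \<longlonglongrightarrow> 0"
  proof (rule LIMSEQ_I)
    fix r :: real assume r: "r > 0"
    have c0: "c \<ge> 0" unfolding c_def by simp
    show "\<exists>no. \<forall>n\<ge>no. norm (d n - 0) < r"
    proof (cases "c = 0")
      case True
      have "4 * c - d n \<ge> 0" for n
      proof -
        have "0 \<le> (\<integral>x. ?g n x \<partial>\<Omega>)" using le by (intro integral_nonneg_AE) auto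
        also have "\<dots> = 4 * c - d n" using iY iY' iD by (simp add: eY eY' d_def)
        finally show ?thesis .
      qed
      then have "d n = 0" for n using d0[of n] True by (simp add: order_antisym)
      then show ?thesis using r by auto
    next
      case False
      \<comment> \<open>The cap \<open>2 * c\<close> keeps \<open>4 * c - r'\<close> nonnegative, so
        that \<open>ennreal\<close> does not truncate it and the comparison can be read back in the
        reals. It leaves no positive choice if \<open>c = 0\<close>, hence the case
        distinction.\<close>
      define r' where "r' = min r (2 * c)"
      have r': "0 < r'" "r' \<le> r" "r' \<le> 2 * c" using r False c0 by (auto simp: r'_def)
      have "ennreal (4 * c - r') < ennreal (4 * c)" using r' c0 by (intro ennreal_lessI) auto
      with lf have "ennreal (4 * c - r') < liminf (\<lambda>n. ennreal (4 * c - d n))" by (rule less_le_trans[rotated])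
      then have "eventually (\<lambda>n. ennreal (4 * c - r') < ennreal (4 * c - d n)) sequentially"
        by (rule less_LiminfD)
      then obtain no where no: "\<And>n. n \<ge> no \<Longrightarrow> ennreal (4 * c - r') < ennreal (4 * c - d n)"
        by (auto simp: eventually_sequentially)
      have "d n < r" if "n \<ge> no" for n
        using no[OF that] r' c0 by (subst (asm) ennreal_less_iff) auto
      then show ?thesis using d0 by auto
    qed
  qed
  then show ?thesis using that[OF P Y Y'm dY dY' iD] by (simp add: d_def[abs_def])
qed

text \<open>A joint event is sorted by the coordinate that each variable reads: the product measure
  factors over coordinates, the hypothesis factors within each of them. In the application a
  coordinate is a pair of whole sequences, of which only one block is read.\<close>

lemma indep_vars_PiM_nested:
  fixes C :: "'k \<Rightarrow> 'c measure" and g :: "'i \<Rightarrow> 'c \<Rightarrow> 'd"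
  assumes C: "\<And>k. prob_space (C k)" and b: "\<And>i. i \<in> I \<Longrightarrow> b i \<in> K"
    and ind: "\<And>k. k \<in> K \<Longrightarrow> prob_space.indep_vars (C k) N g {i\<in>I. b i = k}"
  shows "prob_space.indep_vars (PiM K C) N (\<lambda>i \<omega>. g i (\<omega> (b i))) I"
proof -
  interpret Ck: prob_space "C k" for k by fact
  interpret P: product_prob_space C K ..
  have gm: "g i \<in> C (b i) \<rightarrow>\<^sub>M N i" if "i \<in> I" for i
    using Ck.indep_vars_rv[OF ind[OF b[OF that]], of i] that by auto
  have gm': "(\<lambda>\<omega>. g i (\<omega> (b i))) \<in> PiM K C \<rightarrow>\<^sub>M N i" if "i \<in> I" for i
    using gm[OF that] b[OF that] by (intro measurable_compose[OF measurable_component_singleton])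
  show ?thesis
    unfolding P.indep_vars_def2
  proof (intro conjI ballI P.indep_setsI)
    fix J A assume J: "J \<noteq> {}" "J \<subseteq> I" "finite J"
      and "\<forall>j\<in>J. A j \<in> {(\<lambda>\<omega>. g j (\<omega> (b j))) -` A \<inter> space (PiM K C) |A. A \<in> sets (N j)}"
    then have "\<forall>j\<in>J. \<exists>B. B \<in> sets (N j) \<and> A j = (\<lambda>\<omega>. g j (\<omega> (b j))) -` B \<inter> space (PiM K C)"
      by auto
    then obtain B where B: "\<And>j. j \<in> J \<Longrightarrow> B j \<in> sets (N j)"
      "\<And>j. j \<in> J \<Longrightarrow> A j = (\<lambda>\<omega>. g j (\<omega> (b j))) -` B j \<inter> space (PiM K C)"
      by metis
    define E where "E k = (\<Inter>j\<in>{j\<in>J. b j = k}. g j -` B j \<inter> space (C k))" for k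
    have bJ: "b ` J \<subseteq> K" "finite (b ` J)" using J b by auto
    have nonempty: "{j\<in>J. b j = k} \<noteq> {}" if "k \<in> b ` J" for k using that by auto
    have E: "E k \<in> sets (C k)" if "k \<in> b ` J" for k
      unfolding E_def using nonempty[OF that] J B gm by (intro sets.finite_INT) (auto intro!: measurable_sets)
    have "(\<Inter>j\<in>J. A j) = {\<omega>\<in>space (PiM K C). \<forall>k\<in>b ` J. \<omega> k \<in> E k}"
    proof (intro equalityI subsetI)
      fix \<omega> assume w: "\<omega> \<in> (\<Inter>j\<in>J. A j)"
      then have "\<omega> \<in> space (PiM K C)" using J(1) B by auto
      moreover have "g j (\<omega> (b j)) \<in> B j" if "j \<in> J" for j
        using w B(2)[OF that] that by auto
      ultimately show "\<omega> \<in> {\<omega>\<in>space (PiM K C). \<forall>k\<in>b ` J. \<omega> k \<in> E k}"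
        using bJ by (fastforce simp: E_def space_PiM PiE_iff)
    next
      fix \<omega> assume w: "\<omega> \<in> {\<omega>\<in>space (PiM K C). \<forall>k\<in>b ` J. \<omega> k \<in> E k}"
      show "\<omega> \<in> (\<Inter>j\<in>J. A j)"
      proof
        fix j assume j: "j \<in> J"
        then have "\<omega> (b j) \<in> E (b j)" using w by auto
        then have "g j (\<omega> (b j)) \<in> B j" unfolding E_def using j by blast
        then show "\<omega> \<in> A j" using w j B(2)[OF j] by auto
      qed
    qed
    then have "P.prob (\<Inter>j\<in>J. A j) = (\<Prod>k\<in>b ` J. Ck.prob k (E k))"
      using P.emeasure_PiM_Collect[OF bJ, of E] E
      by (simp add: P.emeasure_eq_measure Ck.emeasure_eq_measure prod_ennreal prod_nonneg)
    also have "\<dots> = (\<Prod>k\<in>b ` J. \<Prod>j\<in>{j\<in>J. b j = k}. Ck.prob k (g j -` B j \<inter> space (C k)))"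
      unfolding E_def using J B nonempty bJ
      by (intro prod.cong refl Ck.indep_varsD[OF ind]) auto
    also have "\<dots> = (\<Prod>k\<in>b ` J. \<Prod>j\<in>{j\<in>J. b j = k}. P.prob (A j))"
    proof (intro prod.cong refl)
      fix k j assume "k \<in> b ` J" and j: "j \<in> {j\<in>J. b j = k}"
      have "A j = {\<omega>\<in>space (PiM K C). \<omega> k \<in> g j -` B j \<inter> space (C k)}"
        using B(2)[of j] j bJ \<open>k \<in> b ` J\<close> by (fastforce simp: space_PiM PiE_iff extensional_def)
      moreover have "g j -` B j \<inter> space (C k) \<in> sets (C k)"
        using gm[of j] j J B by (auto intro!: measurable_sets)
      ultimately show "Ck.prob k (g j -` B j \<inter> space (C k)) = P.prob (A j)"
        using P.emeasure_PiM_Collect_single[of k "g j -` B j \<inter> space (C k)"] bJ \<open>k \<in> b ` J\<close>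
        by (auto simp: P.emeasure_eq_measure Ck.emeasure_eq_measure)
    qed
    also have "\<dots> = (\<Prod>j\<in>J. P.prob (A j))"
      using J by (intro prod.image_gen[symmetric])
    finally show "P.prob (\<Inter>j\<in>J. A j) = (\<Prod>j\<in>J. P.prob (A j))" .
  qed (use gm' in auto)
qed

lemma (in prob_space) indep_vars_singleton:
  assumes "random_variable (N i) (X i)"
  shows "indep_vars N X {i}"
  unfolding indep_vars_def2
proof (intro conjI indep_setsI)
  fix J A assume "J \<noteq> {}" "J \<subseteq> {i}"
  then have "J = {i}" by auto
  then show "prob (\<Inter>j\<in>J. A j) = (\<Prod>j\<in>J. prob (A j))" by simp
qed (use assms in auto)

section \<open>The Lindeberg central limit theorem\<close>

text \<open>The Taylor polynomial of degree 2 is an upper bound because the cubic remainder has the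
  sign of the cube of \<open>- a\<close>.\<close>

lemma abs_exp_minus_le:
  fixes a :: real
  assumes "a \<ge> 0"
  shows "\<bar>exp (- a) - (1 - a)\<bar> \<le> a\<^sup>2 / 2"
proof -
  have 1: "1 - a \<le> exp (- a)" using exp_ge_add_one_self[of "-a"] by simp
  have "exp (- a) \<le> 1 - a + a\<^sup>2 / 2"
  proof (cases "a = 0")
    case False
    then obtain t where "\<bar>t\<bar> \<le> \<bar>- a\<bar>" "exp (- a) = (\<Sum>m<3. (- a) ^ m / fact m) + exp t / fact 3 * (- a) ^ 3"
      using Maclaurin_exp_le[of "-a" 3] by blast
    moreover have "exp t / fact 3 * (- a) ^ 3 \<le> 0"
      using assms by (intro mult_nonneg_nonpos) (auto simp: power_minus_odd)
    ultimately show ?thesis by (simp add: numeral_3_eq_3 power2_eq_square)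
  qed simp
  with 1 show ?thesis by simp
qed

text \<open>The characteristic functions are compared factor by factor with those of normal
  variables of the same variances; for factors of modulus at most 1, the products differ by at most
  the sum of the differences. The index sets are arbitrary finite sets, since the result is needed
  for blocks and not for initial segments.\<close>

lemma (in prob_space) lindeberg_clt:
  fixes X :: "'i \<Rightarrow> 'a \<Rightarrow> real" and I :: "nat \<Rightarrow> 'i set"
  assumes fin: "\<And>k. finite (I k)" and ind: "\<And>k. indep_vars (\<lambda>_. borel) X (I k)"
    and mean: "\<And>k i. i \<in> I k \<Longrightarrow> expectation (X i) = 0"
    and sq: "\<And>k i. i \<in> I k \<Longrightarrow> integrable M (\<lambda>\<omega>. (X i \<omega>)\<^sup>2)"
    and v: "\<And>k. v k = (\<Sum>i\<in>I k. expectation (\<lambda>\<omega>. (X i \<omega>)\<^sup>2))" and v_pos: "\<And>k. v k > 0"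
    and lind: "\<And>\<epsilon>. \<epsilon> > 0 \<Longrightarrow> (\<lambda>k. (\<Sum>i\<in>I k. expectation
      (\<lambda>\<omega>. (X i \<omega>)\<^sup>2 * indicator {\<omega>. \<bar>X i \<omega>\<bar> \<ge> \<epsilon> * sqrt (v k)} \<omega>)) / v k) \<longlonglongrightarrow> 0"
  shows "weak_conv_m (\<lambda>k. distr M borel (\<lambda>\<omega>. (\<Sum>i\<in>I k. X i \<omega>) / sqrt (v k))) std_normal_distribution"
proof (rule levy_continuity)
  have rv: "random_variable borel (X i)" if "i \<in> I k" for i k
    using indep_vars_rv[OF ind that] .
  show "real_distribution (distr M borel (\<lambda>\<omega>. (\<Sum>i\<in>I k. X i \<omega>) / sqrt (v k)))" for k
    by (intro real_distribution_distr borel_measurable_divide borel_measurable_sum rv) auto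
  show "real_distribution std_normal_distribution" by (rule real_dist_normal_dist)
  fix t :: real
  define L where "L \<epsilon> k = (\<Sum>i\<in>I k. expectation
      (\<lambda>\<omega>. (X i \<omega>)\<^sup>2 * indicator {\<omega>. \<bar>X i \<omega>\<bar> \<ge> \<epsilon> * sqrt (v k)} \<omega>)) / v k" for \<epsilon> k
  \<comment> \<open>The three terms come from the values above \<open>\<epsilon>\<close>, where
    second moments are used, from the values below \<open>\<epsilon>\<close>, where the third moment
    is at most \<open>\<epsilon>\<close> times the second, and from replacing \<open>1 - x\<close>
    by \<open>exp (- x)\<close>, which needs uniformly small variances.\<close>
  have bound: "norm (char (distr M borel (\<lambda>\<omega>. (\<Sum>i\<in>I k. X i \<omega>) / sqrt (v k))) t - exp (- t\<^sup>2 / 2))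
      \<le> t\<^sup>2 * L \<epsilon> k + \<bar>t\<bar>^3 * \<epsilon> / 6 + t^4 * (\<epsilon>\<^sup>2 + L \<epsilon> k) / 8" if \<epsilon>: "\<epsilon> > 0" for \<epsilon> k
  proof -
    define V where "V = v k"
    have V: "V > 0" "sqrt V > 0" using v_pos[of k] by (auto simp: V_def)
    define \<xi> where "\<xi> i \<omega> = X i \<omega> / sqrt V" for i \<omega>
    define s where "s i = expectation (\<lambda>\<omega>. (\<xi> i \<omega>)\<^sup>2)" for i
    define l where "l i = expectation (\<lambda>\<omega>. (\<xi> i \<omega>)\<^sup>2 * indicator {\<omega>. \<bar>\<xi> i \<omega>\<bar> \<ge> \<epsilon>} \<omega>)" for i
    have ind_eq: "{\<omega>. \<bar>\<xi> i \<omega>\<bar> \<ge> \<epsilon>} = {\<omega>. \<bar>X i \<omega>\<bar> \<ge> \<epsilon> * sqrt V}" for i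
      using V by (auto simp: \<xi>_def abs_divide le_divide_eq)
    have sq_eq: "(\<xi> i \<omega>)\<^sup>2 = (X i \<omega>)\<^sup>2 / V" for i \<omega>
      using V by (simp add: \<xi>_def power_divide)
    have s_sum: "(\<Sum>i\<in>I k. s i) = 1"
      using V by (simp add: s_def sq_eq sum_divide_distrib[symmetric] v[symmetric] V_def)
    have l_sum: "(\<Sum>i\<in>I k. l i) = L \<epsilon> k"
      by (simp add: l_def sq_eq ind_eq L_def V_def sum_divide_distrib)
    have \<xi>_rv[measurable]: "random_variable borel (\<xi> i)" if "i \<in> I k" for i
      unfolding \<xi>_def using rv[OF that] by measurable
    have \<xi>_sq: "integrable M (\<lambda>\<omega>. (\<xi> i \<omega>)\<^sup>2)" if "i \<in> I k" for i
      using sq[OF that] by (simp add: sq_eq)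
    have \<xi>_int: "integrable M (\<xi> i)" if "i \<in> I k" for i
      using square_integrable_imp_integrable[OF \<xi>_rv \<xi>_sq] that by auto
    have \<xi>_mean: "expectation (\<xi> i) = 0" if "i \<in> I k" for i
      using mean[OF that] by (simp add: \<xi>_def[abs_def])
    have li: "integrable M (\<lambda>\<omega>. (\<xi> i \<omega>)\<^sup>2 * indicator {\<omega>. \<bar>\<xi> i \<omega>\<bar> \<ge> \<epsilon>} \<omega>)" if "i \<in> I k" for i
    proof (rule Bochner_Integration.integrable_bound[OF \<xi>_sq[OF that]])
      have "(\<lambda>\<omega>. (\<xi> i \<omega>)\<^sup>2 * (if \<bar>\<xi> i \<omega>\<bar> \<ge> \<epsilon> then 1 else 0)) \<in> borel_measurable M"
        using \<xi>_rv[OF that] by measurable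
      then show "(\<lambda>\<omega>. (\<xi> i \<omega>)\<^sup>2 * indicator {\<omega>. \<bar>\<xi> i \<omega>\<bar> \<ge> \<epsilon>} \<omega>) \<in> borel_measurable M"
        by (simp add: indicator_def of_bool_def)
    qed (auto split: split_indicator)
    have s0: "s i \<ge> 0" "l i \<ge> 0" for i by (auto simp: s_def l_def intro!: integral_nonneg_AE)
    \<comment> \<open>No summand dominates: its variance is at most the truncated part
      \<open>\<epsilon>\<^sup>2\<close> plus its share of the Lindeberg sum.\<close>
    have s_le: "s i \<le> \<epsilon>\<^sup>2 + L \<epsilon> k" if i: "i \<in> I k" for i
    proof -
      have "s i \<le> expectation (\<lambda>\<omega>. \<epsilon>\<^sup>2 + (\<xi> i \<omega>)\<^sup>2 * indicator {\<omega>. \<bar>\<xi> i \<omega>\<bar> \<ge> \<epsilon>} \<omega>)"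
        unfolding s_def
      proof (rule integral_mono[OF \<xi>_sq[OF i]])
        fix \<omega>
        have "(\<xi> i \<omega>)\<^sup>2 \<le> \<epsilon>\<^sup>2" if "\<not> \<bar>\<xi> i \<omega>\<bar> \<ge> \<epsilon>"
          using that \<epsilon> by (simp add: abs_le_square_iff[symmetric])
        then show "(\<xi> i \<omega>)\<^sup>2 \<le> \<epsilon>\<^sup>2 + (\<xi> i \<omega>)\<^sup>2 * indicator {\<omega>. \<bar>\<xi> i \<omega>\<bar> \<ge> \<epsilon>} \<omega>"
          by (auto split: split_indicator)
      qed (use li[OF i] in auto)
      also have "\<dots> = \<epsilon>\<^sup>2 + l i" using li[OF i] by (simp add: l_def prob_space)
      also have "l i \<le> L \<epsilon> k" unfolding l_sum[symmetric] by (rule member_le_sum) (use i fin s0 in auto)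
      finally show ?thesis by simp
    qed
    have char_eq: "char (distr M borel (\<lambda>\<omega>. (\<Sum>i\<in>I k. X i \<omega>) / sqrt (v k))) t
      = (\<Prod>i\<in>I k. char (distr M borel (\<xi> i)) t)"
    proof -
      have "indep_vars (\<lambda>_. borel) \<xi> (I k)"
        unfolding \<xi>_def by (rule indep_vars_compose2[OF ind]) measurable
      from char_distr_sum[OF this] show ?thesis
        by (simp add: \<xi>_def sum_divide_distrib V_def)
    qed
    have exp_eq: "complex_of_real (exp (- t\<^sup>2 / 2)) = (\<Prod>i\<in>I k. complex_of_real (exp (- (t\<^sup>2 * s i / 2))))"
    proof -
      have "(\<Prod>i\<in>I k. exp (- (t\<^sup>2 * s i / 2))) = exp (\<Sum>i\<in>I k. - (t\<^sup>2 * s i / 2))"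
        by (rule exp_sum[symmetric, OF fin])
      also have "(\<Sum>i\<in>I k. - (t\<^sup>2 * s i / 2)) = - (t\<^sup>2 / 2) * (\<Sum>i\<in>I k. s i)"
        by (simp add: sum_distrib_left sum_negf)
      finally show ?thesis by (simp add: s_sum of_real_prod[symmetric] del: of_real_exp)
    qed
    have one: "norm (char (distr M borel (\<xi> i)) t - complex_of_real (exp (- (t\<^sup>2 * s i / 2))))
      \<le> t\<^sup>2 * l i + \<bar>t\<bar>^3 * \<epsilon> / 6 * s i + t^4 * (\<epsilon>\<^sup>2 + L \<epsilon> k) / 8 * s i" if i: "i \<in> I k" for i
    proof -
      let ?m = "\<lambda>\<omega>. min (6 * (\<xi> i \<omega>)\<^sup>2) (\<bar>t\<bar> * \<bar>\<xi> i \<omega>\<bar> ^ 3)"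
      have var: "variance (\<xi> i) = s i" by (simp add: \<xi>_mean[OF i] s_def)
      have mi: "integrable M ?m"
        by (rule Bochner_Integration.integrable_bound[where f="\<lambda>\<omega>. 6 * (\<xi> i \<omega>)\<^sup>2"])
           (use \<xi>_sq[OF i] \<xi>_rv[OF i] in \<open>auto simp: min_def\<close>)
      \<comment> \<open>The quadratic argument of the minimum serves the values above
        \<open>\<epsilon>\<close>, the cubic one those below.\<close>
      have "expectation ?m \<le> expectation (\<lambda>\<omega>. 6 * ((\<xi> i \<omega>)\<^sup>2 * indicator {\<omega>. \<bar>\<xi> i \<omega>\<bar> \<ge> \<epsilon>} \<omega>) + \<bar>t\<bar> * \<epsilon> * (\<xi> i \<omega>)\<^sup>2)"
      proof (rule integral_mono[OF mi])
        show "integrable M (\<lambda>\<omega>. 6 * ((\<xi> i \<omega>)\<^sup>2 * indicator {\<omega>. \<bar>\<xi> i \<omega>\<bar> \<ge> \<epsilon>} \<omega>) + \<bar>t\<bar> * \<epsilon> * (\<xi> i \<omega>)\<^sup>2)"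
          using li[OF i] \<xi>_sq[OF i] by auto
        fix \<omega>
        show "?m \<omega> \<le> 6 * ((\<xi> i \<omega>)\<^sup>2 * indicator {\<omega>. \<bar>\<xi> i \<omega>\<bar> \<ge> \<epsilon>} \<omega>) + \<bar>t\<bar> * \<epsilon> * (\<xi> i \<omega>)\<^sup>2"
        proof (cases "\<bar>\<xi> i \<omega>\<bar> \<ge> \<epsilon>")
          case True
          then show ?thesis using \<epsilon> by (simp add: min.coboundedI1)
        next
          case False
          then have "\<bar>t\<bar> * (\<bar>\<xi> i \<omega>\<bar> * (\<xi> i \<omega>)\<^sup>2) \<le> \<bar>t\<bar> * (\<epsilon> * (\<xi> i \<omega>)\<^sup>2)"
            by (intro mult_left_mono mult_right_mono) auto
          moreover have "\<bar>\<xi> i \<omega>\<bar> ^ 3 = \<bar>\<xi> i \<omega>\<bar> * (\<xi> i \<omega>)\<^sup>2"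
            by (simp add: power3_eq_cube power2_eq_square abs_mult_self_eq mult.assoc)
          ultimately show ?thesis using False by (simp add: min.coboundedI2 mult.assoc)
        qed
      qed
      also have "\<dots> = 6 * l i + \<bar>t\<bar> * \<epsilon> * s i"
        using li[OF i] \<xi>_sq[OF i] by (simp add: l_def s_def)
      finally have E: "expectation ?m \<le> 6 * l i + \<bar>t\<bar> * \<epsilon> * s i" .
      have "norm (char (distr M borel (\<xi> i)) t - (1 - t\<^sup>2 * s i / 2)) \<le> t\<^sup>2 / 6 * expectation ?m"
        using char_approx3'[OF \<xi>_rv[OF i] \<xi>_int[OF i] \<xi>_sq[OF i] \<xi>_mean[OF i] var refl, of t] by simp
      also have "\<dots> \<le> t\<^sup>2 / 6 * (6 * l i + \<bar>t\<bar> * \<epsilon> * s i)"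
        using E by (intro mult_left_mono) auto
      also have "\<dots> = t\<^sup>2 * l i + \<bar>t\<bar>^3 * \<epsilon> / 6 * s i"
        by (simp add: field_simps power3_eq_cube power2_eq_square abs_mult_self_eq)
      finally have 1: "norm (char (distr M borel (\<xi> i)) t - (1 - t\<^sup>2 * s i / 2)) \<le> t\<^sup>2 * l i + \<bar>t\<bar>^3 * \<epsilon> / 6 * s i" .
      have "norm (complex_of_real (1 - t\<^sup>2 * s i / 2) - complex_of_real (exp (- (t\<^sup>2 * s i / 2))))
          = \<bar>exp (- (t\<^sup>2 * s i / 2)) - (1 - t\<^sup>2 * s i / 2)\<bar>"
        by (simp only: of_real_diff[symmetric] norm_of_real abs_minus_commute)
      also have "\<dots> \<le> (t\<^sup>2 * s i / 2)\<^sup>2 / 2" using s0 by (intro abs_exp_minus_le) auto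
      also have "\<dots> = t^4 / 8 * s i * s i" by (simp add: power2_eq_square field_simps eval_nat_numeral)
      also have "\<dots> \<le> t^4 / 8 * (\<epsilon>\<^sup>2 + L \<epsilon> k) * s i"
        using s_le[OF i] s0 by (intro mult_right_mono mult_left_mono) auto
      finally have 2: "norm (complex_of_real (1 - t\<^sup>2 * s i / 2) - complex_of_real (exp (- (t\<^sup>2 * s i / 2))))
        \<le> t^4 * (\<epsilon>\<^sup>2 + L \<epsilon> k) / 8 * s i" by simp
      show ?thesis
        using norm_triangle_le[OF add_mono[OF 1 2]] by simp
    qed
    have "norm ((\<Prod>i\<in>I k. char (distr M borel (\<xi> i)) t) - (\<Prod>i\<in>I k. complex_of_real (exp (- (t\<^sup>2 * s i / 2)))))
      \<le> (\<Sum>i\<in>I k. norm (char (distr M borel (\<xi> i)) t - complex_of_real (exp (- (t\<^sup>2 * s i / 2)))))"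
    proof (rule norm_prod_diff)
      fix i assume i: "i \<in> I k"
      show "norm (char (distr M borel (\<xi> i)) t) \<le> 1"
        by (intro real_distribution.cmod_char_le_1 real_distribution_distr \<xi>_rv i)
      show "norm (complex_of_real (exp (- (t\<^sup>2 * s i / 2)))) \<le> 1" using s0 by (simp only: norm_of_real) simp
    qed
    also have "\<dots> \<le> (\<Sum>i\<in>I k. t\<^sup>2 * l i + \<bar>t\<bar>^3 * \<epsilon> / 6 * s i + t^4 * (\<epsilon>\<^sup>2 + L \<epsilon> k) / 8 * s i)"
      by (rule sum_mono) (rule one)
    also have "\<dots> = t\<^sup>2 * L \<epsilon> k + \<bar>t\<bar>^3 * \<epsilon> / 6 + t^4 * (\<epsilon>\<^sup>2 + L \<epsilon> k) / 8"
      by (simp only: sum.distrib sum_distrib_left[symmetric] s_sum l_sum mult_1_right)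
    finally show ?thesis unfolding char_eq exp_eq .
  qed
  have "(\<lambda>k. char (distr M borel (\<lambda>\<omega>. (\<Sum>i\<in>I k. X i \<omega>) / sqrt (v k))) t) \<longlonglongrightarrow> complex_of_real (exp (- t\<^sup>2 / 2))"
  proof (rule LIMSEQ_eventuallyI)
    fix r :: real assume r: "r > 0"
    define c where "c = \<bar>t\<bar>^3 / 6 + t^4 / 8"
    \<comment> \<open>The bound \<open>\<epsilon> \<le> 1\<close> absorbs
      \<open>\<epsilon>\<^sup>2\<close> into \<open>\<epsilon>\<close>; the denominator with
      \<open>c + 1\<close> makes \<open>c * \<epsilon>\<close> strictly less than
      \<open>r / 2\<close>, also for \<open>c = 0\<close>.\<close>
    define \<epsilon> where "\<epsilon> = min 1 (r / (2 * (c + 1)))"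
    have c: "c \<ge> 0" by (simp add: c_def)
    have \<epsilon>: "\<epsilon> > 0" "\<epsilon> \<le> 1" using r c by (auto simp: \<epsilon>_def)
    have "\<epsilon> * (c + 1) \<le> r / (2 * (c + 1)) * (c + 1)"
      using c by (intro mult_right_mono) (auto simp: \<epsilon>_def)
    also have "r / (2 * (c + 1)) * (c + 1) = r / 2" using c by (simp add: divide_simps)
    finally have ce: "c * \<epsilon> < r / 2" using c \<epsilon> by (simp add: algebra_simps)
    have "\<bar>t\<bar>^3 * \<epsilon> / 6 + t^4 * \<epsilon>\<^sup>2 / 8 \<le> c * \<epsilon>"
    proof -
      have "\<epsilon>\<^sup>2 \<le> \<epsilon>" using \<epsilon> by (simp add: power2_eq_square mult_left_le)
      then have "t^4 * \<epsilon>\<^sup>2 \<le> t^4 * \<epsilon>" by (intro mult_left_mono) auto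
      then show ?thesis by (simp add: c_def algebra_simps)
    qed
    moreover have "(\<lambda>k. L \<epsilon> k * (t\<^sup>2 + t^4 / 8)) \<longlonglongrightarrow> 0 * (t\<^sup>2 + t^4 / 8)"
      using lind[OF \<epsilon>(1)] unfolding L_def by (intro tendsto_intros)
    then have "eventually (\<lambda>k. L \<epsilon> k * (t\<^sup>2 + t^4 / 8) < r / 2) sequentially"
      using r by (intro order_tendstoD) auto
    ultimately have "eventually (\<lambda>k. t\<^sup>2 * L \<epsilon> k + \<bar>t\<bar>^3 * \<epsilon> / 6 + t^4 * (\<epsilon>\<^sup>2 + L \<epsilon> k) / 8 < r) sequentially"
      using ce by (auto elim!: eventually_mono simp: algebra_simps add_divide_distrib)
    then show "eventually (\<lambda>k. norm (char (distr M borel (\<lambda>\<omega>. (\<Sum>i\<in>I k. X i \<omega>) / sqrt (v k))) t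
        - complex_of_real (exp (- t\<^sup>2 / 2))) < r) sequentially"
      by (rule eventually_mono) (use bound[OF \<epsilon>(1)] in \<open>auto intro: le_less_trans\<close>)
  qed
  then show "(\<lambda>k. char (distr M borel (\<lambda>\<omega>. (\<Sum>i\<in>I k. X i \<omega>) / sqrt (v k))) t) \<longlonglongrightarrow> char std_normal_distribution t"
    by (simp add: char_std_normal_distribution)
qed

section \<open>Lindeberg sequences and blocks\<close>

text \<open>The largest admissible \<open>j \<le> n\<close> works: the cap makes the maximum exist
  without stopping \<open>f\<close> from growing, and \<open>P 0\<close> keeps the set of candidates
  nonempty.\<close>

lemma diagonal_index:
  fixes P :: "nat \<Rightarrow> nat \<Rightarrow> bool"
  assumes ev: "\<And>j. eventually (P j) sequentially" and P0: "\<And>n. P 0 n"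
  obtains f :: "nat \<Rightarrow> nat" where "filterlim f at_top sequentially" "\<And>n. P (f n) n"
proof
  define f where "f n = Max {j\<in>{..n}. P j n}" for n
  have ne: "{j\<in>{..n}. P j n} \<noteq> {}" for n using P0 by auto
  have fin: "finite {j\<in>{..n}. P j n}" for n by auto
  show "P (f n) n" for n using Max_in[OF fin ne, of n] by (auto simp: f_def)
  show "filterlim f at_top sequentially"
    unfolding filterlim_at_top
  proof
    fix j
    show "eventually (\<lambda>n. j \<le> f n) sequentially"
      using ev[of j] eventually_ge_at_top[of j]
      by eventually_elim (auto simp: f_def intro!: Max_ge)
  qed
qed

locale lindeberg_sequence = prob_space M for M :: "'a measure" +
  fixes Z :: "nat \<Rightarrow> 'a \<Rightarrow> real"
  assumes indep: "indep_vars (\<lambda>_. borel) Z {1..}"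
    and mean: "\<And>i. i \<ge> 1 \<Longrightarrow> expectation (Z i) = 0"
    and square_integrable: "\<And>i. i \<ge> 1 \<Longrightarrow> integrable M (\<lambda>\<omega>. (Z i \<omega>)\<^sup>2)"
    and variance_pos: "\<And>i. i \<ge> 1 \<Longrightarrow> variance (Z i) > 0"
    and lindeberg: "lindeberg M Z"
begin

abbreviation (input) "\<sigma>2 i \<equiv> variance (Z i)"
abbreviation (input) "s2 \<equiv> sum_var M Z"
abbreviation (input)
  "tail i c \<equiv> expectation (\<lambda>\<omega>. (Z i \<omega>)\<^sup>2 * indicator {\<omega>. \<bar>Z i \<omega>\<bar> \<ge> c} \<omega>)"

lemma rv: "i \<ge> 1 \<Longrightarrow> Z i \<in> borel_measurable M"
  using indep_vars_rv[OF indep] by auto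

lemma variance_eq: "i \<ge> 1 \<Longrightarrow> \<sigma>2 i = expectation (\<lambda>\<omega>. (Z i \<omega>)\<^sup>2)"
  by (simp add: mean)

lemma sum_var_Suc: "s2 (Suc n) = s2 n + \<sigma>2 (Suc n)"
  by (simp add: sum_var_def)

lemma sum_var_0: "s2 0 = 0"
  by (simp add: sum_var_def)

lemma sum_var_diff: "p \<le> q \<Longrightarrow> (\<Sum>i\<in>{p<..q}. \<sigma>2 i) = s2 q - s2 p"
proof -
  assume "p \<le> q"
  then have "{1..q} = {1..p} \<union> {p<..q}" by auto
  then have "s2 q = s2 p + (\<Sum>i\<in>{p<..q}. \<sigma>2 i)"
    unfolding sum_var_def by (subst sum.union_disjoint[symmetric]) auto
  then show ?thesis by simp
qed

lemma sum_var_strict_mono: "strict_mono s2"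
  by (rule strict_monoI_Suc) (use variance_pos in \<open>simp add: sum_var_Suc\<close>)

lemma sum_var_mono: "p \<le> q \<Longrightarrow> s2 p \<le> s2 q"
  using sum_var_strict_mono by (simp add: strict_mono_less_eq)

lemma sum_var_pos: "n \<ge> 1 \<Longrightarrow> s2 n > 0"
  using strict_mono_less[OF sum_var_strict_mono, of 0 n] by (simp add: sum_var_0)

lemma sum_var_nonneg: "s2 n \<ge> 0"
  using sum_var_mono[of 0 n] by (simp add: sum_var_0)

definition lind_frac :: "real \<Rightarrow> nat \<Rightarrow> real" where
  "lind_frac \<epsilon> n = (\<Sum>i=1..n. tail i (\<epsilon> * sqrt (s2 n))) / s2 n"

lemma lind_frac_tendsto: "\<epsilon> > 0 \<Longrightarrow> lind_frac \<epsilon> \<longlonglongrightarrow> 0"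
  using lindeberg unfolding lindeberg_def lind_frac_def[abs_def] by auto

lemma integrable_tail:
  assumes "i \<ge> 1"
  shows "integrable M (\<lambda>\<omega>. (Z i \<omega>)\<^sup>2 * indicator {\<omega>. \<bar>Z i \<omega>\<bar> \<ge> c} \<omega>)"
proof (rule Bochner_Integration.integrable_bound[OF square_integrable[OF assms]])
  have "(\<lambda>\<omega>. (Z i \<omega>)\<^sup>2 * (if \<bar>Z i \<omega>\<bar> \<ge> c then 1 else 0)) \<in> borel_measurable M"
    using rv[OF assms] by measurable
  then show "(\<lambda>\<omega>. (Z i \<omega>)\<^sup>2 * indicator {\<omega>. \<bar>Z i \<omega>\<bar> \<ge> c} \<omega>) \<in> borel_measurable M"
    by (simp add: indicator_def of_bool_def)
qed (auto split: split_indicator)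

lemma tail_nonneg: "0 \<le> tail i c"
  by (intro integral_nonneg_AE) auto

lemma tail_le_variance:
  "i \<ge> 1 \<Longrightarrow> tail i c \<le> \<sigma>2 i"
  unfolding variance_eq
  by (intro integral_mono integrable_tail square_integrable) (auto split: split_indicator)

lemma lind_frac_le_1: "lind_frac \<epsilon> n \<le> 1"
proof -
  have "(\<Sum>i=1..n. tail i (\<epsilon> * sqrt (s2 n))) \<le> s2 n"
    unfolding sum_var_def by (intro sum_mono tail_le_variance) auto
  then show ?thesis unfolding lind_frac_def
    using sum_var_nonneg[of n] by (cases "s2 n = 0") (auto simp: divide_le_eq_1)
qed

text \<open>Splitting at \<open>\<epsilon> * sqrt (s2 n)\<close> bounds each variance by
  \<open>\<epsilon>\<^sup>2 * s2 n\<close> plus the Lindeberg sum; with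
  \<open>\<epsilon>\<^sup>2 = \<delta> / 2\<close> each contributes one half. Later this limits how
  far the clocks and the blocks can overshoot in a single step.\<close>

lemma feller:
  assumes "\<delta> > 0"
  shows "eventually (\<lambda>n. \<forall>i\<in>{1..n}. \<sigma>2 i \<le> \<delta> * s2 n) sequentially"
proof -
  define \<epsilon> where "\<epsilon> = sqrt (\<delta> / 2)"
  have \<epsilon>: "\<epsilon> > 0" "\<epsilon>\<^sup>2 = \<delta> / 2" using assms by (auto simp: \<epsilon>_def)
  have "eventually (\<lambda>n. lind_frac \<epsilon> n < \<delta> / 2) sequentially"
    using order_tendstoD(2)[OF lind_frac_tendsto[OF \<epsilon>(1)], of "\<delta> / 2"] assms by simp
  then show ?thesis
  proof eventually_elim
    case (elim n)
    show ?case
    proof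
      fix i assume i: "i \<in> {1..n}"
      let ?c = "\<epsilon> * sqrt (s2 n)"
      have s: "s2 n > 0" using i sum_var_pos by auto
      have "\<sigma>2 i \<le> expectation (\<lambda>\<omega>. ?c\<^sup>2 + (Z i \<omega>)\<^sup>2 * indicator {\<omega>. \<bar>Z i \<omega>\<bar> \<ge> ?c} \<omega>)"
        unfolding variance_eq[of i] using i
      proof (subst variance_eq)
        show "expectation (\<lambda>\<omega>. (Z i \<omega>)\<^sup>2) \<le> expectation (\<lambda>\<omega>. ?c\<^sup>2 + (Z i \<omega>)\<^sup>2 * indicator {\<omega>. \<bar>Z i \<omega>\<bar> \<ge> ?c} \<omega>)"
        proof (rule integral_mono)
          fix \<omega>
          have "(Z i \<omega>)\<^sup>2 \<le> ?c\<^sup>2" if "\<not> \<bar>Z i \<omega>\<bar> \<ge> ?c"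
            using that \<epsilon>(1) s by (simp add: abs_le_square_iff[symmetric] abs_mult)
          then show "(Z i \<omega>)\<^sup>2 \<le> ?c\<^sup>2 + (Z i \<omega>)\<^sup>2 * indicator {\<omega>. \<bar>Z i \<omega>\<bar> \<ge> ?c} \<omega>"
            by (auto split: split_indicator)
        qed (use square_integrable[of i] integrable_tail[of i] i in auto)
      qed auto
      also have "\<dots> = ?c\<^sup>2 + tail i ?c"
        using integrable_tail[of i] i by (simp add: prob_space)
      also have "tail i ?c \<le> lind_frac \<epsilon> n * s2 n"
        unfolding lind_frac_def using s i tail_nonneg by (auto intro!: member_le_sum)
      also have "\<dots> \<le> \<delta> / 2 * s2 n" using elim s by (intro mult_right_mono) auto
      also have "?c\<^sup>2 = \<delta> / 2 * s2 n" using s \<epsilon>(2) by (simp add: power_mult_distrib)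
      finally show "\<sigma>2 i \<le> \<delta> * s2 n" by simp
    qed
  qed
qed

text \<open>Divergence is forced by the Lindeberg condition: the first variance is positive and
  fixed, yet by \<open>feller\<close> it becomes negligible against \<open>s2 n\<close>.\<close>

lemma sum_var_at_top: "filterlim s2 at_top sequentially"
  unfolding filterlim_at_top
proof
  fix c :: real
  have v1: "\<sigma>2 1 > 0" by (rule variance_pos) simp
  define \<delta> where "\<delta> = \<sigma>2 1 / (\<bar>c\<bar> + 1)"
  have \<delta>: "\<delta> > 0" using v1 by (simp add: \<delta>_def)
  show "eventually (\<lambda>n. c \<le> s2 n) sequentially"
    using feller[OF \<delta>] eventually_ge_at_top[of 1]
  proof eventually_elim
    case (elim n)
    then have "\<sigma>2 1 \<le> \<delta> * s2 n" by auto
    then have "(\<bar>c\<bar> + 1) * \<sigma>2 1 \<le> s2 n * \<sigma>2 1"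
      by (simp add: \<delta>_def pos_le_divide_eq mult_ac del: One_nat_def)
    then have "\<bar>c\<bar> + 1 \<le> s2 n" using v1 by (simp only: mult_le_cancel_right_pos)
    then show ?case by linarith
  qed
qed

text \<open>A block starting at \<open>p\<close> lets the variance grow by the factor
  \<open>1 + g p\<close>. With \<open>S\<close> the variance at its end and
  \<open>\<gamma> = g p\<close>, the block variance is at least \<open>\<gamma> * S / 2\<close>, so
  the truncation level of the block eventually exceeds \<open>\<gamma> * sqrt S\<close>. If the
  Lindeberg sum at that level is at most \<open>\<gamma>\<^sup>2 * S\<close>, it is at most
  \<open>2 * \<gamma>\<close> times the block variance. This dictates the requirement
  \<open>lind_frac (g p) m \<le> (g p)\<^sup>2\<close> for all \<open>m \<ge> p\<close>.\<close>

lemma blocks_exist: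
  obtains r :: "nat \<Rightarrow> nat" where "strict_mono r" "r 0 = 0"
    "(\<lambda>k. (s2 (r (Suc k)) - s2 (r k)) / s2 (r (Suc k))) \<longlonglongrightarrow> 0"
    "\<And>\<epsilon>. \<epsilon> > 0 \<Longrightarrow> (\<lambda>k. (\<Sum>i\<in>{r k<..r (Suc k)}. tail i (\<epsilon> * sqrt (s2 (r (Suc k)) - s2 (r k))))
      / (s2 (r (Suc k)) - s2 (r k))) \<longlonglongrightarrow> 0"
proof -
  \<comment> \<open>Since \<open>e 0 = 1\<close> and Lindeberg fractions never exceed 1, the
    requirement holds everywhere at \<open>j = 0\<close>, where the diagonal choice starts.\<close>
  define e where "e j = 1 / real (Suc j)" for j
  have e: "e j > 0" "e j \<le> 1" for j by (auto simp: e_def)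
  obtain f :: "nat \<Rightarrow> nat" where f: "filterlim f at_top sequentially"
    and fP: "\<And>n. \<forall>m\<ge>n. lind_frac (e (f n)) m \<le> (e (f n))\<^sup>2"
  proof (rule diagonal_index[of "\<lambda>j n. \<forall>m\<ge>n. lind_frac (e j) m \<le> (e j)\<^sup>2"])
    fix j
    have "eventually (\<lambda>n. lind_frac (e j) n < (e j)\<^sup>2) sequentially"
      using e[of j] by (intro order_tendstoD(2)[OF lind_frac_tendsto]) simp_all
    then show "eventually (\<lambda>n. \<forall>m\<ge>n. lind_frac (e j) m \<le> (e j)\<^sup>2) sequentially"
      unfolding eventually_sequentially by (meson less_imp_le order_trans)
  next
    show "\<forall>m\<ge>n. lind_frac (e 0) m \<le> (e 0)\<^sup>2" for n using lind_frac_le_1 by (simp add: e_def)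
  qed auto
  define g where "g n = e (f n)" for n
  have g: "g n > 0" "g n \<le> 1" for n using e by (auto simp: g_def)
  have g_lind: "lind_frac (g n) m \<le> (g n)\<^sup>2" if "m \<ge> n" for n m using fP that by (auto simp: g_def)
  have "e \<longlonglongrightarrow> 0" unfolding e_def[abs_def] using LIMSEQ_inverse_real_of_nat by (simp add: inverse_eq_divide)
  then have g_lim: "g \<longlonglongrightarrow> 0" unfolding g_def by (rule filterlim_compose[OF _ f])
  \<comment> \<open>The condition \<open>n > p\<close> matters at \<open>p = 0\<close>: there the
    growth condition is void because \<open>s2 0 = 0\<close>, and the first block consists of one
    index.\<close>
  define nxt where "nxt p = (LEAST n. n > p \<and> s2 n \<ge> (1 + g p) * s2 p)" for p
  have nxt: "nxt p > p" "s2 (nxt p) \<ge> (1 + g p) * s2 p" "s2 (nxt p - 1) \<le> (1 + g p) * s2 p" for p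
  proof -
    have "eventually (\<lambda>n. s2 n \<ge> (1 + g p) * s2 p) sequentially"
      using sum_var_at_top unfolding filterlim_at_top by auto
    then have "eventually (\<lambda>n. n > p \<and> s2 n \<ge> (1 + g p) * s2 p) sequentially"
      using eventually_gt_at_top[of p] by eventually_elim auto
    then have "\<exists>n. n > p \<and> s2 n \<ge> (1 + g p) * s2 p"
      by (auto simp: eventually_sequentially)
    then have *: "nxt p > p \<and> s2 (nxt p) \<ge> (1 + g p) * s2 p"
      unfolding nxt_def by (rule LeastI_ex)
    then show "nxt p > p" "s2 (nxt p) \<ge> (1 + g p) * s2 p" by auto
    have "nxt p - 1 < nxt p" using * by simp
    then have "\<not> (nxt p - 1 > p \<and> s2 (nxt p - 1) \<ge> (1 + g p) * s2 p)"
      unfolding nxt_def by (rule not_less_Least)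
    then consider "nxt p - 1 = p" | "s2 (nxt p - 1) < (1 + g p) * s2 p" using * by linarith
    then show "s2 (nxt p - 1) \<le> (1 + g p) * s2 p"
    proof cases
      case 1
      have "1 * s2 p \<le> (1 + g p) * s2 p" using g[of p] sum_var_nonneg[of p] by (intro mult_right_mono) auto
      then show ?thesis using 1 by simp
    qed simp
  qed
  define r where "r k = (nxt ^^ k) 0" for k
  have r0: "r 0 = 0" and rS: "r (Suc k) = nxt (r k)" for k by (auto simp: r_def)
  have mono: "strict_mono r" by (rule strict_monoI_Suc) (simp add: rS nxt)
  have rpos: "r (Suc k) \<ge> 1" for k using strict_mono_less[OF mono, of 0 "Suc k"] r0 by simp
  have r_top: "filterlim r at_top sequentially" by (rule filterlim_subseq[OF mono])
  have gr: "(\<lambda>k. g (r k)) \<longlonglongrightarrow> 0" by (rule filterlim_compose[OF g_lim r_top])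
  define w where "w k = s2 (r (Suc k)) - s2 (r k)" for k
  have w_pos: "w k > 0" for k using strict_monoD[OF sum_var_strict_mono strict_monoD[OF mono, of k "Suc k"]] by (simp add: w_def)
  have sp: "s2 (r (Suc k)) > 0" for k using sum_var_pos[OF rpos] .
  \<comment> \<open>Before its last index the block has not grown beyond the prescribed factor; the
    overshoot is at most the variance of that index, which \<open>feller\<close> makes
    negligible.\<close>
  have w_le: "w k \<le> g (r k) * s2 (r k) + \<sigma>2 (r (Suc k))" for k
  proof -
    obtain q where q: "r (Suc k) = Suc q" using rpos[of k] by (cases "r (Suc k)") auto
    have "s2 q \<le> (1 + g (r k)) * s2 (r k)" using nxt(3)[of "r k"] q rS[of k] by simp
    then show ?thesis by (simp add: w_def q sum_var_Suc algebra_simps)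
  qed
  have ratio: "(\<lambda>k. w k / s2 (r (Suc k))) \<longlonglongrightarrow> 0"
  proof (rule LIMSEQ_eventuallyI)
    fix \<delta> :: real assume \<delta>: "\<delta> > 0"
    have "eventually (\<lambda>k. g (r k) < \<delta> / 2) sequentially"
      using order_tendstoD(2)[OF gr, of "\<delta> / 2"] \<delta> by simp
    moreover have "eventually (\<lambda>k. \<forall>i\<in>{1..r (Suc k)}. \<sigma>2 i \<le> \<delta> / 4 * s2 (r (Suc k))) sequentially"
      using \<delta> by (intro eventually_compose_filterlim[OF feller[of "\<delta> / 4"]
        filterlim_compose[OF r_top filterlim_Suc]]) auto
    ultimately show "eventually (\<lambda>k. norm (w k / s2 (r (Suc k)) - 0) < \<delta>) sequentially"
    proof eventually_elim
      case (elim k)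
      have "\<sigma>2 (r (Suc k)) \<le> \<delta> / 4 * s2 (r (Suc k))"
        using rpos[of k] by (intro bspec[OF elim(2)]) simp
      with w_le[of k] have "w k \<le> g (r k) * s2 (r k) + \<delta> / 4 * s2 (r (Suc k))"
        by linarith
      also have "g (r k) * s2 (r k) \<le> \<delta> / 2 * s2 (r (Suc k))"
        using elim(1) g[of "r k"] \<delta> sum_var_nonneg sum_var_mono[of "r k" "r (Suc k)"] strict_monoD[OF mono, of k "Suc k"]
        by (intro mult_mono) auto
      finally have "w k \<le> (3 / 4 * \<delta>) * s2 (r (Suc k))" by simp
      then have "w k / s2 (r (Suc k)) \<le> 3 / 4 * \<delta>" using sp[of k] by (simp add: divide_le_eq)
      also have "3 / 4 * \<delta> < \<delta>" using \<delta> by simp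
      finally show ?case using w_pos[of k] sp[of k] by (simp add: abs_divide)
    qed
  qed
  have lind: "(\<lambda>k. (\<Sum>i\<in>{r k<..r (Suc k)}. tail i (\<epsilon> * sqrt (w k))) / w k) \<longlonglongrightarrow> 0" if \<epsilon>: "\<epsilon> > 0" for \<epsilon>
  proof (rule tendsto_sandwich[of "\<lambda>_. 0" _ _ "\<lambda>k. 2 * g (r k)"])
    show "eventually (\<lambda>k. 0 \<le> (\<Sum>i\<in>{r k<..r (Suc k)}. tail i (\<epsilon> * sqrt (w k))) / w k) sequentially"
      using w_pos by (intro always_eventually allI divide_nonneg_pos sum_nonneg tail_nonneg) auto
    have "eventually (\<lambda>k. g (r k) < \<epsilon>\<^sup>2 / 2) sequentially"
      using order_tendstoD(2)[OF gr, of "\<epsilon>\<^sup>2 / 2"] \<epsilon> by simp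
    moreover have "eventually (\<lambda>k. w k / s2 (r (Suc k)) < 1 / 2) sequentially"
      using order_tendstoD(2)[OF ratio, of "1 / 2"] by simp
    ultimately show "eventually (\<lambda>k. (\<Sum>i\<in>{r k<..r (Suc k)}. tail i (\<epsilon> * sqrt (w k))) / w k \<le> 2 * g (r k)) sequentially"
    proof eventually_elim
      case (elim k)
      define \<gamma> where "\<gamma> = g (r k)"
      define S where "S = s2 (r (Suc k))"
      have S: "S > 0" using sp by (simp add: S_def)
      have \<gamma>: "\<gamma> > 0" using g by (simp add: \<gamma>_def)
      have "w k < S / 2" using elim(2) S by (simp add: S_def[symmetric] divide_less_eq)
      then have half: "s2 (r k) \<ge> S / 2" by (simp add: w_def S_def)
      have "w k \<ge> \<gamma> * s2 (r k)" using nxt(2)[of "r k"] by (simp add: w_def rS \<gamma>_def algebra_simps)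
      moreover have "\<gamma> * s2 (r k) \<ge> \<gamma> * (S / 2)" using half \<gamma> by (intro mult_left_mono) auto
      ultimately have wS: "w k \<ge> \<gamma> * S / 2" by simp
      \<comment> \<open>Here \<open>\<gamma> \<le> \<epsilon>\<^sup>2 / 2\<close> enters. It
        compares the truncation level of the block with the level \<open>\<gamma> * sqrt S\<close>
        at which \<open>g\<close> was chosen.\<close>
      have "\<gamma>\<^sup>2 * S \<le> \<epsilon>\<^sup>2 * w k"
      proof -
        have "\<gamma>\<^sup>2 * S = \<gamma> * (\<gamma> * S)" by (simp add: power2_eq_square)
        also have "\<dots> \<le> (\<epsilon>\<^sup>2 / 2) * (\<gamma> * S)" using elim(1) \<gamma> S by (intro mult_right_mono) (auto simp: \<gamma>_def)
        also have "\<dots> = \<epsilon>\<^sup>2 * (\<gamma> * S / 2)" by simp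
        also have "\<dots> \<le> \<epsilon>\<^sup>2 * w k" using wS by (intro mult_left_mono) auto
        finally show ?thesis .
      qed
      then have "sqrt (\<gamma>\<^sup>2 * S) \<le> sqrt (\<epsilon>\<^sup>2 * w k)" by (rule real_sqrt_le_mono)
      then have thr: "\<gamma> * sqrt S \<le> \<epsilon> * sqrt (w k)" using \<gamma> \<epsilon> by (simp add: real_sqrt_mult)
      let ?E = "\<lambda>c i. tail i c"
      have "(\<Sum>i\<in>{r k<..r (Suc k)}. ?E (\<epsilon> * sqrt (w k)) i) \<le> (\<Sum>i\<in>{r k<..r (Suc k)}. ?E (\<gamma> * sqrt S) i)"
        using thr by (intro sum_mono integral_mono integrable_tail) (auto split: split_indicator)
      also have "\<dots> \<le> (\<Sum>i=1..r (Suc k). ?E (\<gamma> * sqrt S) i)"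
        by (rule sum_mono2) (use tail_nonneg in auto)
      also have "\<dots> = lind_frac \<gamma> (r (Suc k)) * S" using S by (simp add: lind_frac_def S_def)
      also have "\<dots> \<le> \<gamma>\<^sup>2 * S"
        using g_lind[of "r k" "r (Suc k)"] strict_monoD[OF mono, of k "Suc k"] S
        by (intro mult_right_mono) (auto simp: \<gamma>_def)
      also have "\<dots> \<le> 2 * \<gamma> * w k"
      proof -
        have "2 * \<gamma> * (\<gamma> * S / 2) \<le> 2 * \<gamma> * w k" using wS \<gamma> by (intro mult_left_mono) auto
        then show ?thesis by (simp add: power2_eq_square)
      qed
      finally show ?case using w_pos[of k] by (simp add: divide_le_eq \<gamma>_def)
    qed
    show "(\<lambda>k. 2 * g (r k)) \<longlonglongrightarrow> 0" using tendsto_mult_right[OF gr, of 2] by simp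
  qed auto
  show ?thesis
    using that[OF mono r0] ratio lind unfolding w_def by blast
qed

end

section \<open>Coupling the blocks with normal variables\<close>

text \<open>Independence is a property of the joint law, and composing with \<open>f\<close> leaves
  the joint law unchanged. This moves independence between the spaces of sequences and the spaces
  that carry the variables.\<close>

lemma (in prob_space) indep_vars_distr_iff:
  assumes "I \<noteq> {}" and f[measurable]: "f \<in> M \<rightarrow>\<^sub>M L"
    and X: "\<And>i. i \<in> I \<Longrightarrow> X i \<in> L \<rightarrow>\<^sub>M M' i"
  shows "prob_space.indep_vars (distr M L f) M' X I \<longleftrightarrow> indep_vars M' (\<lambda>i \<omega>. X i (f \<omega>)) I"
proof -
  interpret L: prob_space "distr M L f" by (rule prob_space_distr) fact
  have "L.indep_vars M' X I \<longleftrightarrow>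
     distr (distr M L f) (PiM I M') (\<lambda>x. \<lambda>i\<in>I. X i x) = (\<Pi>\<^sub>M i\<in>I. distr (distr M L f) (M' i) (X i))"
    using assms by (intro L.indep_vars_iff_distr_eq_PiM') auto
  also have "distr (distr M L f) (PiM I M') (\<lambda>x. \<lambda>i\<in>I. X i x) = distr M (PiM I M') (\<lambda>\<omega>. \<lambda>i\<in>I. X i (f \<omega>))"
    using X by (subst distr_distr) (auto simp: comp_def intro!: measurable_restrict)
  also have "(\<Pi>\<^sub>M i\<in>I. distr (distr M L f) (M' i) (X i)) = (\<Pi>\<^sub>M i\<in>I. distr M (M' i) (\<lambda>\<omega>. X i (f \<omega>)))"
    using X by (intro PiM_cong refl) (auto simp: distr_distr comp_def)
  also have "(distr M (PiM I M') (\<lambda>\<omega>. \<lambda>i\<in>I. X i (f \<omega>)) = (\<Pi>\<^sub>M i\<in>I. distr M (M' i) (\<lambda>\<omega>. X i (f \<omega>)))) \<longleftrightarrow>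
    indep_vars M' (\<lambda>i \<omega>. X i (f \<omega>)) I"
    using assms by (intro indep_vars_iff_distr_eq_PiM'[symmetric]) (auto intro!: measurable_compose[OF f])
  finally show ?thesis .
qed

lemma std_normal_coordinates:
  defines "B \<equiv> PiM {1::nat..} (\<lambda>_. std_normal_distribution)"
  shows "prob_space B"
    and "prob_space.indep_vars B (\<lambda>_. borel) (\<lambda>i y. y i) {1..}"
    and "i \<ge> 1 \<Longrightarrow> distributed B lborel (\<lambda>y. y i) std_normal_density"
proof -
  have P: "prob_space std_normal_distribution" by (rule prob_space_normal_density) simp
  interpret S: prob_space std_normal_distribution by fact
  interpret B: product_prob_space "\<lambda>_::nat. std_normal_distribution" "{1..}" ..
  show "prob_space B" unfolding B_def by (rule B.P.prob_space_axioms)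
  show "prob_space.indep_vars B (\<lambda>_. borel) (\<lambda>i y. y i) {1..}"
    unfolding B_def
  proof (rule indep_vars_PiM_nested[where b="\<lambda>i. i" and g="\<lambda>i x. x"])
    fix k :: nat assume "k \<in> {1..}"
    then have "{i \<in> {1..}. i = k} = {k}" by auto
    then show "S.indep_vars (\<lambda>_. borel) (\<lambda>i x. x) {i \<in> {1..}. i = k}"
      by (simp add: S.indep_vars_singleton)
  qed (use P in auto)
  show "distributed B lborel (\<lambda>y. y i) std_normal_density" if "i \<ge> 1"
  proof -
    have "distr B lborel (\<lambda>y. y i) = distr B std_normal_distribution (\<lambda>y. y i)"
      by (intro distr_cong) auto
    also have "\<dots> = std_normal_distribution"
      unfolding B_def using that by (intro B.PiM_component) auto
    finally show ?thesis
      using that by (auto simp: distributed_def B_def)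
  qed
qed

context lindeberg_sequence
begin

lemma normal_block:
  assumes N: "prob_space N" and ind: "prob_space.indep_vars N (\<lambda>_. borel) Y {1..}"
    and Y: "\<And>i. i \<ge> 1 \<Longrightarrow> distributed N lborel (Y i) std_normal_density"
    and "p < q"
  shows "distributed N lborel (\<lambda>\<omega>. \<Sum>i\<in>{p<..q}. sqrt (\<sigma>2 i) * Y i \<omega>)
    (normal_density 0 (sqrt (s2 q - s2 p)))"
proof -
  interpret N: prob_space N by fact
  have "distributed N lborel (\<lambda>\<omega>. \<Sum>i\<in>{p<..q}. sqrt (\<sigma>2 i) * Y i \<omega>)
    (normal_density (\<Sum>i\<in>{p<..q}. 0) (sqrt (\<Sum>i\<in>{p<..q}. (sqrt (\<sigma>2 i))\<^sup>2)))"
  proof (rule N.sum_indep_normal)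
    show "N.indep_vars (\<lambda>_. borel) (\<lambda>i \<omega>. sqrt (\<sigma>2 i) * Y i \<omega>) {p<..q}"
      by (intro N.indep_vars_compose2[OF N.indep_vars_subset[OF ind]]) auto
    fix i assume i: "i \<in> {p<..q}"
    then show "0 < sqrt (\<sigma>2 i)" using variance_pos[of i] by auto
    then show "distributed N lborel (\<lambda>\<omega>. sqrt (\<sigma>2 i) * Y i \<omega>) (normal_density 0 (sqrt (\<sigma>2 i)))"
      using N.normal_density_affine[OF Y, of i "sqrt (\<sigma>2 i)" 0] i by simp
  qed (use assms in auto)
  also have "(\<Sum>i\<in>{p<..q}. (sqrt (\<sigma>2 i))\<^sup>2) = s2 q - s2 p"
    using sum_var_diff[of p q] variance_pos \<open>p < q\<close> by simp
  finally show ?thesis by simp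
qed

text \<open>Each \<open>C k\<close> couples the laws of the two entire sequences, but is tuned to
  bring only the sums over block \<open>k\<close> together. The final sequences live on the product
  of all \<open>C k\<close> and take from component \<open>k\<close> only the coordinates of block
  \<open>k\<close>. So the blocks become independent, and within a block each sequence keeps its own
  law although their joint law there is never described.\<close>

lemma coupling_exists:
  obtains N :: "(nat \<Rightarrow> (nat \<Rightarrow> real) \<times> (nat \<Rightarrow> real)) measure"
    and Z' Y :: "nat \<Rightarrow> (nat \<Rightarrow> (nat \<Rightarrow> real) \<times> (nat \<Rightarrow> real)) \<Rightarrow> real"
    and r :: "nat \<Rightarrow> nat" and \<eta> :: "nat \<Rightarrow> real"
  where "prob_space N"
    "prob_space.indep_vars N (\<lambda>_. borel) Z' {1..}"
    "\<And>i. i \<ge> 1 \<Longrightarrow> distr N borel (Z' i) = distr M borel (Z i)"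
    "prob_space.indep_vars N (\<lambda>_. borel) Y {1..}"
    "\<And>i. i \<ge> 1 \<Longrightarrow> distributed N lborel (Y i) std_normal_density"
    "strict_mono r" "r 0 = 0"
    "(\<lambda>k. (s2 (r (Suc k)) - s2 (r k)) / s2 (r (Suc k))) \<longlonglongrightarrow> 0"
    "prob_space.indep_vars N (\<lambda>_. borel)
       (\<lambda>k \<omega>. \<Sum>i\<in>{r k<..r (Suc k)}. Z' i \<omega> - sqrt (\<sigma>2 i) * Y i \<omega>) UNIV"
    "\<And>k. integrable N (\<lambda>\<omega>. (\<Sum>i\<in>{r k<..r (Suc k)}. Z' i \<omega> - sqrt (\<sigma>2 i) * Y i \<omega>)\<^sup>2)"
    "\<And>k. (\<integral>\<omega>. (\<Sum>i\<in>{r k<..r (Suc k)}. Z' i \<omega> - sqrt (\<sigma>2 i) * Y i \<omega>)\<^sup>2 \<partial>N)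
       \<le> \<eta> k * (s2 (r (Suc k)) - s2 (r k))"
    "\<eta> \<longlonglongrightarrow> 0"
proof -
  obtain r where mono: "strict_mono r" and r0: "r 0 = 0"
    and ratio: "(\<lambda>k. (s2 (r (Suc k)) - s2 (r k)) / s2 (r (Suc k))) \<longlonglongrightarrow> 0"
    and lind: "\<And>\<epsilon>. \<epsilon> > 0 \<Longrightarrow> (\<lambda>k. (\<Sum>i\<in>{r k<..r (Suc k)}. tail i (\<epsilon> * sqrt (s2 (r (Suc k)) - s2 (r k))))
      / (s2 (r (Suc k)) - s2 (r k))) \<longlonglongrightarrow> 0"
    by (rule blocks_exist) blast
  define w where "w k = s2 (r (Suc k)) - s2 (r k)" for k
  define I where "I k = {r k<..r (Suc k)}" for k
  have rS: "r k < r (Suc k)" for k using strict_monoD[OF mono, of k "Suc k"] by simp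
  have w_pos: "w k > 0" for k using strict_monoD[OF sum_var_strict_mono rS[of k]] by (simp add: w_def)
  have I1: "I k \<subseteq> {1..}" "finite (I k)" for k by (auto simp: I_def)
  have w_eq: "w k = (\<Sum>i\<in>I k. \<sigma>2 i)" for k using sum_var_diff[of "r k" "r (Suc k)"] rS[of k] by (simp add: w_def I_def)
  have w_eq': "w k = (\<Sum>i\<in>I k. expectation (\<lambda>\<omega>. (Z i \<omega>)\<^sup>2))" for k
    unfolding w_eq using I1(1)[of k] by (intro sum.cong refl variance_eq) auto
  have indI: "indep_vars (\<lambda>_. borel) Z (I k)" for k by (rule indep_vars_subset[OF indep I1(1)])
  have clt: "weak_conv_m (\<lambda>k. distr M borel (\<lambda>\<omega>. (\<Sum>i\<in>I k. Z i \<omega>) / sqrt (w k))) std_normal_distribution"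
  proof (rule lindeberg_clt[OF I1(2) indI _ _ w_eq' w_pos])
    show "expectation (Z i) = 0" "integrable M (\<lambda>\<omega>. (Z i \<omega>)\<^sup>2)" if "i \<in> I k" for k i
      using that I1(1)[of k] mean square_integrable by auto
    show "(\<lambda>k. (\<Sum>i\<in>I k. tail i (\<epsilon> * sqrt (w k))) / w k)
       \<longlonglongrightarrow> 0" if "\<epsilon> > 0" for \<epsilon>
      using lind[OF that] unfolding I_def w_def .
  qed
  have Zm: "(\<lambda>\<omega>. (\<Sum>i\<in>I k. Z i \<omega>) / sqrt (w k)) \<in> borel_measurable M" for k
    using I1(1)[of k] rv by (intro borel_measurable_divide borel_measurable_sum) auto
  have Zsq: "integrable M (\<lambda>\<omega>. ((\<Sum>i\<in>I k. Z i \<omega>) / sqrt (w k))\<^sup>2) \<and>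
    expectation (\<lambda>\<omega>. ((\<Sum>i\<in>I k. Z i \<omega>) / sqrt (w k))\<^sup>2) = 1" for k
  proof -
    have "integrable M (\<lambda>\<omega>. (\<Sum>i\<in>I k. Z i \<omega>)\<^sup>2) \<and> expectation (\<lambda>\<omega>. (\<Sum>i\<in>I k. Z i \<omega>)\<^sup>2) = w k"
      unfolding w_eq' using I1(1)[of k] mean square_integrable
      by (intro indep_sum_second_moment I1(2) indI) auto
    then show ?thesis using w_pos[of k] by (simp add: power_divide)
  qed
  have std2: "integrable std_normal_distribution (\<lambda>x. x\<^sup>2)" "(\<integral>x. x\<^sup>2 \<partial>std_normal_distribution) = 1"
    using integrable_std_normal_distribution_moment[of 2] std_normal_distribution_even_moments(1)[of 1]
    by (auto simp: fact_numeral)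
  obtain \<Omega> :: "real measure" and S :: "nat \<Rightarrow> real \<Rightarrow> real" and S' :: "real \<Rightarrow> real"
    where \<Omega>: "prob_space \<Omega>" and S: "\<And>n. S n \<in> borel_measurable \<Omega>" "S' \<in> borel_measurable \<Omega>"
    and dS: "\<And>k. distr \<Omega> borel (S k) = distr M borel (\<lambda>\<omega>. (\<Sum>i\<in>I k. Z i \<omega>) / sqrt (w k))"
      "distr \<Omega> borel S' = std_normal_distribution"
    and S2: "\<And>n. integrable \<Omega> (\<lambda>x. (S n x - S' x)\<^sup>2)" "(\<lambda>n. \<integral>x. (S n x - S' x)\<^sup>2 \<partial>\<Omega>) \<longlonglongrightarrow> 0"
  proof (rule Skorohod_L2[OF _ real_dist_normal_dist clt _ std2(1)])
    show "real_distribution (distr M borel (\<lambda>\<omega>. (\<Sum>i\<in>I k. Z i \<omega>) / sqrt (w k)))" for k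
      using Zm by (rule real_distribution_distr)
    show "integrable (distr M borel (\<lambda>\<omega>. (\<Sum>i\<in>I k. Z i \<omega>) / sqrt (w k))) (\<lambda>x. x\<^sup>2)" for k
      using Zsq[of k] Zm[of k] by (subst integrable_distr_eq) auto
    show "(\<integral>x. x\<^sup>2 \<partial>distr M borel (\<lambda>\<omega>. (\<Sum>i\<in>I k. Z i \<omega>) / sqrt (w k))) = (\<integral>x. x\<^sup>2 \<partial>std_normal_distribution)" for k
      using Zsq[of k] Zm[of k] by (subst integral_distr) (auto simp: std2)
  qed blast
  define A where "A = distr M (Pi\<^sub>M {1..} (\<lambda>_. borel)) (\<lambda>\<omega>. \<lambda>i\<in>{1..}. Z i \<omega>)"
  define B where "B = PiM {1::nat..} (\<lambda>_. std_normal_distribution)"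
  have Z_seq[measurable]: "(\<lambda>\<omega>. \<lambda>i\<in>{1..}. Z i \<omega>) \<in> M \<rightarrow>\<^sub>M Pi\<^sub>M {1..} (\<lambda>_. borel)"
    using rv by (intro measurable_restrict) auto
  have sA[measurable_cong]: "sets A = sets (Pi\<^sub>M {1..} (\<lambda>_. borel))" by (simp add: A_def)
  have sB[measurable_cong]: "sets B = sets (Pi\<^sub>M {1..} (\<lambda>_. borel))"
    unfolding B_def by (intro sets_PiM_cong) auto
  interpret A: prob_space A unfolding A_def by (rule prob_space_distr) measurable
  interpret B: prob_space B unfolding B_def by (rule std_normal_coordinates(1))
  have A_ind: "A.indep_vars (\<lambda>_. borel) (\<lambda>i z. z i) {1..}"
    unfolding A_def
  proof (subst indep_vars_distr_iff)
    show "indep_vars (\<lambda>_. borel) (\<lambda>i \<omega>. (\<lambda>i\<in>{1..}. Z i \<omega>) i) {1..}"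
      using indep by (rule indep_vars_cong[THEN iffD1, rotated 3]) auto
  qed (use Z_seq in \<open>auto simp del: One_nat_def\<close>)
  have B_ind: "B.indep_vars (\<lambda>_. borel) (\<lambda>i z. z i) {1..}"
    and B_dist: "i \<ge> 1 \<Longrightarrow> distributed B lborel (\<lambda>y. y i) std_normal_density" for i
    unfolding B_def using std_normal_coordinates by auto
  have coord[measurable]: "(\<lambda>z. z i) \<in> borel_measurable A" "(\<lambda>z. z i) \<in> borel_measurable B" if "i \<ge> 1" for i
    using A.indep_vars_rv[OF A_ind] B.indep_vars_rv[OF B_ind] that by auto
  have sumA[measurable]: "(\<lambda>z. (\<Sum>i\<in>I k. z i) / sqrt (w k)) \<in> borel_measurable A" for k
    using I1(1)[of k] by (intro borel_measurable_divide borel_measurable_sum coord) auto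
  have sumA': "(\<lambda>z. (\<Sum>i\<in>I k. z i) / sqrt (w k)) \<in> borel_measurable (Pi\<^sub>M {1..} (\<lambda>_. borel))" for k
    using sumA[of k] by (simp add: measurable_cong_sets[OF sA refl])
  have sumB[measurable]: "(\<lambda>y. (\<Sum>i\<in>I k. sqrt (\<sigma>2 i) * y i) / sqrt (w k)) \<in> borel_measurable B" for k
    using I1(1)[of k] by (intro borel_measurable_divide borel_measurable_sum borel_measurable_times coord) auto
  define P where "P k C \<longleftrightarrow> prob_space C \<and> sets C = sets (A \<Otimes>\<^sub>M B) \<and> distr C A fst = A \<and> distr C B snd = B \<and>
    integrable C (\<lambda>z. ((\<Sum>i\<in>I k. fst z i) / sqrt (w k) - (\<Sum>i\<in>I k. sqrt (\<sigma>2 i) * snd z i) / sqrt (w k))\<^sup>2) \<and>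
    (\<integral>z. ((\<Sum>i\<in>I k. fst z i) / sqrt (w k) - (\<Sum>i\<in>I k. sqrt (\<sigma>2 i) * snd z i) / sqrt (w k))\<^sup>2 \<partial>C)
     \<le> 2 * (\<integral>x. (S k x - S' x)\<^sup>2 \<partial>\<Omega>) + 8 * (1 / real (Suc k))\<^sup>2"
    for k C
  have ex: "\<exists>C. P k C" for k
    unfolding P_def
  proof (rule coupling_of_functions[OF A.prob_space_axioms B.prob_space_axioms \<Omega> sumA sumB S _ _ S2(1)])
    show "distr A borel (\<lambda>z. (\<Sum>i\<in>I k. z i) / sqrt (w k)) = distr \<Omega> borel (S k)"
      unfolding dS A_def
    proof (subst distr_distr[OF sumA'[of k] Z_seq])
      have "(\<Sum>i\<in>I k. (\<lambda>i\<in>{1..}. Z i \<omega>) i) = (\<Sum>i\<in>I k. Z i \<omega>)" for \<omega>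
        using I1(1)[of k] by (intro sum.cong) auto
      then show "distr M borel ((\<lambda>z. (\<Sum>i\<in>I k. z i) / sqrt (w k)) \<circ> (\<lambda>\<omega>. \<lambda>i\<in>{1..}. Z i \<omega>)) =
        distr M borel (\<lambda>\<omega>. (\<Sum>i\<in>I k. Z i \<omega>) / sqrt (w k))"
        by (simp add: comp_def)
    qed
    have "distributed B lborel (\<lambda>y. \<Sum>i\<in>I k. sqrt (\<sigma>2 i) * y i) (normal_density 0 (sqrt (w k)))"
      unfolding I_def w_def by (rule normal_block[OF B.prob_space_axioms B_ind B_dist rS])
    then have "distributed B lborel (\<lambda>y. (\<Sum>i\<in>I k. sqrt (\<sigma>2 i) * y i) / sqrt (w k)) std_normal_density"
      using B.normal_standard_normal_convert[of "sqrt (w k)" "\<lambda>y. \<Sum>i\<in>I k. sqrt (\<sigma>2 i) * y i" 0] w_pos[of k] by simp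
    then have "distr B lborel (\<lambda>y. (\<Sum>i\<in>I k. sqrt (\<sigma>2 i) * y i) / sqrt (w k)) = std_normal_distribution"
      by (auto simp: distributed_def)
    moreover have "distr B lborel (\<lambda>y. (\<Sum>i\<in>I k. sqrt (\<sigma>2 i) * y i) / sqrt (w k)) =
      distr B borel (\<lambda>y. (\<Sum>i\<in>I k. sqrt (\<sigma>2 i) * y i) / sqrt (w k))"
      by (intro distr_cong) auto
    ultimately show "distr B borel (\<lambda>y. (\<Sum>i\<in>I k. sqrt (\<sigma>2 i) * y i) / sqrt (w k)) = distr \<Omega> borel S'"
      by (simp add: dS)
    \<comment> \<open>The grid is refined with \<open>k\<close>, so that rounding contributes
      nothing to the limit of \<open>\<eta>\<close>.\<close>
    show "0 < 1 / real (Suc k)" by simp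
  qed blast
  define C where "C k = (SOME C. P k C)" for k
  have PC: "P k (C k)" for k unfolding C_def by (rule someI_ex[OF ex])
  have C: "\<And>k. prob_space (C k)" and sC[measurable_cong]: "\<And>k. sets (C k) = sets (A \<Otimes>\<^sub>M B)"
    and CA: "\<And>k. distr (C k) A fst = A" and CB: "\<And>k. distr (C k) B snd = B"
    and Cint: "\<And>k. integrable (C k) (\<lambda>z. ((\<Sum>i\<in>I k. fst z i) / sqrt (w k) - (\<Sum>i\<in>I k. sqrt (\<sigma>2 i) * snd z i) / sqrt (w k))\<^sup>2)"
    and Cle: "\<And>k. (\<integral>z. ((\<Sum>i\<in>I k. fst z i) / sqrt (w k) - (\<Sum>i\<in>I k. sqrt (\<sigma>2 i) * snd z i) / sqrt (w k))\<^sup>2 \<partial>C k)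
     \<le> 2 * (\<integral>x. (S k x - S' x)\<^sup>2 \<partial>\<Omega>) + 8 * (1 / real (Suc k))\<^sup>2"
    using PC unfolding P_def by blast+
  interpret C: prob_space "C k" for k by (rule C)
  interpret N: product_prob_space C UNIV ..
  define N where "N = PiM UNIV C"
  have N: "prob_space N" unfolding N_def by (rule N.P.prob_space_axioms)
  have comp: "distr N (C k) (\<lambda>\<omega>. \<omega> k) = C k" for k unfolding N_def by (rule N.PiM_component) simp
  have compm[measurable]: "(\<lambda>\<omega>. \<omega> k) \<in> N \<rightarrow>\<^sub>M C k" for k unfolding N_def by simp
  \<comment> \<open>For \<open>i \<ge> 1\<close> this is the number of the block that contains
    \<open>i\<close>.\<close>
  define b where "b i = (LEAST k. i \<le> r (Suc k))" for i
  have b: "i \<in> I (b i)" if "i \<ge> 1" for i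
  proof -
    have "i \<le> r (Suc i)" using strict_mono_imp_increasing[OF mono, of "Suc i"] by simp
    then have 1: "i \<le> r (Suc (b i))" unfolding b_def by (rule LeastI)
    have "r (b i) < i"
    proof (cases "b i")
      case 0 then show ?thesis using that r0 by simp
    next
      case (Suc k)
      then show ?thesis using not_less_Least[of k "\<lambda>k. i \<le> r (Suc k)"] unfolding b_def[symmetric] by simp
    qed
    then show ?thesis using 1 by (simp add: I_def)
  qed
  have b_eq: "b i = k" if "i \<in> I k" for i k
  proof (rule ccontr)
    assume "b i \<noteq> k"
    then consider "Suc (b i) \<le> k" | "Suc k \<le> b i" by linarith
    then show False
    proof cases
      case 1
      then have "r (Suc (b i)) \<le> r k" using mono by (simp add: strict_mono_less_eq)
      then show False using b[of i] that I1(1)[of k] by (auto simp: I_def)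
    next
      case 2
      then have "r (Suc k) \<le> r (b i)" using mono by (simp add: strict_mono_less_eq)
      then show False using b[of i] that I1(1)[of k] by (auto simp: I_def)
    qed
  qed
  define Z' where "Z' i \<omega> = fst (\<omega> (b i)) i" for i and \<omega> :: "nat \<Rightarrow> (nat \<Rightarrow> real) \<times> (nat \<Rightarrow> real)"
  define Y where "Y i \<omega> = snd (\<omega> (b i)) i" for i and \<omega> :: "nat \<Rightarrow> (nat \<Rightarrow> real) \<times> (nat \<Rightarrow> real)"
  define d where "d k c = (\<Sum>i\<in>I k. fst c i) / sqrt (w k) - (\<Sum>i\<in>I k. sqrt (\<sigma>2 i) * snd c i) / sqrt (w k)"
    for k and c :: "(nat \<Rightarrow> real) \<times> (nat \<Rightarrow> real)"
  have fst_ind: "C.indep_vars k (\<lambda>_. borel) (\<lambda>i c. fst c i) {1..}" for k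
    using A_ind by (subst (asm) CA[of k, symmetric], subst (asm) C.indep_vars_distr_iff) auto
  have snd_ind: "C.indep_vars k (\<lambda>_. borel) (\<lambda>i c. snd c i) {1..}" for k
    using B_ind by (subst (asm) CB[of k, symmetric], subst (asm) C.indep_vars_distr_iff) auto
  have [measurable]: "(\<lambda>c. fst c i) \<in> borel_measurable (C k)" "(\<lambda>c. snd c i) \<in> borel_measurable (C k)" if "i \<ge> 1" for i k
    using C.indep_vars_rv[OF fst_ind, of i k] C.indep_vars_rv[OF snd_ind, of i k] that by auto
  have dm[measurable]: "d k \<in> borel_measurable (C k)" for k
  proof -
    have "d k = (\<lambda>c. (\<lambda>z. (\<Sum>i\<in>I k. z i) / sqrt (w k)) (fst c) - (\<lambda>y. (\<Sum>i\<in>I k. sqrt (\<sigma>2 i) * y i) / sqrt (w k)) (snd c))"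
      by (simp add: d_def fun_eq_iff)
    also have "\<dots> \<in> borel_measurable (C k)"
      by (intro borel_measurable_diff measurable_compose[OF _ sumA] measurable_compose[OF _ sumB]) measurable
    finally show ?thesis .
  qed
  \<comment> \<open>Only component \<open>k\<close> of the product enters the difference over block
    \<open>k\<close>. This yields both the independence of the differences and their second
    moments.\<close>
  have D_eq: "(\<Sum>i\<in>{r k<..r (Suc k)}. Z' i \<omega> - sqrt (\<sigma>2 i) * Y i \<omega>) = sqrt (w k) * d k (\<omega> k)" for k \<omega>
  proof -
    have "(\<Sum>i\<in>I k. Z' i \<omega> - sqrt (\<sigma>2 i) * Y i \<omega>) = (\<Sum>i\<in>I k. fst (\<omega> k) i - sqrt (\<sigma>2 i) * snd (\<omega> k) i)"
      by (intro sum.cong) (auto simp: Z'_def Y_def b_eq)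
    then show ?thesis using w_pos[of k]
      by (simp add: I_def[symmetric] d_def sum_subtractf right_diff_distrib)
  qed
  show ?thesis
  proof (rule that[OF N _ _ _ _ mono r0 ratio])
    show "prob_space.indep_vars N (\<lambda>_. borel) Z' {1..}"
      unfolding N_def Z'_def
    proof (rule indep_vars_PiM_nested[where g="\<lambda>i c. fst c i" and b=b])
      show "C.indep_vars k (\<lambda>_. borel) (\<lambda>i c. fst c i) {i \<in> {1..}. b i = k}" for k
        by (rule C.indep_vars_subset[OF fst_ind]) auto
    qed (use C in auto)
    show "prob_space.indep_vars N (\<lambda>_. borel) Y {1..}"
      unfolding N_def Y_def
    proof (rule indep_vars_PiM_nested[where g="\<lambda>i c. snd c i" and b=b])
      show "C.indep_vars k (\<lambda>_. borel) (\<lambda>i c. snd c i) {i \<in> {1..}. b i = k}" for k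
        by (rule C.indep_vars_subset[OF snd_ind]) auto
    qed (use C in auto)
    show "prob_space.indep_vars N (\<lambda>_. borel)
       (\<lambda>k \<omega>. \<Sum>i\<in>{r k<..r (Suc k)}. Z' i \<omega> - sqrt (\<sigma>2 i) * Y i \<omega>) UNIV"
      unfolding N_def D_eq
    proof (rule indep_vars_PiM_nested[where g="\<lambda>k c. sqrt (w k) * d k c" and b="\<lambda>k. k"])
      show "C.indep_vars k (\<lambda>_. borel) (\<lambda>k c. sqrt (w k) * d k c) {i \<in> UNIV. i = k}" for k
        by (simp add: C.indep_vars_singleton)
    qed (use C in auto)
    show "distr N borel (Z' i) = distr M borel (Z i)" if i: "i \<ge> 1" for i
    proof -
      have "distr N borel (Z' i) = distr (distr N (C (b i)) (\<lambda>\<omega>. \<omega> (b i))) borel (\<lambda>c. fst c i)"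
        unfolding Z'_def[abs_def] using i by (subst distr_distr) (auto simp: comp_def)
      also have "\<dots> = distr (distr (C (b i)) A fst) borel (\<lambda>z. z i)"
        using i by (subst (2) distr_distr) (auto simp: comp_def comp)
      also have "\<dots> = distr M borel (Z i)"
        unfolding CA unfolding A_def using i by (subst distr_distr[OF _ Z_seq]) (auto simp: comp_def)
      finally show ?thesis .
    qed
    show "distributed N lborel (Y i) std_normal_density" if i: "i \<ge> 1" for i
    proof -
      have "distr N lborel (Y i) = distr (distr N (C (b i)) (\<lambda>\<omega>. \<omega> (b i))) lborel (\<lambda>c. snd c i)"
        unfolding Y_def[abs_def] using i by (subst distr_distr) (auto simp: comp_def)
      also have "\<dots> = distr (distr (C (b i)) B snd) lborel (\<lambda>z. z i)"
        using i by (subst (2) distr_distr) (auto simp: comp_def comp)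
      also have "\<dots> = std_normal_distribution"
        using B_dist[OF i] by (simp add: CB distributed_def)
      moreover have "Y i \<in> borel_measurable N"
        unfolding Y_def[abs_def] by (rule measurable_compose[OF compm]) (use i in measurable)
      ultimately show ?thesis by (simp add: distributed_def)
    qed
    define \<eta> where "\<eta> k = 2 * (\<integral>x. (S k x - S' x)\<^sup>2 \<partial>\<Omega>) + 8 * (1 / real (Suc k))\<^sup>2" for k
    have dint: "integrable (C k) (\<lambda>c. (d k c)\<^sup>2)" and dle: "(\<integral>c. (d k c)\<^sup>2 \<partial>C k) \<le> \<eta> k" for k
      using Cint[of k] Cle[of k] unfolding d_def \<eta>_def by auto
    have dN: "integrable N (\<lambda>\<omega>. (d k (\<omega> k))\<^sup>2)" "(\<integral>\<omega>. (d k (\<omega> k))\<^sup>2 \<partial>N) = (\<integral>c. (d k c)\<^sup>2 \<partial>C k)" for k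
      using integrable_distr_eq[OF compm, of "\<lambda>c. (d k c)\<^sup>2"] integral_distr[OF compm, of "\<lambda>c. (d k c)\<^sup>2"] dint[of k]
      by (auto simp: comp)
    show "integrable N (\<lambda>\<omega>. (\<Sum>i\<in>{r k<..r (Suc k)}. Z' i \<omega> - sqrt (\<sigma>2 i) * Y i \<omega>)\<^sup>2)" for k
      unfolding D_eq power_mult_distrib using dN(1) by simp
    show "(\<integral>\<omega>. (\<Sum>i\<in>{r k<..r (Suc k)}. Z' i \<omega> - sqrt (\<sigma>2 i) * Y i \<omega>)\<^sup>2 \<partial>N)
       \<le> \<eta> k * (s2 (r (Suc k)) - s2 (r k))" for k
    proof -
      have "(\<integral>\<omega>. (\<Sum>i\<in>{r k<..r (Suc k)}. Z' i \<omega> - sqrt (\<sigma>2 i) * Y i \<omega>)\<^sup>2 \<partial>N) = w k * (\<integral>c. (d k c)\<^sup>2 \<partial>C k)"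
        unfolding D_eq power_mult_distrib using w_pos[of k] by (simp add: dN)
      also have "\<dots> \<le> w k * \<eta> k" using dle w_pos[of k] by (intro mult_left_mono) auto
      finally show ?thesis by (simp add: w_def mult.commute)
    qed
    have "(\<lambda>k. 1 / real (Suc k)) \<longlonglongrightarrow> 0" using LIMSEQ_inverse_real_of_nat by (simp add: inverse_eq_divide)
    then have "(\<lambda>k. 2 * (\<integral>x. (S k x - S' x)\<^sup>2 \<partial>\<Omega>) + 8 * (1 / real (Suc k))\<^sup>2) \<longlonglongrightarrow> 2 * 0 + 8 * 0\<^sup>2"
      by (intro tendsto_intros S2(2))
    then show "\<eta> \<longlonglongrightarrow> 0" by (simp add: \<eta>_def[abs_def])
  qed
qed

end

section \<open>Uniform closeness of the coupled partial sums\<close>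

text \<open>A fixed initial part is swamped by the diverging total weight. The lemma converts errors
  relative to single blocks into errors relative to the whole sum.\<close>

lemma toeplitz_weighted:
  fixes c w :: "nat \<Rightarrow> real"
  assumes c: "c \<longlonglongrightarrow> 0" and w: "\<And>k. w k > 0"
    and T: "filterlim (\<lambda>n. \<Sum>k<n. w k) at_top sequentially"
  shows "(\<lambda>n. (\<Sum>k<n. c k * w k) / (\<Sum>k<n. w k)) \<longlonglongrightarrow> 0"
proof (rule LIMSEQ_eventuallyI)
  fix \<epsilon> :: real assume \<epsilon>: "\<epsilon> > 0"
  obtain N where N: "\<And>k. k \<ge> N \<Longrightarrow> \<bar>c k\<bar> < \<epsilon> / 2"
    using LIMSEQ_D[OF c, of "\<epsilon> / 2"] \<epsilon> by auto
  define B where "B = (\<Sum>k<N. \<bar>c k\<bar> * w k)"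
  have B: "B \<ge> 0" unfolding B_def using w by (intro sum_nonneg mult_nonneg_nonneg) (auto simp: less_imp_le)
  \<comment> \<open>The term \<open>4 * B / \<epsilon>\<close> makes the initial part at most a
    quarter of \<open>\<epsilon>\<close> times the total weight; the added 1 makes that weight
    positive.\<close>
  have "eventually (\<lambda>n. 4 * B / \<epsilon> + 1 \<le> (\<Sum>k<n. w k)) sequentially"
    using T unfolding filterlim_at_top by blast
  then show "eventually (\<lambda>n. norm ((\<Sum>k<n. c k * w k) / (\<Sum>k<n. w k) - 0) < \<epsilon>) sequentially"
    using eventually_ge_at_top[of N]
  proof eventually_elim
    case (elim n)
    have Tp: "(\<Sum>k<n. w k) > 0" using elim(1) B \<epsilon> by (smt (verit) divide_nonneg_pos)
    have split: "{..<n} = {..<N} \<union> {N..<n}" using elim(2) by auto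
    have "\<bar>\<Sum>k<n. c k * w k\<bar> \<le> (\<Sum>k<n. \<bar>c k\<bar> * w k)"
      using w by (intro order_trans[OF sum_abs] sum_mono) (simp add: abs_mult less_imp_le)
    also have "\<dots> = B + (\<Sum>k\<in>{N..<n}. \<bar>c k\<bar> * w k)"
      unfolding split B_def by (subst sum.union_disjoint) auto
    also have "(\<Sum>k\<in>{N..<n}. \<bar>c k\<bar> * w k) \<le> (\<Sum>k\<in>{N..<n}. \<epsilon> / 2 * w k)"
      using N w by (intro sum_mono mult_right_mono) (auto simp: less_imp_le)
    also have "\<dots> \<le> \<epsilon> / 2 * (\<Sum>k<n. w k)"
      unfolding sum_distrib_left[symmetric] using w \<epsilon> by (intro mult_left_mono sum_mono2) (auto simp: less_imp_le)
    also have "B + \<epsilon> / 2 * (\<Sum>k<n. w k) < \<epsilon> * (\<Sum>k<n. w k)"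
    proof -
      have "(4 * B / \<epsilon> + 1) * \<epsilon> \<le> (\<Sum>k<n. w k) * \<epsilon>" using elim(1) \<epsilon> by (intro mult_right_mono) auto
      then have "4 * B + \<epsilon> \<le> \<epsilon> * (\<Sum>k<n. w k)" using \<epsilon> by (simp add: algebra_simps)
      then show ?thesis using B \<epsilon> by simp
    qed
    finally show ?case using Tp by (simp add: abs_divide divide_less_eq)
  qed
qed

text \<open>Markov's inequality for the fourth power, with the normal fourth moment
  \<open>3 * \<tau>^4\<close>. The bound is quadratic in the variance, so its sum over many small
  pieces is still small.\<close>

lemma (in prob_space) normal_tail:
  assumes X: "distributed M lborel X (normal_density 0 \<tau>)" and \<tau>: "\<tau> > 0" and a: "a > 0"
  shows "prob {\<omega>\<in>space M. \<bar>X \<omega>\<bar> > a} \<le> 3 * \<tau>^4 / a^4"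
proof -
  have [measurable]: "X \<in> borel_measurable M" using distributed_measurable[OF X] by simp
  have m4: "has_bochner_integral lborel (\<lambda>x. normal_density 0 \<tau> x * x ^ 4) (3 * \<tau>^4)"
    using normal_moment_even[OF \<tau>, of 0 2] \<tau>
    by (simp add: fact_numeral power_divide field_simps power2_eq_square eval_nat_numeral)
  have int: "integrable M (\<lambda>\<omega>. (X \<omega>)^4)"
    using distributed_integrable[OF X, of "\<lambda>x. x^4"] m4
    by (auto simp: has_bochner_integral_iff)
  have ex: "expectation (\<lambda>\<omega>. (X \<omega>)^4) = 3 * \<tau>^4"
    using distributed_integral[OF X, of "\<lambda>x. x^4"] m4
    by (auto simp: has_bochner_integral_iff)
  have "prob {\<omega>\<in>space M. \<bar>X \<omega>\<bar> > a} \<le> prob {\<omega>\<in>space M. (X \<omega>)^4 \<ge> a^4}"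
  proof (rule finite_measure_mono)
    show "{\<omega>\<in>space M. \<bar>X \<omega>\<bar> > a} \<subseteq> {\<omega>\<in>space M. (X \<omega>)^4 \<ge> a^4}"
    proof safe
      fix \<omega> assume "\<bar>X \<omega>\<bar> > a"
      then have "a^4 \<le> \<bar>X \<omega>\<bar>^4" using a by (intro power_mono) auto
      then show "a^4 \<le> (X \<omega>)^4" by (simp add: power_even_abs)
    qed
  qed measurable
  also have "\<dots> \<le> expectation (\<lambda>\<omega>. (X \<omega>)^4) / a^4"
    using int a by (intro integral_Markov_inequality_measure[where A="{}"]) auto
  finally show ?thesis by (simp add: ex)
qed

lemma (in prob_space) prob_abs_add_le:
  fixes X Y :: "'a \<Rightarrow> real"
  assumes [measurable]: "X \<in> borel_measurable M" "Y \<in> borel_measurable M"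
  shows "prob {\<omega>\<in>space M. \<bar>X \<omega> + Y \<omega>\<bar> > 2 * a} \<le>
    prob {\<omega>\<in>space M. \<bar>X \<omega>\<bar> > a} + prob {\<omega>\<in>space M. \<bar>Y \<omega>\<bar> > a}"
proof -
  have "prob {\<omega>\<in>space M. \<bar>X \<omega> + Y \<omega>\<bar> > 2 * a} \<le>
    prob ({\<omega>\<in>space M. \<bar>X \<omega>\<bar> > a} \<union> {\<omega>\<in>space M. \<bar>Y \<omega>\<bar> > a})"
    by (intro finite_measure_mono) auto
  also have "\<dots> \<le> prob {\<omega>\<in>space M. \<bar>X \<omega>\<bar> > a} + prob {\<omega>\<in>space M. \<bar>Y \<omega>\<bar> > a}"
    by (intro measure_Un_le) auto
  finally show ?thesis .
qed

text \<open>The name \<open>Z\<close> now stands for the coupled copy. The joint behaviour of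
  \<open>Z\<close> and \<open>Y\<close> is known only through their differences over blocks, so
  independence and second moments of these differences are stated as assumptions.\<close>

locale lindeberg_coupling = lindeberg_sequence M Z for M :: "'a measure" and Z +
  fixes Y :: "nat \<Rightarrow> 'a \<Rightarrow> real" and r :: "nat \<Rightarrow> nat" and \<eta> :: "nat \<Rightarrow> real"
  assumes Y_indep: "indep_vars (\<lambda>_. borel) Y {1..}"
    and Y_normal: "\<And>i. i \<ge> 1 \<Longrightarrow> distributed M lborel (Y i) std_normal_density"
    and r_mono: "strict_mono r" and r_0: "r 0 = 0"
    and block_ratio: "(\<lambda>k. (sum_var M Z (r (Suc k)) - sum_var M Z (r k)) / sum_var M Z (r (Suc k))) \<longlonglongrightarrow> 0"
    and D_indep: "indep_vars (\<lambda>_. borel)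
       (\<lambda>k \<omega>. \<Sum>i\<in>{r k<..r (Suc k)}. Z i \<omega> - sqrt (variance (Z i)) * Y i \<omega>) UNIV"
    and D_int: "\<And>k. integrable M (\<lambda>\<omega>. (\<Sum>i\<in>{r k<..r (Suc k)}. Z i \<omega> - sqrt (variance (Z i)) * Y i \<omega>)\<^sup>2)"
    and D_le: "\<And>k. (\<integral>\<omega>. (\<Sum>i\<in>{r k<..r (Suc k)}. Z i \<omega> - sqrt (variance (Z i)) * Y i \<omega>)\<^sup>2 \<partial>M)
       \<le> \<eta> k * (sum_var M Z (r (Suc k)) - sum_var M Z (r k))"
    and \<eta>_lim: "\<eta> \<longlonglongrightarrow> 0"
begin

definition S :: "nat \<Rightarrow> 'a \<Rightarrow> real" where "S m \<omega> = (\<Sum>i=1..m. Z i \<omega>)"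
definition G :: "nat \<Rightarrow> 'a \<Rightarrow> real" where "G m \<omega> = (\<Sum>i=1..m. sqrt (\<sigma>2 i) * Y i \<omega>)"
definition D :: "nat \<Rightarrow> 'a \<Rightarrow> real" where
  "D k \<omega> = (\<Sum>i\<in>{r k<..r (Suc k)}. Z i \<omega> - sqrt (\<sigma>2 i) * Y i \<omega>)"
definition w :: "nat \<Rightarrow> real" where "w k = s2 (r (Suc k)) - s2 (r k)"

lemma sum_Icc_split: "(p :: nat) \<le> m \<Longrightarrow> (\<Sum>i=1..m. f i) = (\<Sum>i=1..p. f i) + (\<Sum>i\<in>{p<..m}. f i :: real)"
proof -
  assume "p \<le> m"
  then have "{1..m} = {1..p} \<union> {p<..m}" by auto
  then show ?thesis by (simp only:) (subst sum.union_disjoint, auto)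
qed

lemma S_diff: "p \<le> m \<Longrightarrow> S m \<omega> - S p \<omega> = (\<Sum>i\<in>{p<..m}. Z i \<omega>)"
  unfolding S_def using sum_Icc_split[of p m "\<lambda>i. Z i \<omega>"] by simp

lemma G_diff: "p \<le> m \<Longrightarrow> G m \<omega> - G p \<omega> = (\<Sum>i\<in>{p<..m}. sqrt (\<sigma>2 i) * Y i \<omega>)"
  unfolding G_def using sum_Icc_split[of p m "\<lambda>i. sqrt (\<sigma>2 i) * Y i \<omega>"] by simp

lemma Y_rv: "i \<ge> 1 \<Longrightarrow> Y i \<in> borel_measurable M"
  using indep_vars_rv[OF Y_indep] by auto

lemma S_rv[measurable]: "S m \<in> borel_measurable M"
  unfolding S_def using rv by (intro borel_measurable_sum) auto

lemma G_rv[measurable]: "G m \<in> borel_measurable M"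
  unfolding G_def using Y_rv by (intro borel_measurable_sum borel_measurable_times) auto

lemma r_less: "r k < r (Suc k)" using strict_monoD[OF r_mono, of k "Suc k"] by simp

lemma w_pos: "w k > 0" using strict_monoD[OF sum_var_strict_mono r_less[of k]] by (simp add: w_def)

lemma sum_w: "(\<Sum>k<K. w k) = s2 (r K)"
  unfolding w_def by (subst sum_lessThan_telescope) (simp add: r_0 sum_var_0)

lemma D_eq: "D k \<omega> = (S (r (Suc k)) \<omega> - S (r k) \<omega>) - (G (r (Suc k)) \<omega> - G (r k) \<omega>)"
  using r_less[of k] by (simp add: D_def S_diff G_diff sum_subtractf)

lemma sum_D: "(\<Sum>k<K. D k \<omega>) = S (r K) \<omega> - G (r K) \<omega>"
proof -
  have "(\<Sum>k<K. D k \<omega>) = (\<Sum>k<K. (S (r (Suc k)) \<omega> - G (r (Suc k)) \<omega>) - (S (r k) \<omega> - G (r k) \<omega>))"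
    by (intro sum.cong) (auto simp: D_eq)
  also have "\<dots> = S (r K) \<omega> - G (r K) \<omega>"
    by (subst sum_lessThan_telescope) (simp add: r_0 S_def G_def)
  finally show ?thesis .
qed

lemma D_rv[measurable]: "D k \<in> borel_measurable M"
  unfolding D_eq[abs_def] by measurable

lemma D_sq: "integrable M (\<lambda>\<omega>. (D k \<omega>)\<^sup>2)" "expectation (\<lambda>\<omega>. (D k \<omega>)\<^sup>2) \<le> \<eta> k * w k"
  using D_int D_le by (auto simp: D_def w_def)

lemma \<eta>_nonneg: "\<eta> k \<ge> 0"
proof -
  have "0 \<le> \<eta> k * w k" using D_sq(2)[of k] by (rule order_trans[rotated]) simp
  then show ?thesis using w_pos[of k] by (simp add: zero_le_mult_iff)
qed

lemma Y_sq: "i \<ge> 1 \<Longrightarrow> integrable M (\<lambda>\<omega>. (Y i \<omega>)\<^sup>2) \<and> expectation (\<lambda>\<omega>. (Y i \<omega>)\<^sup>2) = 1 \<and> expectation (Y i) = 0"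
proof -
  assume i: "i \<ge> 1"
  note d = Y_normal[OF i]
  have e: "expectation (Y i) = 0" by (rule standard_normal_distributed_expectation[OF d])
  moreover have "variance (Y i) = 1" by (rule standard_normal_distributed_variance[OF d])
  moreover have "integrable M (\<lambda>\<omega>. (Y i \<omega>)\<^sup>2)"
    using distributed_integrable[OF d, of "\<lambda>x. x\<^sup>2"] integrable_std_normal_moment[of 2] by simp
  ultimately show ?thesis by simp
qed

lemma G_summand: "i \<ge> 1 \<Longrightarrow> integrable M (\<lambda>\<omega>. (sqrt (\<sigma>2 i) * Y i \<omega>)\<^sup>2) \<and>
  expectation (\<lambda>\<omega>. (sqrt (\<sigma>2 i) * Y i \<omega>)\<^sup>2) = \<sigma>2 i \<and> expectation (\<lambda>\<omega>. sqrt (\<sigma>2 i) * Y i \<omega>) = 0"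
  using Y_sq[of i] variance_pos[of i] by (simp add: power_mult_distrib)

section \<open>Tail bounds for normal increments, block oscillations and accumulated
  differences\<close>

lemma G_tail:
  assumes "p \<le> q" "a > 0"
  shows "prob {\<omega>\<in>space M. \<bar>G q \<omega> - G p \<omega>\<bar> > a} \<le> 3 * (s2 q - s2 p)\<^sup>2 / a^4"
proof (cases "p = q")
  case True then show ?thesis using assms by simp
next
  case False
  then have pq: "p < q" using assms by simp
  have pos: "s2 q - s2 p > 0" using strict_monoD[OF sum_var_strict_mono pq] by simp
  have "(sqrt (s2 q - s2 p))^4 = (s2 q - s2 p)\<^sup>2"
    using pos by (simp add: eval_nat_numeral)
  moreover have "{\<omega>\<in>space M. \<bar>G q \<omega> - G p \<omega>\<bar> > a} = {\<omega>\<in>space M. \<bar>\<Sum>i\<in>{p<..q}. sqrt (\<sigma>2 i) * Y i \<omega>\<bar> > a}"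
    using assms by (simp add: G_diff)
  ultimately show ?thesis
    using normal_tail[OF normal_block[OF prob_space_axioms Y_indep Y_normal pq] _ assms(2)] pos by simp
qed

text \<open>Ottaviani's inequality extends the fourth moment bound from the final increment to the
  maximum, at the price of a factor 2 and of a doubled threshold.\<close>

lemma G_max_tail:
  assumes "p \<le> q" "a > 0" "s2 q - s2 p \<le> a\<^sup>2 / 2"
  shows "prob {\<omega>\<in>space M. \<exists>m\<in>{p..q}. \<bar>G m \<omega> - G p \<omega>\<bar> > 2 * a} \<le> 6 * (s2 q - s2 p)\<^sup>2 / a^4"
proof -
  have "prob {\<omega>\<in>space M. \<exists>m\<in>{p..q}. \<bar>\<Sum>i\<in>{p<..m}. sqrt (\<sigma>2 i) * Y i \<omega>\<bar> > 2 * a}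
    \<le> 2 * prob {\<omega>\<in>space M. \<bar>\<Sum>i\<in>{p<..q}. sqrt (\<sigma>2 i) * Y i \<omega>\<bar> > a}"
  proof (rule ottaviani_second_moment)
    show "indep_vars (\<lambda>_. borel) (\<lambda>i \<omega>. sqrt (\<sigma>2 i) * Y i \<omega>) {p<..q}"
      by (intro indep_vars_compose2[OF indep_vars_subset[OF Y_indep]]) auto
    have "(\<Sum>i\<in>{p<..q}. expectation (\<lambda>\<omega>. (sqrt (\<sigma>2 i) * Y i \<omega>)\<^sup>2)) = (\<Sum>i\<in>{p<..q}. \<sigma>2 i)"
      using G_summand by (intro sum.cong) auto
    then show "(\<Sum>i\<in>{p<..q}. expectation (\<lambda>\<omega>. (sqrt (\<sigma>2 i) * Y i \<omega>)\<^sup>2)) \<le> a\<^sup>2 / 2"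
      using assms by (simp add: sum_var_diff)
  qed (use G_summand assms in auto)
  moreover have "{\<omega>\<in>space M. \<exists>m\<in>{p..q}. \<bar>\<Sum>i\<in>{p<..m}. sqrt (\<sigma>2 i) * Y i \<omega>\<bar> > 2 * a} =
    {\<omega>\<in>space M. \<exists>m\<in>{p..q}. \<bar>G m \<omega> - G p \<omega>\<bar> > 2 * a}"
    by (intro Collect_cong conj_cong bex_cong) (auto simp: G_diff)
  moreover have "prob {\<omega>\<in>space M. \<bar>\<Sum>i\<in>{p<..q}. sqrt (\<sigma>2 i) * Y i \<omega>\<bar> > a} \<le> 3 * (s2 q - s2 p)\<^sup>2 / a^4"
    using G_tail[OF assms(1,2)] assms by (simp add: G_diff)
  ultimately show ?thesis by simp
qed

text \<open>Ottaviani's inequality is applied to \<open>Z\<close> itself; the remaining tail of the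
  block sum is split at \<open>a / 2\<close> into the normal increment and the coupling difference.
  The constants are \<open>2 * 3 * 2^4 = 96\<close> and \<open>2 * 2^2 = 8\<close>.\<close>

lemma S_block_max_tail:
  assumes a: "a > 0" "w k \<le> a\<^sup>2 / 2"
  shows "prob {\<omega>\<in>space M. \<exists>m\<in>{r k..r (Suc k)}. \<bar>S m \<omega> - S (r k) \<omega>\<bar> > 2 * a}
    \<le> 96 * (w k)\<^sup>2 / a^4 + 8 * (\<eta> k * w k) / a\<^sup>2"
proof -
  let ?p = "r k" and ?q = "r (Suc k)"
  have pq: "?p \<le> ?q" using r_less[of k] by simp
  have "prob {\<omega>\<in>space M. \<exists>m\<in>{?p..?q}. \<bar>\<Sum>i\<in>{?p<..m}. Z i \<omega>\<bar> > 2 * a}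
    \<le> 2 * prob {\<omega>\<in>space M. \<bar>\<Sum>i\<in>{?p<..?q}. Z i \<omega>\<bar> > a}"
  proof (rule ottaviani_second_moment)
    show "indep_vars (\<lambda>_. borel) Z {?p<..?q}" by (rule indep_vars_subset[OF indep]) auto
    have "(\<Sum>i\<in>{?p<..?q}. expectation (\<lambda>\<omega>. (Z i \<omega>)\<^sup>2)) = (\<Sum>i\<in>{?p<..?q}. \<sigma>2 i)"
      by (intro sum.cong refl variance_eq[symmetric]) auto
    then show "(\<Sum>i\<in>{?p<..?q}. expectation (\<lambda>\<omega>. (Z i \<omega>)\<^sup>2)) \<le> a\<^sup>2 / 2"
      using a sum_var_diff[OF pq] by (simp add: w_def)
  qed (use mean square_integrable a in auto)
  moreover have "{\<omega>\<in>space M. \<exists>m\<in>{?p..?q}. \<bar>\<Sum>i\<in>{?p<..m}. Z i \<omega>\<bar> > 2 * a} =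
    {\<omega>\<in>space M. \<exists>m\<in>{?p..?q}. \<bar>S m \<omega> - S ?p \<omega>\<bar> > 2 * a}"
    by (intro Collect_cong conj_cong bex_cong) (auto simp: S_diff)
  moreover have "prob {\<omega>\<in>space M. \<bar>\<Sum>i\<in>{?p<..?q}. Z i \<omega>\<bar> > a} \<le> 48 * (w k)\<^sup>2 / a^4 + 4 * (\<eta> k * w k) / a\<^sup>2"
  proof -
    have "{\<omega>\<in>space M. \<bar>\<Sum>i\<in>{?p<..?q}. Z i \<omega>\<bar> > a} = {\<omega>\<in>space M. \<bar>(G ?q \<omega> - G ?p \<omega>) + D k \<omega>\<bar> > 2 * (a / 2)}"
      using pq by (simp add: D_eq S_diff)
    then have "prob {\<omega>\<in>space M. \<bar>\<Sum>i\<in>{?p<..?q}. Z i \<omega>\<bar> > a} \<le>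
      prob {\<omega>\<in>space M. \<bar>G ?q \<omega> - G ?p \<omega>\<bar> > a / 2} + prob {\<omega>\<in>space M. \<bar>D k \<omega>\<bar> > a / 2}"
      by (simp only:) (rule prob_abs_add_le, measurable)
    also have "prob {\<omega>\<in>space M. \<bar>G ?q \<omega> - G ?p \<omega>\<bar> > a / 2} \<le> 3 * (w k)\<^sup>2 / (a / 2)^4"
      using G_tail[OF pq, of "a / 2"] a by (simp add: w_def)
    also have "prob {\<omega>\<in>space M. \<bar>D k \<omega>\<bar> > a / 2} \<le> expectation (\<lambda>\<omega>. (D k \<omega>)\<^sup>2) / (a / 2)\<^sup>2"
      using a by (intro second_moment_tail D_sq) auto
    also have "\<dots> \<le> \<eta> k * w k / (a / 2)\<^sup>2"
      using D_sq(2)[of k] by (intro divide_right_mono) auto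
    finally show ?thesis by (simp add: power_divide eval_nat_numeral mult_ac)
  qed
  ultimately show ?thesis by simp
qed

text \<open>Along the block boundaries \<open>S - G\<close> is a random walk with the independent
  centred steps \<open>D k\<close>, so its maximum is controlled by its final variance.\<close>

lemma D_max_tail:
  assumes a: "a > 0" "(\<Sum>k<K. \<eta> k * w k) \<le> a\<^sup>2 / 2"
  shows "prob {\<omega>\<in>space M. \<exists>k\<le>K. \<bar>S (r k) \<omega> - G (r k) \<omega>\<bar> > 2 * a} \<le> 2 * (\<Sum>k<K. \<eta> k * w k) / a\<^sup>2"
proof -
  have D_int1: "integrable M (D k)" for k using square_integrable_imp_integrable[OF D_rv D_sq(1)] .
  have Z_int: "integrable M (Z i)" "integrable M (Y i)" if "i \<ge> 1" for i
    using square_integrable_imp_integrable[OF rv[OF that] square_integrable[OF that]]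
      square_integrable_imp_integrable[OF Y_rv[OF that]] Y_sq[OF that] by auto
  have D_mean: "expectation (D k) = 0" for k
  proof -
    have "expectation (D k) = (\<Sum>i\<in>{r k<..r (Suc k)}. expectation (\<lambda>\<omega>. Z i \<omega> - sqrt (\<sigma>2 i) * Y i \<omega>))"
      unfolding D_def[abs_def] using Z_int by (intro Bochner_Integration.integral_sum) auto
    also have "\<dots> = 0" using Z_int mean Y_sq by (intro sum.neutral) auto
    finally show ?thesis .
  qed
  \<comment> \<open>The shift adapts block numbers, which start at 0, to the summation range
    \<open>{0<..K}\<close> of the maximal inequality.\<close>
  let ?X = "\<lambda>i. D (i - 1)"
  have "indep_vars (\<lambda>_. borel) D UNIV" using D_indep by (simp add: D_def[abs_def])
  then have indX: "indep_vars (\<lambda>_. borel) ?X {0<..K}"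
  proof -
    assume "indep_vars (\<lambda>_. borel) D UNIV"
    have "disjoint_family_on (\<lambda>i. {i - 1}) {0<..K}"
      unfolding disjoint_family_on_def by (intro ballI impI) auto
    from indep_vars_restrict[OF \<open>indep_vars (\<lambda>_. borel) D UNIV\<close> _ this]
    have "indep_vars (\<lambda>j. Pi\<^sub>M {j - 1} (\<lambda>_. borel)) (\<lambda>j \<omega>. restrict (\<lambda>i. D i \<omega>) {j - 1}) {0<..K}"
      by simp
    from indep_vars_compose2[OF this, of "\<lambda>j x. x (j - 1)" "\<lambda>_. borel"]
    show ?thesis by simp
  qed
  have sumX: "(\<Sum>i\<in>{0<..k}. f (i - 1)) = (\<Sum>j<k. f j)" for f :: "nat \<Rightarrow> real" and k :: nat
  proof -
    have "{0<..k} = Suc ` {..<k}" by (auto simp: image_Suc_lessThan)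
    then show ?thesis by (simp add: sum.reindex)
  qed
  have "prob {\<omega>\<in>space M. \<exists>k\<in>{0..K}. \<bar>\<Sum>i\<in>{0<..k}. ?X i \<omega>\<bar> > 2 * a}
    \<le> 2 * prob {\<omega>\<in>space M. \<bar>\<Sum>i\<in>{0<..K}. ?X i \<omega>\<bar> > a}"
  proof (rule ottaviani_second_moment[OF indX])
    have "(\<Sum>i\<in>{0<..K}. expectation (\<lambda>\<omega>. (D (i - 1) \<omega>)\<^sup>2)) \<le> (\<Sum>i\<in>{0<..K}. \<eta> (i - 1) * w (i - 1))"
      using D_sq by (intro sum_mono)
    also have "\<dots> = (\<Sum>k<K. \<eta> k * w k)" by (rule sumX[of "\<lambda>k. \<eta> k * w k"])
    finally show "(\<Sum>i\<in>{0<..K}. expectation (\<lambda>\<omega>. (D (i - 1) \<omega>)\<^sup>2)) \<le> a\<^sup>2 / 2" using a by simp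
  qed (use D_mean D_sq a in auto)
  also have "prob {\<omega>\<in>space M. \<bar>\<Sum>i\<in>{0<..K}. ?X i \<omega>\<bar> > a} \<le> (\<Sum>k<K. \<eta> k * w k) / a\<^sup>2"
  proof -
    have mom: "integrable M (\<lambda>\<omega>. (\<Sum>i\<in>{0<..K}. ?X i \<omega>)\<^sup>2) \<and>
      expectation (\<lambda>\<omega>. (\<Sum>i\<in>{0<..K}. ?X i \<omega>)\<^sup>2) = (\<Sum>i\<in>{0<..K}. expectation (\<lambda>\<omega>. (?X i \<omega>)\<^sup>2))"
      using D_mean D_sq by (intro indep_sum_second_moment indX) auto
    have "prob {\<omega>\<in>space M. \<bar>\<Sum>i\<in>{0<..K}. ?X i \<omega>\<bar> > a} \<le> expectation (\<lambda>\<omega>. (\<Sum>i\<in>{0<..K}. ?X i \<omega>)\<^sup>2) / a\<^sup>2"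
      using mom by (intro second_moment_tail a) auto
    also have "\<dots> \<le> (\<Sum>i\<in>{0<..K}. \<eta> (i - 1) * w (i - 1)) / a\<^sup>2"
      using mom D_sq by (auto intro!: divide_right_mono sum_mono)
    also have "\<dots> = (\<Sum>k<K. \<eta> k * w k) / a\<^sup>2" by (simp only: sumX[of "\<lambda>k. \<eta> k * w k"])
    finally show ?thesis .
  qed
  finally show ?thesis
    unfolding sumX[of "\<lambda>k. D k _"] sum_D by (simp add: Ball_def Bex_def)
qed

text \<open>Inside a block, \<open>S - G\<close> is its value at the left boundary plus the
  oscillations of \<open>S\<close> and \<open>G\<close> since then. Each of the three is kept within
  \<open>2 * a\<close>, whence the 6. All probabilities reduce to two weighted averages that tend to
  0: \<open>H\<close> for the coupling errors, \<open>Q\<close> for the squared block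
  variances.\<close>

lemma coupling_close_blocks:
  assumes \<epsilon>: "\<epsilon> > 0"
  shows "(\<lambda>K. prob {\<omega>\<in>space M. \<exists>m\<le>r K. \<bar>S m \<omega> - G m \<omega>\<bar> > 6 * (\<epsilon> * sqrt (s2 (r K)))}) \<longlonglongrightarrow> 0"
proof -
  define H where "H K = (\<Sum>k<K. \<eta> k * w k) / (\<Sum>k<K. w k)" for K
  define Q where "Q K = (\<Sum>k<K. (w k / s2 (r (Suc k))) * w k) / (\<Sum>k<K. w k)" for K
  have top: "filterlim (\<lambda>n. \<Sum>k<n. w k) at_top sequentially"
    unfolding sum_w by (rule filterlim_compose[OF sum_var_at_top filterlim_subseq[OF r_mono]])
  have H: "H \<longlonglongrightarrow> 0" unfolding H_def[abs_def] by (rule toeplitz_weighted[OF \<eta>_lim w_pos top])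
  have Q: "Q \<longlonglongrightarrow> 0" unfolding Q_def[abs_def] using block_ratio
    by (intro toeplitz_weighted[OF _ w_pos top]) (simp add: w_def)
  \<comment> \<open>The 10 is \<open>2 + 8\<close>, from the boundaries and from the differences
    inside blocks; the 102 is \<open>96 + 6\<close>, from the oscillations of \<open>S\<close> and
    of \<open>G\<close>.\<close>
  define b where "b K = 10 * H K / \<epsilon>\<^sup>2 + 102 * Q K / \<epsilon>^4" for K
  have "b \<longlonglongrightarrow> 10 * 0 / \<epsilon>\<^sup>2 + 102 * 0 / \<epsilon>^4" unfolding b_def[abs_def] using \<epsilon> by (intro tendsto_intros H Q) auto
  then have b: "b \<longlonglongrightarrow> 0" by simp
  show ?thesis
  proof (rule tendsto_sandwich[OF _ _ tendsto_const b])
    have "eventually (\<lambda>K. H K < \<epsilon>\<^sup>2 / 2) sequentially"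
      using order_tendstoD(2)[OF H, of "\<epsilon>\<^sup>2 / 2"] \<epsilon> by simp
    moreover have "eventually (\<lambda>K. Q K < \<epsilon>^4 / 4) sequentially"
      using order_tendstoD(2)[OF Q, of "\<epsilon>^4 / 4"] \<epsilon> by simp
    ultimately show "eventually (\<lambda>K. prob {\<omega>\<in>space M. \<exists>m\<le>r K. \<bar>S m \<omega> - G m \<omega>\<bar> > 6 * (\<epsilon> * sqrt (s2 (r K)))} \<le> b K) sequentially"
      using eventually_ge_at_top[of 1]
    proof eventually_elim
      case (elim K)
      define T where "T = s2 (r K)"
      have "r K \<ge> 1" using elim(3) strict_mono_less[OF r_mono, of 0 K] r_0 by simp
      then have T: "T > 0" unfolding T_def by (rule sum_var_pos)
      define a where "a = \<epsilon> * sqrt T"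
      have a: "a > 0" "a\<^sup>2 = \<epsilon>\<^sup>2 * T" using \<epsilon> T by (auto simp: a_def power_mult_distrib)
      have a4: "a^4 = \<epsilon>^4 * T\<^sup>2"
        using a(2) by (metis mult.commute power_mult power_mult_distrib numeral_Bit0 mult_2_right numeral_times_numeral power_even_eq)
      have HT: "(\<Sum>k<K. \<eta> k * w k) = H K * T" using T by (simp add: H_def sum_w T_def)
      \<comment> \<open>As \<open>T\<close> dominates the variance at the end of every block, the
        sum of squares is at most \<open>T\<close> times a weighted sum of the block ratios, which
        tend to 0.\<close>
      have QT: "(\<Sum>k<K. (w k)\<^sup>2) \<le> Q K * T\<^sup>2"
      proof -
        have "(\<Sum>k<K. (w k)\<^sup>2) \<le> (\<Sum>k<K. T * ((w k / s2 (r (Suc k))) * w k))"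
        proof (rule sum_mono)
          fix k assume "k \<in> {..<K}"
          then have "r (Suc k) \<le> r K" using r_mono by (simp add: strict_mono_less_eq)
          then have le: "s2 (r (Suc k)) \<le> T" unfolding T_def by (rule sum_var_mono)
          have p: "s2 (r (Suc k)) > 0" using r_less[of k] by (intro sum_var_pos) simp
          have "1 \<le> T / s2 (r (Suc k))" using le p by simp
          then have "1 * (w k)\<^sup>2 \<le> T / s2 (r (Suc k)) * (w k)\<^sup>2" by (intro mult_right_mono) auto
          then show "(w k)\<^sup>2 \<le> T * ((w k / s2 (r (Suc k))) * w k)" by (simp add: power2_eq_square mult_ac)
        qed
        also have "\<dots> = T * (\<Sum>k<K. (w k / s2 (r (Suc k))) * w k)" by (rule sum_distrib_left[symmetric])
        also have "(\<Sum>k<K. (w k / s2 (r (Suc k))) * w k) = Q K * T"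
          unfolding Q_def sum_w T_def[symmetric] using T by simp
        also have "T * (Q K * T) = Q K * T\<^sup>2" by (simp add: power2_eq_square)
        finally show ?thesis .
      qed
      \<comment> \<open>The variance condition of the maximal inequalities: a single square is at
        most the sum of all squares.\<close>
      have wk: "w k \<le> a\<^sup>2 / 2" if "k < K" for k
      proof -
        have "(w k)\<^sup>2 \<le> (\<Sum>k<K. (w k)\<^sup>2)" using that by (intro member_le_sum) auto
        also have "\<dots> \<le> Q K * T\<^sup>2" by (rule QT)
        also have "\<dots> \<le> \<epsilon>^4 / 4 * T\<^sup>2" using elim(2) by (intro mult_right_mono) auto
        also have "\<dots> = (a\<^sup>2 / 2)\<^sup>2" unfolding a(2) by (simp add: power_divide power_mult_distrib eval_nat_numeral)
        finally show ?thesis by (rule power2_le_imp_le) simp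
      qed
      define B1 where "B1 = {\<omega>\<in>space M. \<exists>k\<le>K. \<bar>S (r k) \<omega> - G (r k) \<omega>\<bar> > 2 * a}"
      define B2 where "B2 k = {\<omega>\<in>space M. \<exists>m\<in>{r k..r (Suc k)}. \<bar>S m \<omega> - S (r k) \<omega>\<bar> > 2 * a}" for k
      define B3 where "B3 k = {\<omega>\<in>space M. \<exists>m\<in>{r k..r (Suc k)}. \<bar>G m \<omega> - G (r k) \<omega>\<bar> > 2 * a}" for k
      have ev[measurable]: "B1 \<in> events" "B2 k \<in> events" "B3 k \<in> events" for k
        unfolding B1_def B2_def B3_def by measurable
      have "(\<Sum>k<K. \<eta> k * w k) \<le> a\<^sup>2 / 2"
      proof -
        have "H K * T \<le> \<epsilon>\<^sup>2 / 2 * T" using elim(1) T by (intro mult_right_mono) auto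
        then show ?thesis by (simp add: HT a(2))
      qed
      from D_max_tail[OF a(1) this] have p1: "prob B1 \<le> 2 * (H K * T) / a\<^sup>2" by (simp add: B1_def HT)
      have p2: "prob (B2 k) \<le> 96 * (w k)\<^sup>2 / a^4 + 8 * (\<eta> k * w k) / a\<^sup>2" if "k < K" for k
        unfolding B2_def using S_block_max_tail[OF a(1) wk[OF that]] .
      have p3: "prob (B3 k) \<le> 6 * (w k)\<^sup>2 / a^4" if "k < K" for k
        unfolding B3_def using G_max_tail[OF _ a(1), of "r k" "r (Suc k)"] r_less[of k] wk[OF that] by (simp add: w_def)
      have sub: "{\<omega>\<in>space M. \<exists>m\<le>r K. \<bar>S m \<omega> - G m \<omega>\<bar> > 6 * a} \<subseteq> B1 \<union> (\<Union>k<K. B2 k \<union> B3 k)"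
      proof
        fix \<omega> assume "\<omega> \<in> {\<omega>\<in>space M. \<exists>m\<le>r K. \<bar>S m \<omega> - G m \<omega>\<bar> > 6 * a}"
        then obtain m where m: "\<omega> \<in> space M" "m \<le> r K" "\<bar>S m \<omega> - G m \<omega>\<bar> > 6 * a" by auto
        \<comment> \<open>Index 0 lies in no block, but both sums vanish there. Any other
          \<open>m\<close> lies in the block that ends at the first boundary not below
          \<open>m\<close>.\<close>
        have m0: "m \<noteq> 0"
        proof
          assume "m = 0"
          then show False using m(3) a by (simp add: S_def G_def)
        qed
        define k' where "k' = (LEAST k. m \<le> r k)"
        have k': "m \<le> r k'" "k' \<le> K" unfolding k'_def using m(2) by (auto intro: LeastI Least_le)
        obtain k where k: "k' = Suc k" using k'(1) m0 r_0 by (cases k') auto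
        have "\<not> m \<le> r k" using not_less_Least[of k "\<lambda>k. m \<le> r k"] k unfolding k'_def by simp
        then have mk: "m \<in> {r k..r (Suc k)}" "k < K" using k' k by auto
        show "\<omega> \<in> B1 \<union> (\<Union>k<K. B2 k \<union> B3 k)"
        proof (rule ccontr)
          assume n: "\<omega> \<notin> B1 \<union> (\<Union>k<K. B2 k \<union> B3 k)"
          have nB: "\<omega> \<notin> B1" "\<omega> \<notin> B2 k" "\<omega> \<notin> B3 k" using n mk by auto
          have "\<bar>S (r k) \<omega> - G (r k) \<omega>\<bar> \<le> 2 * a"
            using nB(1) m(1) less_imp_le[OF mk(2)] unfolding B1_def mem_Collect_eq by (meson not_less)
          moreover have "\<bar>S m \<omega> - S (r k) \<omega>\<bar> \<le> 2 * a"
            using nB(2) m(1) mk(1) unfolding B2_def mem_Collect_eq by (meson not_less)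
          moreover have "\<bar>G m \<omega> - G (r k) \<omega>\<bar> \<le> 2 * a"
            using nB(3) m(1) mk(1) unfolding B3_def mem_Collect_eq by (meson not_less)
          ultimately show False using m(3) by linarith
        qed
      qed
      have "prob {\<omega>\<in>space M. \<exists>m\<le>r K. \<bar>S m \<omega> - G m \<omega>\<bar> > 6 * a} \<le> prob (B1 \<union> (\<Union>k<K. B2 k \<union> B3 k))"
        using sub by (intro finite_measure_mono) auto
      also have "\<dots> \<le> prob B1 + prob (\<Union>k<K. B2 k \<union> B3 k)" by (intro measure_Un_le) auto
      also have "prob (\<Union>k<K. B2 k \<union> B3 k) \<le> (\<Sum>k<K. prob (B2 k \<union> B3 k))"
        by (intro measure_UNION_le) auto
      also have "\<dots> \<le> (\<Sum>k<K. 102 / a^4 * (w k)\<^sup>2 + 8 / a\<^sup>2 * (\<eta> k * w k))"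
      proof (rule sum_mono)
        fix k assume "k \<in> {..<K}"
        then have k: "k < K" by simp
        have "prob (B2 k \<union> B3 k) \<le> prob (B2 k) + prob (B3 k)" by (intro measure_Un_le) auto
        then show "prob (B2 k \<union> B3 k) \<le> 102 / a^4 * (w k)\<^sup>2 + 8 / a\<^sup>2 * (\<eta> k * w k)"
          using p2[OF k] p3[OF k] by (simp add: field_simps)
      qed
      also have "\<dots> = 102 / a^4 * (\<Sum>k<K. (w k)\<^sup>2) + 8 / a\<^sup>2 * (H K * T)"
        unfolding HT[symmetric] by (simp only: sum.distrib sum_distrib_left)
      also have "102 / a^4 * (\<Sum>k<K. (w k)\<^sup>2) \<le> 102 / a^4 * (Q K * T\<^sup>2)"
        using QT a by (intro mult_left_mono) auto
      finally have "prob {\<omega>\<in>space M. \<exists>m\<le>r K. \<bar>S m \<omega> - G m \<omega>\<bar> > 6 * a}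
        \<le> 2 * (H K * T) / a\<^sup>2 + (102 / a^4 * (Q K * T\<^sup>2) + 8 / a\<^sup>2 * (H K * T))" using p1 by linarith
      also have "\<dots> = b K" using T \<epsilon> unfolding a4 a(2) b_def by (simp add: field_simps)
      finally show ?case by (simp add: a_def T_def)
    qed
  qed (auto simp: measure_nonneg)
qed

text \<open>A general \<open>n\<close> is enlarged to the next boundary \<open>r (K n)\<close>.
  Eventually a block holds less than half of the variance up to its end, so this at most doubles the
  variance; the \<open>sqrt 2\<close> in \<open>\<epsilon>'\<close> pays for it.\<close>

lemma coupling_close:
  assumes \<epsilon>: "\<epsilon> > 0"
  shows "(\<lambda>n. prob {\<omega>\<in>space M. \<exists>m\<le>n. \<bar>S m \<omega> - G m \<omega>\<bar> > \<epsilon> * sqrt (s2 n)}) \<longlonglongrightarrow> 0"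
proof -
  define K where "K n = (LEAST k. n \<le> r k)" for n
  have K: "n \<le> r (K n)" for n
    unfolding K_def using strict_mono_imp_increasing[OF r_mono, of n] by (rule LeastI)
  have K_le: "r (K n - 1) < n" if "n \<ge> 1" for n
  proof (cases "K n")
    case 0 then show ?thesis using that r_0 by simp
  next
    case (Suc k)
    then show ?thesis using not_less_Least[of k "\<lambda>k. n \<le> r k"] unfolding K_def[symmetric] by simp
  qed
  have K_top: "filterlim K at_top sequentially"
    unfolding filterlim_at_top
  proof
    fix j
    show "eventually (\<lambda>n. j \<le> K n) sequentially"
      using eventually_gt_at_top[of "r j"]
    proof eventually_elim
      case (elim n)
      then have "r j < r (K n)" using K[of n] by simp
      then show ?case using r_mono by (simp add: strict_mono_less)
    qed
  qed
  define \<epsilon>' where "\<epsilon>' = \<epsilon> / (6 * sqrt 2)"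
  have \<epsilon>': "\<epsilon>' > 0" using \<epsilon> by (simp add: \<epsilon>'_def)
  have lim: "(\<lambda>n. prob {\<omega>\<in>space M. \<exists>m\<le>r (K n). \<bar>S m \<omega> - G m \<omega>\<bar> > 6 * (\<epsilon>' * sqrt (s2 (r (K n))))}) \<longlonglongrightarrow> 0"
    by (rule filterlim_compose[OF coupling_close_blocks[OF \<epsilon>'] K_top])
  show ?thesis
  proof (rule tendsto_sandwich[OF _ _ tendsto_const lim])
    have "eventually (\<lambda>k. w k / s2 (r (Suc k)) < 1 / 2) sequentially"
      using order_tendstoD(2)[OF block_ratio, of "1 / 2"] by (simp add: w_def)
    then obtain k0 where k0: "\<And>k. k \<ge> k0 \<Longrightarrow> w k / s2 (r (Suc k)) < 1 / 2" by (auto simp: eventually_sequentially)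
    have "eventually (\<lambda>n. K n \<ge> Suc k0) sequentially" using K_top unfolding filterlim_at_top by blast
    then show "eventually (\<lambda>n. prob {\<omega>\<in>space M. \<exists>m\<le>n. \<bar>S m \<omega> - G m \<omega>\<bar> > \<epsilon> * sqrt (s2 n)} \<le>
      prob {\<omega>\<in>space M. \<exists>m\<le>r (K n). \<bar>S m \<omega> - G m \<omega>\<bar> > 6 * (\<epsilon>' * sqrt (s2 (r (K n))))}) sequentially"
      using eventually_ge_at_top[of 1]
    proof eventually_elim
      case (elim n)
      obtain k where k: "K n = Suc k" "k \<ge> k0" using elim(1) by (cases "K n") auto
      have "s2 (r (Suc k)) > 0" using r_less[of k] by (intro sum_var_pos) simp
      then have "s2 (r (K n)) \<le> 2 * s2 (r k)" using k0[OF k(2)] by (simp add: k w_def divide_less_eq)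
      also have "s2 (r k) \<le> s2 n" using K_le[OF elim(2)] k by (intro sum_var_mono) simp
      finally have "sqrt (s2 (r (K n))) \<le> sqrt 2 * sqrt (s2 n)" by (simp add: real_sqrt_mult[symmetric])
      then have "6 * (\<epsilon>' * sqrt (s2 (r (K n)))) \<le> 6 * (\<epsilon>' * (sqrt 2 * sqrt (s2 n)))"
        using \<epsilon>' by (intro mult_left_mono) auto
      also have "\<dots> = \<epsilon> * sqrt (s2 n)" by (simp add: \<epsilon>'_def)
      finally have le: "6 * (\<epsilon>' * sqrt (s2 (r (K n)))) \<le> \<epsilon> * sqrt (s2 n)" .
      show ?case
      proof (rule finite_measure_mono)
        show "{\<omega>\<in>space M. \<exists>m\<le>n. \<bar>S m \<omega> - G m \<omega>\<bar> > \<epsilon> * sqrt (s2 n)} \<subseteq>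
          {\<omega>\<in>space M. \<exists>m\<le>r (K n). \<bar>S m \<omega> - G m \<omega>\<bar> > 6 * (\<epsilon>' * sqrt (s2 (r (K n))))}"
          using le K[of n] by (auto intro: order_trans le_less_trans)
      qed measurable
    qed
  qed (auto simp: measure_nonneg)
qed

end

section \<open>Sums of squares and the time change\<close>

text \<open>Bracketing for both clocks: level \<open>t * f n\<close> is respected at the chosen
  index and exceeded one index later. The last fact says nothing at \<open>k = n\<close>, hence the
  case distinctions where it is used.\<close>

lemma Max_index:
  fixes f :: "nat \<Rightarrow> real"
  assumes "f 0 = 0" "f n \<ge> 0" "t \<ge> 0"
  defines "k \<equiv> Max {m\<in>{0..n}. f m \<le> t * f n}"
  shows "k \<le> n" "f k \<le> t * f n" "k < n \<Longrightarrow> f (Suc k) > t * f n"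
proof -
  let ?A = "{m\<in>{0..n}. f m \<le> t * f n}"
  have fin: "finite ?A" and ne: "?A \<noteq> {}" using assms(1-3) by auto
  have "k \<in> ?A" unfolding k_def by (rule Max_in[OF fin ne])
  then show "k \<le> n" "f k \<le> t * f n" by auto
  assume "k < n"
  show "f (Suc k) > t * f n"
  proof (rule ccontr)
    assume "\<not> f (Suc k) > t * f n"
    then have "Suc k \<in> ?A" using \<open>k < n\<close> by auto
    then have "Suc k \<le> k" unfolding k_def by (intro Max_ge fin)
    then show False by simp
  qed
qed

lemma abs_sqrt_minus_one_le:
  fixes x :: real
  assumes "x \<ge> 0"
  shows "\<bar>sqrt x - 1\<bar> \<le> \<bar>x - 1\<bar>"
proof -
  have "x - 1 = (sqrt x - 1) * (sqrt x + 1)" using assms by (simp add: algebra_simps)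
  then have "\<bar>x - 1\<bar> = \<bar>sqrt x - 1\<bar> * (sqrt x + 1)" using assms by (simp add: abs_mult)
  moreover have "\<bar>sqrt x - 1\<bar> * 1 \<le> \<bar>sqrt x - 1\<bar> * (sqrt x + 1)"
    using assms by (intro mult_left_mono) auto
  ultimately show ?thesis by simp
qed

definition centred_squares :: "nat \<Rightarrow> (nat \<Rightarrow> real) \<Rightarrow> nat \<Rightarrow> real" where
  "centred_squares n z m = (\<Sum>i=1..m. (z i - sample_mean n z)\<^sup>2)"

text \<open>Expanding the squares leaves the corrections \<open>2 * q * S\<close> and
  \<open>m * q^2\<close>, where \<open>q\<close> is the sample mean. Cauchy-Schwarz bounds every
  partial sum by \<open>2 * sqrt (n * s n)\<close>, and the hypothesis on the full sum makes
  \<open>q\<close> at most \<open>\<delta> / 8\<close> times \<open>sqrt (s n / n)\<close>. The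
  three errors are \<open>\<delta> / 4\<close>, \<open>\<delta> / 2\<close> and
  \<open>\<delta> / 64\<close> times \<open>s n\<close>.\<close>

lemma centred_squares_close:
  fixes z :: "nat \<Rightarrow> real" and s :: "nat \<Rightarrow> real"
  assumes n: "n \<ge> 1" and s: "s n > 0" "\<And>m. m \<le> n \<Longrightarrow> s m \<le> s n" and \<delta>: "0 < \<delta>" "\<delta> \<le> 1"
    and sq: "\<And>m. m \<le> n \<Longrightarrow> \<bar>(\<Sum>i=1..m. (z i)\<^sup>2) - s m\<bar> \<le> \<delta> / 4 * s n"
    and S: "\<bar>\<Sum>i=1..n. z i\<bar> \<le> \<delta> / 8 * sqrt (real n * s n)" and m: "m \<le> n"
  shows "\<bar>centred_squares n z m - s m\<bar> \<le> \<delta> * s n"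
proof -
  define S where "S = (\<Sum>i=1..m. z i)"
  define q where "q = sample_mean n z"
  have q: "\<bar>q\<bar> * real n \<le> \<delta> / 8 * sqrt (real n * s n)"
    using S n by (simp add: q_def sample_mean_def abs_divide)
  have eq: "centred_squares n z m = (\<Sum>i=1..m. (z i)\<^sup>2) - 2 * q * S + real m * q\<^sup>2"
    unfolding centred_squares_def q_def[symmetric] S_def
    by (simp add: power2_diff sum.distrib sum_subtractf sum_distrib_left sum_distrib_right mult_ac)
  have "S\<^sup>2 \<le> (\<Sum>i=1..m. 1\<^sup>2) * (\<Sum>i=1..m. (z i)\<^sup>2)"
    unfolding S_def using Cauchy_Schwarz_ineq_sum[of "\<lambda>_. 1" z "{1..m}"] by simp
  also have "\<dots> \<le> real n * (2 * s n)"
  proof -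
    have "(\<Sum>i=1..m. (z i)\<^sup>2) \<le> s m + \<delta> / 4 * s n" using sq[OF m] by linarith
    also have "s m \<le> s n" using s m by simp
    also have "\<delta> / 4 * s n \<le> 1 * s n" using \<delta> s by (intro mult_right_mono) auto
    finally have "(\<Sum>i=1..m. (z i)\<^sup>2) \<le> 2 * s n" by simp
    then show ?thesis using m by (intro mult_mono) (auto intro!: sum_nonneg)
  qed
  also have "\<dots> \<le> (2 * sqrt (real n * s n))\<^sup>2" using s by (simp add: power_mult_distrib)
  finally have "\<bar>S\<bar> \<le> \<bar>2 * sqrt (real n * s n)\<bar>"
    by (simp only: abs_le_square_iff)
  then have Sle: "\<bar>S\<bar> \<le> 2 * sqrt (real n * s n)" using s by simp
  have "(\<bar>q\<bar> * real n) * \<bar>S\<bar> \<le> (\<delta> / 8 * sqrt (real n * s n)) * (2 * sqrt (real n * s n))"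
    by (rule mult_mono) (use q Sle \<delta> s in auto)
  also have "\<dots> = \<delta> / 4 * (real n * s n)" using s by simp
  finally have qS: "\<bar>q\<bar> * \<bar>S\<bar> \<le> \<delta> / 4 * s n" using n by simp
  have "(\<bar>q\<bar> * real n) * (\<bar>q\<bar> * real n) \<le> (\<delta> / 8 * sqrt (real n * s n)) * (\<delta> / 8 * sqrt (real n * s n))"
    by (rule mult_mono) (use q Sle \<delta> s in auto)
  also have "\<dots> = \<delta> * \<delta> / 64 * (real n * s n)" using s by simp
  also have "\<dots> \<le> \<delta> / 64 * (real n * s n)"
    using \<delta> s by (intro mult_right_mono divide_right_mono mult_left_le) auto
  finally have "real n * (real n * q\<^sup>2) \<le> real n * (\<delta> / 64 * s n)"
    by (simp add: power2_eq_square mult_ac)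
  then have "real n * q\<^sup>2 \<le> \<delta> / 64 * s n" using n by simp
  moreover have "real m * q\<^sup>2 \<le> real n * q\<^sup>2" using m by (intro mult_right_mono) auto
  ultimately have mq: "real m * q\<^sup>2 \<le> \<delta> / 64 * s n" by simp
  have "\<bar>centred_squares n z m - s m\<bar> \<le> \<bar>(\<Sum>i=1..m. (z i)\<^sup>2) - s m\<bar> + 2 * (\<bar>q\<bar> * \<bar>S\<bar>) + real m * q\<^sup>2"
  proof -
    have "\<bar>q * S\<bar> = \<bar>q\<bar> * \<bar>S\<bar>" "real m * q\<^sup>2 \<ge> 0" by (auto simp: abs_mult)
    then show ?thesis unfolding eq mult.assoc by linarith
  qed
  also have "\<dots> \<le> \<delta> / 4 * s n + 2 * (\<delta> / 4 * s n) + \<delta> / 64 * s n"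
    using sq[OF m] qS mq by linarith
  also have "\<dots> \<le> \<delta> * s n" using \<delta> s by (simp add: field_simps)
  finally show ?thesis .
qed

text \<open>The factor \<open>c\<close> is the ratio of the deterministic to the random
  normalisation, the square root of \<open>(n - 1) / n * (s / q)\<close> with \<open>q\<close> the
  observed sum of centred squares. At \<open>n = 1\<close> both sides are 0, because division by 0
  yields 0.\<close>

lemma student_normalisation:
  assumes n: "n \<ge> 1" and s: "s > 0" and \<delta>: "0 < \<delta>" "\<delta> \<le> 1/2"
    and Q: "\<bar>centred_squares n z n - s\<bar> \<le> \<delta> * s"
  obtains c where "student n z t = (\<Sum>i=1..time_data n z t. z i) / sqrt s * c" "\<bar>c - 1\<bar> \<le> 2 * (\<delta> + 1 / real n)"
proof
  define q where "q = centred_squares n z n"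
  define x where "x = (real n - 1) / real n * (s / q)"
  \<comment> \<open>The bound \<open>\<delta> \<le> 1/2\<close> keeps \<open>q\<close> above
    \<open>s / 2\<close>; this is the origin of the factor 2 in the claim.\<close>
  have "\<delta> * s \<le> 1/2 * s" using \<delta> s by (intro mult_right_mono) auto
  then have q: "q \<ge> s / 2" using Q by (simp add: q_def)
  then have qp: "q > 0" using s by simp
  have x0: "x \<ge> 0" using n s qp by (simp add: x_def)
  have n': "real n - 1 \<ge> 0" using n by simp
  have "sqrt x = sqrt (real n - 1) / sqrt (real n) * (sqrt s / sqrt q)"
    by (simp add: x_def real_sqrt_mult real_sqrt_divide)
  moreover have "student n z t = (\<Sum>i=1..time_data n z t. z i) / sqrt (real n) / (sqrt q / sqrt (real n - 1))"
    unfolding student_def q_def centred_squares_def sum_divide_distrib[symmetric] real_sqrt_divide ..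
  ultimately show "student n z t = (\<Sum>i=1..time_data n z t. z i) / sqrt s * sqrt x"
    using s by (simp add: field_simps)
  have "x - 1 = ((s - q) - s / real n) / q"
    using n qp by (simp add: x_def field_simps)
  then have "\<bar>x - 1\<bar> = \<bar>(s - q) - s / real n\<bar> / q" using qp by (simp add: abs_divide)
  also have "\<dots> \<le> (\<delta> * s + s / real n) / q"
  proof (rule divide_right_mono)
    have "s / real n \<ge> 0" using s by simp
    then show "\<bar>(s - q) - s / real n\<bar> \<le> \<delta> * s + s / real n"
      using Q unfolding q_def[symmetric] by linarith
  qed (use qp in simp)
  also have "\<dots> \<le> (\<delta> * s + s / real n) / (s / 2)"
    using q s \<delta> n by (intro divide_left_mono) auto
  also have "\<dots> = 2 * (\<delta> + 1 / real n)" using s by (simp add: field_simps)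
  finally show "\<bar>sqrt x - 1\<bar> \<le> 2 * (\<delta> + 1 / real n)"
    using abs_sqrt_minus_one_le[OF x0] by simp
qed

context lindeberg_sequence
begin

lemma S_max_tail:
  assumes a: "a > 0" "s2 n \<le> a\<^sup>2 / 2"
  shows "prob {\<omega>\<in>space M. \<exists>m\<le>n. \<bar>\<Sum>i=1..m. Z i \<omega>\<bar> > 2 * a} \<le> 2 * s2 n / a\<^sup>2"
    and "prob {\<omega>\<in>space M. \<bar>\<Sum>i=1..n. Z i \<omega>\<bar> > a} \<le> s2 n / a\<^sup>2"
proof -
  have I: "{0<..m} = {1..m}" for m :: nat by auto
  have ind: "indep_vars (\<lambda>_. borel) Z {0<..n}" by (rule indep_vars_subset[OF indep]) auto
  have sum: "(\<Sum>i\<in>{0<..n}. expectation (\<lambda>\<omega>. (Z i \<omega>)\<^sup>2)) = s2 n"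
    unfolding sum_var_def I by (intro sum.cong refl variance_eq[symmetric]) auto
  have "integrable M (\<lambda>\<omega>. (\<Sum>i\<in>{0<..n}. Z i \<omega>)\<^sup>2) \<and> expectation (\<lambda>\<omega>. (\<Sum>i\<in>{0<..n}. Z i \<omega>)\<^sup>2) = s2 n"
    unfolding sum[symmetric] using mean square_integrable by (intro indep_sum_second_moment ind) auto
  then show *: "prob {\<omega>\<in>space M. \<bar>\<Sum>i=1..n. Z i \<omega>\<bar> > a} \<le> s2 n / a\<^sup>2"
    using second_moment_tail[of "\<lambda>\<omega>. \<Sum>i\<in>{0<..n}. Z i \<omega>" a] a rv unfolding I by (auto intro!: borel_measurable_sum)
  have "prob {\<omega>\<in>space M. \<exists>m\<in>{0..n}. \<bar>\<Sum>i\<in>{0<..m}. Z i \<omega>\<bar> > 2 * a}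
    \<le> 2 * prob {\<omega>\<in>space M. \<bar>\<Sum>i\<in>{0<..n}. Z i \<omega>\<bar> > a}"
    by (rule ottaviani_second_moment[OF ind]) (use mean square_integrable a sum in auto)
  then show "prob {\<omega>\<in>space M. \<exists>m\<le>n. \<bar>\<Sum>i=1..m. Z i \<omega>\<bar> > 2 * a} \<le> 2 * s2 n / a\<^sup>2"
    using * unfolding I by (simp add: Bex_def)
qed

text \<open>The squares are truncated at level \<open>\<delta> * sqrt s\<close> of \<open>Z\<close>.
  The bounded part \<open>\<tau>\<close> has second moments at most
  \<open>\<delta>\<^sup>2 * s\<close> times the variances, so Ottaviani's inequality controls all
  its centred partial sums. The rest \<open>\<rho>\<close> is nonnegative with total mean
  \<open>lind_frac \<delta> n * s\<close>, so Markov's inequality for the full sum covers all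
  partial sums.\<close>

lemma raikov:
  assumes \<epsilon>: "\<epsilon> > 0"
  shows "(\<lambda>n. prob {\<omega>\<in>space M. \<exists>m\<le>n. \<bar>(\<Sum>i=1..m. (Z i \<omega>)\<^sup>2) - s2 m\<bar> > \<epsilon> * s2 n}) \<longlonglongrightarrow> 0"
proof (rule LIMSEQ_eventuallyI)
  fix \<kappa> :: real assume \<kappa>: "\<kappa> > 0"
  \<comment> \<open>With \<open>a = \<epsilon> / 4 * s\<close>, the first entry of the minimum
    ensures the variance condition of the maximal inequality; the second makes the probability of
    \<open>B1\<close> at most \<open>\<kappa> / 4\<close>.\<close>
  define \<delta> where "\<delta> = sqrt (min (\<epsilon>\<^sup>2 / 32) (\<kappa> * \<epsilon>\<^sup>2 / 128))"
  have \<delta>2: "\<delta>\<^sup>2 = min (\<epsilon>\<^sup>2 / 32) (\<kappa> * \<epsilon>\<^sup>2 / 128)" using \<epsilon> \<kappa> by (simp add: \<delta>_def)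
  have \<delta>: "\<delta> > 0" using \<epsilon> \<kappa> by (simp add: \<delta>_def)
  \<comment> \<open>The entry \<open>\<epsilon> / 4\<close> keeps the total mean of
    \<open>\<rho>\<close> below \<open>a\<close>; the entry \<open>\<epsilon> * \<kappa> / 8\<close>
    makes the probability of \<open>B2\<close> at most \<open>\<kappa> / 2\<close>.\<close>
  have "eventually (\<lambda>n. lind_frac \<delta> n < min (\<epsilon> / 4) (\<epsilon> * \<kappa> / 8)) sequentially"
    using \<epsilon> \<kappa> by (intro order_tendstoD(2)[OF lind_frac_tendsto[OF \<delta>]]) auto
  then show "eventually (\<lambda>n. norm (prob {\<omega>\<in>space M. \<exists>m\<le>n. \<bar>(\<Sum>i=1..m. (Z i \<omega>)\<^sup>2) - s2 m\<bar> > \<epsilon> * s2 n} - 0) < \<kappa>) sequentially"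
    using eventually_ge_at_top[of 1]
  proof eventually_elim
    case (elim n)
    define s where "s = s2 n"
    have s: "s > 0" unfolding s_def by (rule sum_var_pos[OF elim(2)])
    define A where "A i = {\<omega>. \<bar>Z i \<omega>\<bar> \<ge> \<delta> * sqrt s}" for i
    define \<rho> where "\<rho> i \<omega> = (Z i \<omega>)\<^sup>2 * indicator (A i) \<omega>" for i \<omega>
    define \<tau> where "\<tau> i \<omega> = (Z i \<omega>)\<^sup>2 - \<rho> i \<omega>" for i \<omega>
    have \<rho>_int: "integrable M (\<rho> i)" if "i \<ge> 1" for i
      using integrable_tail[OF that] by (simp add: \<rho>_def[abs_def] A_def)
    have \<tau>_int: "integrable M (\<tau> i)" if "i \<ge> 1" for i
      unfolding \<tau>_def[abs_def] using \<rho>_int[OF that] square_integrable[OF that] by auto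
    have \<rho>0: "\<rho> i \<omega> \<ge> 0" for i \<omega> by (simp add: \<rho>_def)
    have \<tau>0: "0 \<le> \<tau> i \<omega>" "\<tau> i \<omega> \<le> \<delta>\<^sup>2 * s" "\<tau> i \<omega> \<le> (Z i \<omega>)\<^sup>2" for i \<omega>
    proof -
      have "(Z i \<omega>)\<^sup>2 \<le> (\<delta> * sqrt s)\<^sup>2" if "\<not> \<bar>Z i \<omega>\<bar> \<ge> \<delta> * sqrt s"
        using that \<delta> s by (simp add: abs_le_square_iff[symmetric] abs_mult)
      moreover have "(\<delta> * sqrt s)\<^sup>2 = \<delta>\<^sup>2 * s" using s by (simp add: power_mult_distrib)
      ultimately show "0 \<le> \<tau> i \<omega>" "\<tau> i \<omega> \<le> \<delta>\<^sup>2 * s" "\<tau> i \<omega> \<le> (Z i \<omega>)\<^sup>2"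
        using s by (auto simp: \<tau>_def \<rho>_def A_def split: split_indicator)
    qed
    have Eq: "expectation (\<tau> i) + expectation (\<rho> i) = \<sigma>2 i" if "i \<ge> 1" for i
      using \<rho>_int[OF that] square_integrable[OF that] by (simp add: variance_eq[OF that] \<tau>_def[abs_def])
    have L: "(\<Sum>i=1..n. expectation (\<rho> i)) = lind_frac \<delta> n * s"
      using s by (simp add: lind_frac_def s_def \<rho>_def[abs_def] A_def)
    define X where "X i \<omega> = \<tau> i \<omega> - expectation (\<tau> i)" for i \<omega>
    have X_ind: "indep_vars (\<lambda>_. borel) X {0<..n}"
    proof -
      have "indep_vars (\<lambda>_. borel) (\<lambda>i \<omega>. (\<lambda>x. (x\<^sup>2 - x\<^sup>2 * indicator {x. \<bar>x\<bar> \<ge> \<delta> * sqrt s} x) - expectation (\<tau> i)) (Z i \<omega>)) {0<..n}"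
        by (rule indep_vars_compose2[OF indep_vars_subset[OF indep]]) auto
      then show ?thesis by (simp add: X_def[abs_def] \<tau>_def \<rho>_def A_def indicator_def)
    qed
    have \<tau>_sq: "integrable M (\<lambda>\<omega>. (\<tau> i \<omega>)\<^sup>2) \<and> expectation (\<lambda>\<omega>. (\<tau> i \<omega>)\<^sup>2) \<le> \<delta>\<^sup>2 * s * \<sigma>2 i" if "i \<ge> 1" for i
    proof -
      have le: "(\<tau> i \<omega>)\<^sup>2 \<le> \<delta>\<^sup>2 * s * (Z i \<omega>)\<^sup>2" for \<omega>
        unfolding power2_eq_square[of "\<tau> i \<omega>"] using \<tau>0 s by (intro mult_mono) auto
      have [measurable]: "\<tau> i \<in> borel_measurable M" using \<tau>_int[OF that] by auto
      have I: "integrable M (\<lambda>\<omega>. (\<tau> i \<omega>)\<^sup>2)"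
        by (rule Bochner_Integration.integrable_bound[where f="\<lambda>\<omega>. \<delta>\<^sup>2 * s * (Z i \<omega>)\<^sup>2"])
           (use square_integrable[OF that] le s in auto)
      have "expectation (\<lambda>\<omega>. (\<tau> i \<omega>)\<^sup>2) \<le> expectation (\<lambda>\<omega>. \<delta>\<^sup>2 * s * (Z i \<omega>)\<^sup>2)"
        using square_integrable[OF that] le by (intro integral_mono I) auto
      then show ?thesis using I by (simp add: variance_eq[OF that])
    qed
    have X_sq: "integrable M (\<lambda>\<omega>. (X i \<omega>)\<^sup>2) \<and> expectation (\<lambda>\<omega>. (X i \<omega>)\<^sup>2) \<le> \<delta>\<^sup>2 * s * \<sigma>2 i \<and> expectation (X i) = 0"
      if "i \<ge> 1" for i
    proof -
      have "(\<lambda>\<omega>. (X i \<omega>)\<^sup>2) = (\<lambda>\<omega>. (\<tau> i \<omega>)\<^sup>2 - 2 * expectation (\<tau> i) * \<tau> i \<omega> + (expectation (\<tau> i))\<^sup>2)"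
        by (simp add: X_def power2_diff fun_eq_iff mult_ac)
      moreover have "expectation (\<lambda>\<omega>. (\<tau> i \<omega>)\<^sup>2 - 2 * expectation (\<tau> i) * \<tau> i \<omega> + (expectation (\<tau> i))\<^sup>2) \<le> expectation (\<lambda>\<omega>. (\<tau> i \<omega>)\<^sup>2)"
        using \<tau>_sq[OF that] \<tau>_int[OF that] by (simp add: prob_space power2_eq_square)
      ultimately show ?thesis using \<tau>_sq[OF that] \<tau>_int[OF that] by (auto simp: X_def[abs_def] prob_space)
    qed
    define a where "a = \<epsilon> / 4 * s"
    have a: "a > 0" using \<epsilon> s by (simp add: a_def)
    have I: "{0<..m} = {1..m}" for m :: nat by auto
    have var_le: "(\<Sum>i\<in>{0<..n}. expectation (\<lambda>\<omega>. (X i \<omega>)\<^sup>2)) \<le> \<delta>\<^sup>2 * s\<^sup>2"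
    proof -
      have "(\<Sum>i\<in>{0<..n}. expectation (\<lambda>\<omega>. (X i \<omega>)\<^sup>2)) \<le> (\<Sum>i\<in>{0<..n}. \<delta>\<^sup>2 * s * \<sigma>2 i)"
        using X_sq by (intro sum_mono) auto
      also have "\<dots> = \<delta>\<^sup>2 * s * s" unfolding sum_distrib_left[symmetric] I by (simp add: s_def sum_var_def)
      finally show ?thesis by (simp add: power2_eq_square mult_ac)
    qed
    have "\<delta>\<^sup>2 * s\<^sup>2 \<le> \<epsilon>\<^sup>2 / 32 * s\<^sup>2" unfolding \<delta>2 by (intro mult_right_mono) auto
    also have "\<dots> = a\<^sup>2 / 2" by (simp add: a_def power_mult_distrib power_divide)
    finally have var_a: "\<delta>\<^sup>2 * s\<^sup>2 \<le> a\<^sup>2 / 2" .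
    define B1 where "B1 = {\<omega>\<in>space M. \<exists>m\<in>{0..n}. \<bar>\<Sum>i\<in>{0<..m}. X i \<omega>\<bar> > 2 * a}"
    define B2 where "B2 = {\<omega>\<in>space M. (\<Sum>i=1..n. \<rho> i \<omega>) \<ge> a}"
    have Xm[measurable]: "X i \<in> borel_measurable M" if "i \<in> {0<..n}" for i using indep_vars_rv[OF X_ind that] .
    have B1_ev: "B1 \<in> events" unfolding B1_def
    proof (rule sets.sets_Collect_finite_Ex)
      fix m assume "m \<in> {0..n}"
      then have "(\<lambda>\<omega>. \<Sum>i\<in>{0<..m}. X i \<omega>) \<in> borel_measurable M" by (intro borel_measurable_sum Xm) auto
      then show "{\<omega>\<in>space M. \<bar>\<Sum>i\<in>{0<..m}. X i \<omega>\<bar> > 2 * a} \<in> events" by measurable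
    qed simp
    have \<rho>sum: "integrable M (\<lambda>\<omega>. \<Sum>i=1..n. \<rho> i \<omega>)" using \<rho>_int by auto
    then have B2_ev: "B2 \<in> events" unfolding B2_def by measurable
    have p1: "prob B1 \<le> 2 * (\<delta>\<^sup>2 * s\<^sup>2 / a\<^sup>2)"
    proof -
      have "prob B1 \<le> 2 * prob {\<omega>\<in>space M. \<bar>\<Sum>i\<in>{0<..n}. X i \<omega>\<bar> > a}"
        unfolding B1_def by (rule ottaviani_second_moment[OF X_ind]) (use X_sq a var_le var_a in auto)
      also have "prob {\<omega>\<in>space M. \<bar>\<Sum>i\<in>{0<..n}. X i \<omega>\<bar> > a} \<le> expectation (\<lambda>\<omega>. (\<Sum>i\<in>{0<..n}. X i \<omega>)\<^sup>2) / a\<^sup>2"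
        using indep_sum_second_moment[OF _ X_ind] X_sq
        by (intro second_moment_tail a borel_measurable_sum Xm) auto
      also have "\<dots> \<le> \<delta>\<^sup>2 * s\<^sup>2 / a\<^sup>2"
        using indep_sum_second_moment[OF _ X_ind] X_sq var_le by (intro divide_right_mono) auto
      finally show ?thesis by simp
    qed
    have p2: "prob B2 \<le> lind_frac \<delta> n * s / a"
    proof -
      have "prob B2 \<le> expectation (\<lambda>\<omega>. \<Sum>i=1..n. \<rho> i \<omega>) / a"
        unfolding B2_def using \<rho>sum a \<rho>0
        by (intro integral_Markov_inequality_measure[where A="{}"]) (auto intro!: sum_nonneg)
      also have "expectation (\<lambda>\<omega>. \<Sum>i=1..n. \<rho> i \<omega>) = lind_frac \<delta> n * s"
        unfolding L[symmetric] using \<rho>_int by (intro Bochner_Integration.integral_sum) auto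
      finally show ?thesis .
    qed
    have La: "lind_frac \<delta> n * s \<le> a"
      unfolding a_def using elim(1) s by (intro mult_right_mono) auto
    \<comment> \<open>Outside both events the centred part is at most \<open>2 * a\<close>, and the
      sums of \<open>\<rho>\<close> and of their means both lie between 0 and \<open>a\<close>. The
      total stays below \<open>4 * a\<close>, which is \<open>\<epsilon> * s2 n\<close>.\<close>
    have "{\<omega>\<in>space M. \<exists>m\<le>n. \<bar>(\<Sum>i=1..m. (Z i \<omega>)\<^sup>2) - s2 m\<bar> > \<epsilon> * s2 n} \<subseteq> B1 \<union> B2"
    proof (intro subsetI; rule ccontr)
      fix \<omega> assume w: "\<omega> \<in> {\<omega>\<in>space M. \<exists>m\<le>n. \<bar>(\<Sum>i=1..m. (Z i \<omega>)\<^sup>2) - s2 m\<bar> > \<epsilon> * s2 n}" "\<omega> \<notin> B1 \<union> B2"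
      then obtain m where m: "\<omega> \<in> space M" "m \<le> n" "\<bar>(\<Sum>i=1..m. (Z i \<omega>)\<^sup>2) - s2 m\<bar> > 4 * a"
        by (auto simp: a_def s_def)
      have "(\<Sum>i=1..m. (Z i \<omega>)\<^sup>2) = (\<Sum>i=1..m. \<tau> i \<omega> + \<rho> i \<omega>)" by (simp add: \<tau>_def)
      moreover have "s2 m = (\<Sum>i=1..m. expectation (\<tau> i) + expectation (\<rho> i))"
        unfolding sum_var_def by (intro sum.cong refl Eq[symmetric]) auto
      ultimately have "(\<Sum>i=1..m. (Z i \<omega>)\<^sup>2) - s2 m =
          (\<Sum>i=1..m. X i \<omega>) + (\<Sum>i=1..m. \<rho> i \<omega>) - (\<Sum>i=1..m. expectation (\<rho> i))"
        by (simp add: X_def sum.distrib sum_subtractf)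
      moreover have "\<bar>\<Sum>i=1..m. X i \<omega>\<bar> \<le> 2 * a"
        using w(2) m unfolding B1_def I by (auto simp: not_less)
      moreover have "(\<Sum>i=1..m. \<rho> i \<omega>) \<le> (\<Sum>i=1..n. \<rho> i \<omega>)" using m \<rho>0 by (intro sum_mono2) auto
      moreover have "(\<Sum>i=1..n. \<rho> i \<omega>) < a" using w(2) m unfolding B2_def by auto
      moreover have "0 \<le> (\<Sum>i=1..m. \<rho> i \<omega>)" by (intro sum_nonneg \<rho>0)
      moreover have "(\<Sum>i=1..m. expectation (\<rho> i)) \<le> (\<Sum>i=1..n. expectation (\<rho> i))"
        using m \<rho>0 by (intro sum_mono2) (auto intro!: integral_nonneg_AE)
      moreover have "0 \<le> (\<Sum>i=1..m. expectation (\<rho> i))" using \<rho>0 by (intro sum_nonneg integral_nonneg_AE) auto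
      ultimately show False using m(3) La L by linarith
    qed
    then have "prob {\<omega>\<in>space M. \<exists>m\<le>n. \<bar>(\<Sum>i=1..m. (Z i \<omega>)\<^sup>2) - s2 m\<bar> > \<epsilon> * s2 n} \<le> prob (B1 \<union> B2)"
      using B1_ev B2_ev by (intro finite_measure_mono) auto
    also have "\<dots> \<le> prob B1 + prob B2" using B1_ev B2_ev by (intro measure_Un_le)
    also have "\<dots> \<le> 2 * (\<delta>\<^sup>2 * s\<^sup>2 / a\<^sup>2) + lind_frac \<delta> n * s / a" using p1 p2 by simp
    also have "2 * (\<delta>\<^sup>2 * s\<^sup>2 / a\<^sup>2) = 32 * \<delta>\<^sup>2 / \<epsilon>\<^sup>2"
      using s \<epsilon> by (simp add: a_def power_mult_distrib power_divide)
    also have "\<dots> \<le> 32 * (\<kappa> * \<epsilon>\<^sup>2 / 128) / \<epsilon>\<^sup>2" unfolding \<delta>2 by (intro divide_right_mono mult_left_mono) auto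
    also have "\<dots> = \<kappa> / 4" using \<epsilon> by simp
    also have "lind_frac \<delta> n * s / a = lind_frac \<delta> n * (4 / \<epsilon>)" using s \<epsilon> by (simp add: a_def)
    also have "\<dots> \<le> \<epsilon> * \<kappa> / 8 * (4 / \<epsilon>)" using elim(1) \<epsilon> by (intro mult_right_mono) auto
    also have "\<dots> = \<kappa> / 2" using \<epsilon> by simp
    finally show ?case using \<kappa> by (simp add: measure_nonneg)
  qed
qed

text \<open>Both clocks stop near variance level \<open>t * s2 n\<close>. The variance clock lags by
  at most one jump, which is at most \<open>\<delta> * s2 n\<close>. For the data clock the error of
  \<open>Q\<close> enters at the stopping index or its successor and once more at \<open>n\<close>;
  with one jump added below, it stops at most \<open>3 * \<delta> * s2 n\<close> too early and
  \<open>2 * \<delta> * s2 n\<close> too late.\<close>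

lemma time_change_close:
  assumes t: "t \<in> {0..1}" and n: "n \<ge> 1" and \<delta>: "0 < \<delta>"
    and v: "\<And>i. i \<in> {1..n} \<Longrightarrow> \<sigma>2 i \<le> \<delta> * s2 n"
    and Q: "\<And>m. m \<le> n \<Longrightarrow> \<bar>centred_squares n z m - s2 m\<bar> \<le> \<delta> * s2 n"
  shows "time_data n z t \<le> n" "time_var M Z n t \<le> n"
    "\<bar>s2 (time_data n z t) - s2 (time_var M Z n t)\<bar> \<le> 3 * \<delta> * s2 n"
proof -
  define p where "p = time_data n z t"
  define q where "q = time_var M Z n t"
  define s where "s = s2 n"
  define R where "R = centred_squares n z"
  have s: "s > 0" using sum_var_pos[OF n] by (simp add: s_def)
  have t': "0 \<le> t" "t \<le> 1" using t by auto
  have R: "R 0 = 0" "R n \<ge> 0" by (auto simp: R_def centred_squares_def intro!: sum_nonneg)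
  have p_eq: "p = Max {m\<in>{0..n}. R m \<le> t * R n}" by (simp add: p_def time_data_def R_def centred_squares_def)
  have q_eq: "q = Max {m\<in>{0..n}. s2 m \<le> t * s2 n}" by (simp add: q_def time_var_def)
  note p = Max_index[of R n t, OF R t'(1), folded p_eq]
  note q = Max_index[of s2 n t, OF sum_var_0 sum_var_nonneg t'(1), folded q_eq s_def]
  show "time_data n z t \<le> n" "time_var M Z n t \<le> n" using p q by (auto simp: p_def q_def)
  have ts: "t * s \<le> s" using t' s by (simp add: mult_left_le_one_le)
  have td: "t * (\<delta> * s) \<le> \<delta> * s" using t' s \<delta> by (simp add: mult_left_le_one_le)
  have Rn: "\<bar>t * R n - t * s\<bar> \<le> \<delta> * s"
  proof -
    have "\<bar>t * R n - t * s\<bar> = t * \<bar>R n - s\<bar>" using t' by (simp add: right_diff_distrib[symmetric] abs_mult)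
    also have "\<dots> \<le> t * (\<delta> * s)" using Q[of n] t' by (intro mult_left_mono) (auto simp: R_def s_def)
    finally show ?thesis using td by simp
  qed
  have Qm: "\<bar>R m - s2 m\<bar> \<le> \<delta> * s" if "m \<le> n" for m using Q[OF that] by (simp add: R_def s_def)
  have step: "s2 (Suc m) \<le> s2 m + \<delta> * s" if "m < n" for m
    using v[of "Suc m"] that by (simp add: sum_var_Suc s_def)
  have p1: "s2 p \<le> t * s + 2 * (\<delta> * s)" using p(2) Qm[OF p(1)] Rn by linarith
  have p2: "s2 p \<ge> t * s - 3 * (\<delta> * s)"
  proof (cases "p = n")
    case True
    have "\<delta> * s > 0" using \<delta> s by simp
    then show ?thesis using True ts by (simp add: s_def[symmetric])
  next
    case False
    then have "p < n" using p(1) by simp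
    then show ?thesis using p(3) step[of p] Qm[of "Suc p"] Rn by linarith
  qed
  have q2: "s2 q \<ge> t * s - \<delta> * s"
  proof (cases "q = n")
    case True
    have "\<delta> * s > 0" using \<delta> s by simp
    then show ?thesis using True ts by (simp add: s_def[symmetric])
  next
    case False
    then have "q < n" using q(1) by simp
    then show ?thesis using q(3) step[of q] by linarith
  qed
  have "\<delta> * s > 0" using \<delta> s by simp
  then have "\<bar>s2 p - s2 q\<bar> \<le> 3 * (\<delta> * s)" using p1 p2 q(2) q2 by linarith
  then show "\<bar>s2 (time_data n z t) - s2 (time_var M Z n t)\<bar> \<le> 3 * \<delta> * s2 n"
    by (simp add: p_def q_def s_def mult.assoc)
qed

end

section \<open>Closeness of the Student process\<close>

context lindeberg_coupling
begin

text \<open>The variance clock is cut at \<open>L\<close> levels. Indices whose variances differ by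
  at most \<open>s2 n / L\<close> lie in the same or in adjacent cells, so three increments from
  left ends of cells, each within \<open>2 * a\<close>, suffice. By the fourth moment each cell
  fails with probability of order \<open>1 / L^2\<close>, and the sum over \<open>L + 2\<close>
  cells is of order \<open>1 / L\<close>.\<close>

lemma G_modulus:
  assumes \<epsilon>: "\<epsilon> > 0" and \<kappa>: "\<kappa> > 0"
  obtains \<theta> where "\<theta> > 0"
    "eventually (\<lambda>n. prob {\<omega>\<in>space M. \<exists>q\<le>n. \<exists>p\<le>q. s2 q - s2 p \<le> \<theta> * s2 n \<and>
       \<bar>G q \<omega> - G p \<omega>\<bar> > \<epsilon> * sqrt (s2 n)} < \<kappa>) sequentially"
proof -
  define C where "C = 72 * 1296 / (\<kappa> * \<epsilon>^4)"
  \<comment> \<open>The bound \<open>144 / \<epsilon>\<^sup>2\<close> yields the variance condition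
    for each cell, \<open>C\<close> brings the total probability below \<open>\<kappa>\<close>, and
    \<open>L > 1\<close> allows \<open>L + 2 \<le> 3 * L\<close>.\<close>
  obtain L :: nat where "real L > max 1 (max (144 / \<epsilon>\<^sup>2) C)" using reals_Archimedean2 by blast
  then have L: "real L > 1" "real L > 144 / \<epsilon>\<^sup>2" "real L > C" by auto
  have Lp: "real L > 0" using L by simp
  then have Lp': "1 / real L > 0" by simp
  have "eventually (\<lambda>n. prob {\<omega>\<in>space M. \<exists>q\<le>n. \<exists>p\<le>q. s2 q - s2 p \<le> 1 / real L * s2 n \<and>
       \<bar>G q \<omega> - G p \<omega>\<bar> > \<epsilon> * sqrt (s2 n)} < \<kappa>) sequentially"
    using feller[OF Lp'] eventually_ge_at_top[of 1]
  proof eventually_elim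
    case (elim n)
    define s where "s = s2 n"
    have s: "s > 0" unfolding s_def by (rule sum_var_pos[OF elim(2)])
    define m where "m l = time_var M Z n (real l / real L)" for l
    have tl: "real l / real L \<ge> 0" for l using Lp by simp
    have m_eq: "m l = Max {j\<in>{0..n}. s2 j \<le> (real l / real L) * s2 n}" for l by (simp add: m_def time_var_def)
    note mm = Max_index[of s2 n, OF sum_var_0 sum_var_nonneg tl, folded m_eq s_def]
    have m_ge: "j \<le> m l" if "j \<le> n" "s2 j \<le> (real l / real L) * s" for j l
      unfolding m_eq using that by (intro Max_ge) (auto simp: s_def)
    have m_mono: "m l \<le> m (Suc l)" for l
    proof (rule m_ge[OF mm(1)])
      have "(real l / real L) * s \<le> (real (Suc l) / real L) * s" using s Lp by (intro mult_right_mono divide_right_mono) auto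
      then show "s2 (m l) \<le> (real (Suc l) / real L) * s" using mm(2)[of l] by linarith
    qed
    define a where "a = \<epsilon> * sqrt s / 6"
    have a: "a > 0" "a\<^sup>2 = \<epsilon>\<^sup>2 * s / 36" using \<epsilon> s by (auto simp: a_def power_mult_distrib power_divide)
    have a4: "a^4 = \<epsilon>^4 * s\<^sup>2 / 1296"
    proof -
      have "a^4 = a\<^sup>2 * a\<^sup>2" by (simp add: power_add[symmetric])
      also have "\<dots> = \<epsilon>^4 * s\<^sup>2 / 1296" unfolding a(2) by (simp add: power2_eq_square eval_nat_numeral)
      finally show ?thesis .
    qed
    \<comment> \<open>The nominal cell has variance \<open>s / L\<close>; the clock may lag by one
      jump at its left end, which \<open>feller\<close> bounds by the same amount.\<close>
    have v: "s2 (m (Suc l)) - s2 (m l) \<le> 2 / real L * s" for l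
    proof (cases "m l = n")
      case True
      then have "m (Suc l) = n" using m_mono[of l] mm(1)[of "Suc l"] by simp
      then show ?thesis using True s Lp by simp
    next
      case False
      then have lt: "m l < n" using mm(1)[of l] by simp
      have "\<sigma>2 (Suc (m l)) \<le> 1 / real L * s" using elim(1) lt by (simp add: s_def)
      then have "s2 (m l) \<ge> (real l / real L) * s - 1 / real L * s"
        using mm(3)[OF lt] by (simp add: sum_var_Suc)
      then have "s2 (m (Suc l)) - s2 (m l) \<le> (real (Suc l) / real L) * s - ((real l / real L) * s - 1 / real L * s)"
        using mm(2)[of "Suc l"] by linarith
      also have "\<dots> = 2 / real L * s" by (simp add: add_divide_distrib algebra_simps)
      finally show ?thesis .
    qed
    have v0: "0 \<le> s2 (m (Suc l)) - s2 (m l)" for l using sum_var_mono[OF m_mono[of l]] by simp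
    have va: "2 / real L * s \<le> a\<^sup>2 / 2"
    proof -
      have "144 / real L \<le> \<epsilon>\<^sup>2" using L(2) Lp \<epsilon> by (simp add: field_simps)
      then have "144 / real L * s \<le> \<epsilon>\<^sup>2 * s" using s by (intro mult_right_mono) auto
      then show ?thesis by (simp add: a(2))
    qed
    define B where "B l = {\<omega>\<in>space M. \<exists>j\<in>{m l..m (Suc l)}. \<bar>G j \<omega> - G (m l) \<omega>\<bar> > 2 * a}" for l
    have B_ev[measurable]: "B l \<in> events" for l unfolding B_def by measurable
    have pB: "prob (B l) \<le> 6 * (2 / real L * s)\<^sup>2 / a^4" for l
    proof -
      have "s2 (m (Suc l)) - s2 (m l) \<le> a\<^sup>2 / 2" using v[of l] va by linarith
      then have "prob (B l) \<le> 6 * (s2 (m (Suc l)) - s2 (m l))\<^sup>2 / a^4"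
        unfolding B_def by (rule G_max_tail[OF m_mono a(1)])
      also have "\<dots> \<le> 6 * (2 / real L * s)\<^sup>2 / a^4"
        using v[of l] v0[of l] by (intro divide_right_mono mult_left_mono power_mono) auto
      finally show ?thesis .
    qed
    have sub: "{\<omega>\<in>space M. \<exists>q\<le>n. \<exists>p\<le>q. s2 q - s2 p \<le> 1 / real L * s2 n \<and>
       \<bar>G q \<omega> - G p \<omega>\<bar> > \<epsilon> * sqrt (s2 n)} \<subseteq> (\<Union>l\<le>L + 1. B l)"
    proof
      fix \<omega> assume "\<omega> \<in> {\<omega>\<in>space M. \<exists>q\<le>n. \<exists>p\<le>q. s2 q - s2 p \<le> 1 / real L * s2 n \<and>
       \<bar>G q \<omega> - G p \<omega>\<bar> > \<epsilon> * sqrt (s2 n)}"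
      then obtain p q where pq: "\<omega> \<in> space M" "p \<le> q" "q \<le> n" "s2 q - s2 p \<le> 1 / real L * s"
        "\<bar>G q \<omega> - G p \<omega>\<bar> > 6 * a" by (auto simp: a_def s_def)
      define x where "x = s2 p * real L / s"
      have x0: "x \<ge> 0" using s sum_var_nonneg[of p] by (simp add: x_def)
      have xs: "s2 p = x / real L * s" using s Lp by (simp add: x_def)
      define l where "l = nat \<lfloor>x\<rfloor>"
      have l: "real l \<le> x" "x < real l + 1" using x0 by (auto simp: l_def)
      have "s2 p \<le> s" using pq sum_var_mono[of p n] by (simp add: s_def)
      then have "x \<le> real L" using s Lp by (simp add: x_def divide_le_eq mult_right_mono mult.commute)
      then have lL: "l \<le> L" using l by linarith
      have p1: "m l \<le> p"
      proof -
        have "s2 (m l) \<le> real l / real L * s" by (rule mm(2))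
        also have "\<dots> \<le> s2 p" unfolding xs using l s Lp by (intro mult_right_mono divide_right_mono) auto
        finally show ?thesis using sum_var_strict_mono by (simp add: strict_mono_less_eq)
      qed
      have p2: "p \<le> m (Suc l)"
      proof (rule m_ge)
        show "s2 p \<le> real (Suc l) / real L * s"
          unfolding xs using l s Lp by (intro mult_right_mono divide_right_mono) auto
      qed (use pq in simp)
      have q1: "q \<le> m (Suc (Suc l))"
      proof (rule m_ge[OF pq(3)])
        have "s2 q \<le> (x + 1) / real L * s" using pq(4) xs by (simp add: add_divide_distrib distrib_right)
        also have "\<dots> \<le> real (Suc (Suc l)) / real L * s"
          using l s Lp by (intro mult_right_mono divide_right_mono) auto
        finally show "s2 q \<le> real (Suc (Suc l)) / real L * s" .
      qed
      show "\<omega> \<in> (\<Union>l\<le>L + 1. B l)"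
      proof (rule ccontr)
        assume n: "\<omega> \<notin> (\<Union>l\<le>L + 1. B l)"
        have nB: "\<bar>G j \<omega> - G (m k) \<omega>\<bar> \<le> 2 * a" if "k \<in> {l, Suc l}" "m k \<le> j" "j \<le> m (Suc k)" for j k
        proof -
          have "\<omega> \<notin> B k" using n that(1) lL by auto
          then show ?thesis using pq(1) that(2,3) unfolding B_def by force
        qed
        have 1: "\<bar>G p \<omega> - G (m l) \<omega>\<bar> \<le> 2 * a" using p1 p2 by (intro nB) auto
        show False
        proof (cases "q \<le> m (Suc l)")
          case True
          have "\<bar>G q \<omega> - G (m l) \<omega>\<bar> \<le> 2 * a" using True p1 pq(2) by (intro nB) auto
          then show False using 1 pq(5) a(1) by linarith
        next
          case False
          have "\<bar>G q \<omega> - G (m (Suc l)) \<omega>\<bar> \<le> 2 * a" using False q1 by (intro nB) auto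
          moreover have "\<bar>G (m (Suc l)) \<omega> - G (m l) \<omega>\<bar> \<le> 2 * a" using m_mono[of l] by (intro nB) auto
          ultimately show False using 1 pq(5) by linarith
        qed
      qed
    qed
    have "prob {\<omega>\<in>space M. \<exists>q\<le>n. \<exists>p\<le>q. s2 q - s2 p \<le> 1 / real L * s2 n \<and>
       \<bar>G q \<omega> - G p \<omega>\<bar> > \<epsilon> * sqrt (s2 n)} \<le> prob (\<Union>l\<le>L + 1. B l)"
      using sub by (intro finite_measure_mono) auto
    also have "\<dots> \<le> (\<Sum>l\<le>L + 1. prob (B l))" by (intro measure_UNION_le) auto
    also have "\<dots> \<le> (\<Sum>l\<le>L + 1. 6 * (2 / real L * s)\<^sup>2 / a^4)" by (intro sum_mono pB)
    also have "\<dots> = (real L + 2) * (24 * 1296 / ((real L)\<^sup>2 * \<epsilon>^4))"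
      using s \<epsilon> Lp by (simp add: a4 power_mult_distrib power_divide field_simps)
    also have "\<dots> \<le> (3 * real L) * (24 * 1296 / ((real L)\<^sup>2 * \<epsilon>^4))"
      using L(1) by (intro mult_right_mono) auto
    also have "\<dots> = 72 * 1296 / (real L * \<epsilon>^4)" using Lp \<epsilon> by (simp add: power2_eq_square field_simps)
    also have "\<dots> < \<kappa>"
    proof -
      have "72 * 1296 < real L * (\<kappa> * \<epsilon>^4)" using L(3) \<kappa> \<epsilon> unfolding C_def by (simp add: divide_less_eq)
      then show ?thesis using Lp \<epsilon> by (simp add: divide_less_eq mult_ac)
    qed
    finally show ?case .
  qed
  then show ?thesis using that[of "1 / real L"] Lp by simp
qed

text \<open>Raikov's theorem at level \<open>\<delta> / 4\<close> handles the plain squares.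
  Centring is harmless because the full sum, of order \<open>sqrt (s2 n)\<close>, exceeds
  \<open>\<delta> / 8 * sqrt (n * s2 n)\<close> only with probability of order
  \<open>1 / n\<close>.\<close>

lemma centred_squares_tendsto:
  assumes \<delta>: "0 < \<delta>" "\<delta> \<le> 1"
  shows "(\<lambda>n. prob {\<omega>\<in>space M. \<exists>m\<le>n. \<bar>centred_squares n (\<lambda>i. Z i \<omega>) m - s2 m\<bar> > \<delta> * s2 n}) \<longlonglongrightarrow> 0"
proof -
  define A where "A n = {\<omega>\<in>space M. \<exists>m\<le>n. \<bar>(\<Sum>i=1..m. (Z i \<omega>)\<^sup>2) - s2 m\<bar> > \<delta> / 4 * s2 n}" for n
  have "(\<lambda>n. prob (A n)) \<longlonglongrightarrow> 0" unfolding A_def using \<delta> by (intro raikov) auto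
  moreover have "(\<lambda>n. 64 / \<delta>\<^sup>2 * (1 / real n)) \<longlonglongrightarrow> 64 / \<delta>\<^sup>2 * 0" by (intro tendsto_intros lim_1_over_n)
  ultimately have lim: "(\<lambda>n. prob (A n) + 64 / \<delta>\<^sup>2 * (1 / real n)) \<longlonglongrightarrow> 0 + 64 / \<delta>\<^sup>2 * 0" by (rule tendsto_add)
  have lim': "(\<lambda>n. prob (A n) + 64 / \<delta>\<^sup>2 * (1 / real n)) \<longlonglongrightarrow> 0" using lim by simp
  show ?thesis
  proof (rule tendsto_sandwich[OF _ _ tendsto_const lim'])
    obtain n0 :: nat where n0: "real n0 > 128 / \<delta>\<^sup>2" using reals_Archimedean2 by blast
    show "eventually (\<lambda>n. prob {\<omega>\<in>space M. \<exists>m\<le>n. \<bar>centred_squares n (\<lambda>i. Z i \<omega>) m - s2 m\<bar> > \<delta> * s2 n}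
       \<le> prob (A n) + 64 / \<delta>\<^sup>2 * (1 / real n)) sequentially"
      using eventually_ge_at_top[of "max 1 n0"]
    proof eventually_elim
      case (elim n)
      then have n: "n \<ge> 1" "real n \<ge> real n0" by auto
      have s: "s2 n > 0" by (rule sum_var_pos[OF n(1)])
      define a where "a = \<delta> / 8 * sqrt (real n * s2 n)"
      have a: "a > 0" "a\<^sup>2 = \<delta>\<^sup>2 / 64 * (real n * s2 n)" using \<delta> s n by (auto simp: a_def power_mult_distrib power_divide)
      define B where "B = {\<omega>\<in>space M. \<bar>\<Sum>i=1..n. Z i \<omega>\<bar> > a}"
      have meas: "(\<lambda>\<omega>. \<Sum>i=1..m. Z i \<omega>) \<in> borel_measurable M" "(\<lambda>\<omega>. \<Sum>i=1..m. (Z i \<omega>)\<^sup>2) \<in> borel_measurable M" for m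
        using rv by (auto intro!: borel_measurable_sum)
      have B_ev: "B \<in> events" unfolding B_def using meas by measurable
      have A_ev: "A n \<in> events" unfolding A_def using meas by measurable
      have "128 < real n0 * \<delta>\<^sup>2" using n0 \<delta> by (simp add: divide_less_eq)
      also have "\<dots> \<le> real n * \<delta>\<^sup>2" using n(2) by (intro mult_right_mono) auto
      finally have "128 \<le> \<delta>\<^sup>2 * real n" by (simp add: mult.commute)
      then have "1 * s2 n \<le> (\<delta>\<^sup>2 * real n / 128) * s2 n" using s by (intro mult_right_mono) auto
      then have "s2 n \<le> a\<^sup>2 / 2" by (simp add: a(2))
      then have "prob B \<le> s2 n / a\<^sup>2" unfolding B_def by (rule S_max_tail(2)[OF a(1)])
      also have "\<dots> = 64 / \<delta>\<^sup>2 * (1 / real n)" using s n by (simp add: a(2))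
      finally have pB: "prob B \<le> 64 / \<delta>\<^sup>2 * (1 / real n)" .
      have "{\<omega>\<in>space M. \<exists>m\<le>n. \<bar>centred_squares n (\<lambda>i. Z i \<omega>) m - s2 m\<bar> > \<delta> * s2 n} \<subseteq> A n \<union> B"
      proof (intro subsetI; rule ccontr)
        fix \<omega> assume w: "\<omega> \<in> {\<omega>\<in>space M. \<exists>m\<le>n. \<bar>centred_squares n (\<lambda>i. Z i \<omega>) m - s2 m\<bar> > \<delta> * s2 n}" "\<omega> \<notin> A n \<union> B"
        then obtain m where m: "\<omega> \<in> space M" "m \<le> n" "\<bar>centred_squares n (\<lambda>i. Z i \<omega>) m - s2 m\<bar> > \<delta> * s2 n" by auto
        have "\<bar>centred_squares n (\<lambda>i. Z i \<omega>) m - s2 m\<bar> \<le> \<delta> * s2 n"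
        proof (rule centred_squares_close[where s="sum_var M Z", OF n(1) s _ \<delta> _ _ m(2)])
          show "\<bar>(\<Sum>i=1..j. (Z i \<omega>)\<^sup>2) - s2 j\<bar> \<le> \<delta> / 4 * s2 n" if "j \<le> n" for j
            using w(2) m(1) that unfolding A_def by force
          show "\<bar>\<Sum>i=1..n. Z i \<omega>\<bar> \<le> \<delta> / 8 * sqrt (real n * s2 n)"
            using w(2) m(1) unfolding B_def a_def by force
        qed (rule sum_var_mono)
        then show False using m(3) by simp
      qed
      then have "prob {\<omega>\<in>space M. \<exists>m\<le>n. \<bar>centred_squares n (\<lambda>i. Z i \<omega>) m - s2 m\<bar> > \<delta> * s2 n} \<le> prob (A n \<union> B)"
        using A_ev B_ev by (intro finite_measure_mono) auto
      also have "\<dots> \<le> prob (A n) + prob B" by (intro measure_Un_le A_ev B_ev)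
      finally show ?case using pB by simp
    qed
  qed (auto simp: measure_nonneg)
qed

abbreviation (input)
  "deviation n t \<omega> \<equiv> \<bar>student n (\<lambda>i. Z i \<omega>) t - G (time_var M Z n t) \<omega> / sqrt (s2 n)\<bar>"

text \<open>Three errors of at most \<open>\<epsilon> / 3\<close> each: the random normalisation,
  the coupling at the data-based index, and the increment of \<open>G\<close> between the two
  indices. They hold off four events of probability below \<open>\<kappa> / 4\<close>. Only the
  covering events have to be measurable for this bound; the deviation event itself is treated in
  \<open>student_distance_event\<close>.\<close>

lemma student_close:
  assumes \<epsilon>: "\<epsilon> > 0"
  shows "(\<lambda>n. prob {\<omega>\<in>space M. \<exists>t\<in>{0..1}.
    deviation n t \<omega> > \<epsilon>}) \<longlonglongrightarrow> 0"
proof (rule LIMSEQ_eventuallyI)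
  fix \<kappa> :: real assume \<kappa>: "\<kappa> > 0"
  \<comment> \<open>Normalised partial sums stay within \<open>2 * c\<close> except with probability
    \<open>2 / c\<^sup>2\<close>; \<open>c \<ge> 2\<close> meets the variance condition of
    \<open>S_max_tail\<close>.\<close>
  define c where "c = max 2 (sqrt (8 / \<kappa>) + 1)"
  have c: "c \<ge> 2" "c > sqrt (8 / \<kappa>)" by (auto simp: c_def)
  have "8 / \<kappa> < c\<^sup>2" using power_strict_mono[OF c(2), of 2] \<kappa> by simp
  then have c2: "2 / c\<^sup>2 < \<kappa> / 4" using \<kappa> c(1) by (simp add: field_simps)
  obtain \<theta> where \<theta>: "\<theta> > 0" and mod: "eventually (\<lambda>n. prob {\<omega>\<in>space M. \<exists>q\<le>n. \<exists>p\<le>q. s2 q - s2 p \<le> \<theta> * s2 n \<and>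
       \<bar>G q \<omega> - G p \<omega>\<bar> > \<epsilon> / 3 * sqrt (s2 n)} < \<kappa> / 4) sequentially"
    using G_modulus[of "\<epsilon> / 3" "\<kappa> / 4"] \<epsilon> \<kappa> by auto
  \<comment> \<open>The entry \<open>\<theta> / 3\<close> answers the factor 3 of the time change.
    Once \<open>1 / n\<close> is also below \<open>\<epsilon> / (24 * c)\<close>, the normalisation
    error \<open>2 * c * \<bar>d - 1\<bar>\<close> is at most \<open>\<epsilon> / 3\<close>.\<close>
  define \<delta> where "\<delta> = min (1/2) (min (\<theta> / 3) (\<epsilon> / (24 * c)))"
  have \<delta>: "0 < \<delta>" "\<delta> \<le> 1/2" "\<delta> \<le> \<theta> / 3" "\<delta> \<le> \<epsilon> / (24 * c)" using \<theta> \<epsilon> c by (auto simp: \<delta>_def)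
  obtain n0 :: nat where n0: "real n0 > 24 * c / \<epsilon>" using reals_Archimedean2 by blast
  have "eventually (\<lambda>n. prob {\<omega>\<in>space M. \<exists>m\<le>n. \<bar>centred_squares n (\<lambda>i. Z i \<omega>) m - s2 m\<bar> > \<delta> * s2 n} < \<kappa> / 4) sequentially"
    using order_tendstoD(2)[OF centred_squares_tendsto[of \<delta>], of "\<kappa> / 4"] \<delta> \<kappa> by auto
  moreover have "eventually (\<lambda>n. prob {\<omega>\<in>space M. \<exists>m\<le>n. \<bar>S m \<omega> - G m \<omega>\<bar> > \<epsilon> / 3 * sqrt (s2 n)} < \<kappa> / 4) sequentially"
    using order_tendstoD(2)[OF coupling_close[of "\<epsilon> / 3"], of "\<kappa> / 4"] \<epsilon> \<kappa> by auto
  ultimately show "eventually (\<lambda>n. norm (prob {\<omega>\<in>space M. \<exists>t\<in>{0..1}.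
    deviation n t \<omega> > \<epsilon>} - 0) < \<kappa>) sequentially"
    using mod feller[OF \<delta>(1)] eventually_ge_at_top[of "max 1 n0"]
  proof eventually_elim
    case (elim n)
    have n: "n \<ge> 1" "real n \<ge> real n0" using elim(5) by auto
    define s where "s = s2 n"
    have s: "s > 0" unfolding s_def by (rule sum_var_pos[OF n(1)])
    define B1 where "B1 = {\<omega>\<in>space M. \<exists>m\<le>n. \<bar>centred_squares n (\<lambda>i. Z i \<omega>) m - s2 m\<bar> > \<delta> * s2 n}"
    define B2 where "B2 = {\<omega>\<in>space M. \<exists>m\<le>n. \<bar>S m \<omega> - G m \<omega>\<bar> > \<epsilon> / 3 * sqrt (s2 n)}"
    define B3 where "B3 = {\<omega>\<in>space M. \<exists>q\<le>n. \<exists>p\<le>q. s2 q - s2 p \<le> \<theta> * s2 n \<and> \<bar>G q \<omega> - G p \<omega>\<bar> > \<epsilon> / 3 * sqrt (s2 n)}"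
    define B4 where "B4 = {\<omega>\<in>space M. \<exists>m\<le>n. \<bar>S m \<omega>\<bar> > 2 * (c * sqrt s)}"
    have cm: "(\<lambda>\<omega>. centred_squares n (\<lambda>i. Z i \<omega>) m) \<in> borel_measurable M" if "m \<le> n" for m
      unfolding centred_squares_def sample_mean_def using rv that by (auto intro!: borel_measurable_sum)
    have "B1 = {\<omega>\<in>space M. \<exists>m\<in>{..n}. \<bar>centred_squares n (\<lambda>i. Z i \<omega>) m - s2 m\<bar> > \<delta> * s2 n}"
      unfolding B1_def by auto
    also have "\<dots> \<in> events"
    proof (rule sets.sets_Collect_finite_Ex)
      fix m assume "m \<in> {..n}"
      then have [measurable]: "(\<lambda>\<omega>. centred_squares n (\<lambda>i. Z i \<omega>) m) \<in> borel_measurable M" using cm by simp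
      show "{\<omega>\<in>space M. \<bar>centred_squares n (\<lambda>i. Z i \<omega>) m - s2 m\<bar> > \<delta> * s2 n} \<in> events" by measurable
    qed simp
    finally have ev1: "B1 \<in> events" .
    have ev: "B2 \<in> events" "B3 \<in> events" "B4 \<in> events"
      unfolding B2_def B3_def B4_def by measurable
    have p4: "prob B4 < \<kappa> / 4"
    proof -
      have cs: "c * sqrt s > 0" "(c * sqrt s)\<^sup>2 = c\<^sup>2 * s" using c s by (auto simp: power_mult_distrib)
      have "2 * 2 \<le> c * c" using c by (intro mult_mono) auto
      then have "1 * s \<le> (c\<^sup>2 / 2) * s" using s by (intro mult_right_mono) (auto simp: power2_eq_square)
      then have "s2 n \<le> (c * sqrt s)\<^sup>2 / 2" by (simp add: cs s_def[symmetric])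
      from S_max_tail(1)[OF cs(1) this] have "prob B4 \<le> 2 * s2 n / (c * sqrt s)\<^sup>2"
        by (simp only: B4_def S_def)
      also have "\<dots> = 2 / c\<^sup>2" unfolding cs(2) s_def[symmetric] using s by simp
      finally show ?thesis using c2 by simp
    qed
    have sub: "{\<omega>\<in>space M. \<exists>t\<in>{0..1}. deviation n t \<omega> > \<epsilon>}
      \<subseteq> (B1 \<union> B2) \<union> (B3 \<union> B4)"
    proof (intro subsetI; rule ccontr)
      fix \<omega> assume w: "\<omega> \<in> {\<omega>\<in>space M. \<exists>t\<in>{0..1}. deviation n t \<omega> > \<epsilon>}"
        "\<omega> \<notin> (B1 \<union> B2) \<union> (B3 \<union> B4)"
      then obtain t where t: "\<omega> \<in> space M" "t \<in> {0..1}"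
        "\<bar>student n (\<lambda>i. Z i \<omega>) t - G (time_var M Z n t) \<omega> / sqrt s\<bar> > \<epsilon>" by (auto simp: s_def)
      let ?z = "\<lambda>i. Z i \<omega>"
      define p where "p = time_data n ?z t"
      define q where "q = time_var M Z n t"
      have nB1: "\<bar>centred_squares n ?z m - s2 m\<bar> \<le> \<delta> * s2 n" if "m \<le> n" for m
        using w(2) t(1) that unfolding B1_def by force
      have nB2: "\<bar>S m \<omega> - G m \<omega>\<bar> \<le> \<epsilon> / 3 * sqrt s" if "m \<le> n" for m
        using w(2) t(1) that unfolding B2_def s_def by force
      have nB3: "\<bar>G j \<omega> - G i \<omega>\<bar> \<le> \<epsilon> / 3 * sqrt s" if "i \<le> j" "j \<le> n" "s2 j - s2 i \<le> \<theta> * s2 n" for i j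
        using w(2) t(1) that unfolding B3_def s_def by force
      have nB4: "\<bar>S m \<omega>\<bar> \<le> 2 * (c * sqrt s)" if "m \<le> n" for m
        using w(2) t(1) that unfolding B4_def by force
      have vd: "\<sigma>2 i \<le> \<delta> * s2 n" if "i \<in> {1..n}" for i using elim(4) that by blast
      note tc = time_change_close[OF t(2) n(1) \<delta>(1) vd nB1, folded p_def q_def]
      have "\<bar>s2 p - s2 q\<bar> \<le> \<theta> * s2 n"
      proof -
        have "3 * \<delta> * s2 n \<le> \<theta> * s2 n" using \<delta>(3) s by (intro mult_right_mono) (auto simp: s_def)
        then show ?thesis using tc(3) by simp
      qed
      then have G: "\<bar>G p \<omega> - G q \<omega>\<bar> \<le> \<epsilon> / 3 * sqrt s"
        using nB3[of p q] nB3[of q p] tc(1,2) by (cases "p \<le> q") (auto simp: abs_minus_commute)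
      obtain d where d: "student n ?z t = (\<Sum>i=1..p. ?z i) / sqrt s * d" "\<bar>d - 1\<bar> \<le> 2 * (\<delta> + 1 / real n)"
        using student_normalisation[OF n(1) s \<delta>(1,2), of ?z t] nB1[of n] unfolding p_def s_def by auto
      have "2 * c * \<bar>d - 1\<bar> \<le> \<epsilon> / 3"
      proof -
        have "24 * c < real n0 * \<epsilon>" using n0 \<epsilon> by (simp add: divide_less_eq)
        also have "\<dots> \<le> real n * \<epsilon>" using n(2) \<epsilon> by (intro mult_right_mono) auto
        finally have "24 * c < \<epsilon> * real n" by (simp add: mult.commute)
        then have "1 / real n \<le> \<epsilon> / (24 * c)" using n c \<epsilon> by (simp add: field_simps)
        then have "2 * (\<delta> + 1 / real n) \<le> 2 * (\<epsilon> / (24 * c) + \<epsilon> / (24 * c))"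
          using \<delta>(4) by (intro mult_left_mono add_mono) auto
        with d(2) have "\<bar>d - 1\<bar> \<le> 2 * (\<epsilon> / (24 * c) + \<epsilon> / (24 * c))" by (rule order_trans)
        then have "2 * c * \<bar>d - 1\<bar> \<le> 2 * c * (2 * (\<epsilon> / (24 * c) + \<epsilon> / (24 * c)))" using c by (intro mult_left_mono) auto
        also have "\<dots> = \<epsilon> / 3" using c by (simp add: field_simps)
        finally show ?thesis .
      qed
      moreover have "\<bar>S p \<omega>\<bar> / sqrt s * \<bar>d - 1\<bar> \<le> 2 * c * \<bar>d - 1\<bar>"
        using nB4[OF tc(1)] s by (intro mult_right_mono) (auto simp: divide_le_eq mult_ac)
      moreover have "\<bar>S p \<omega> / sqrt s * (d - 1)\<bar> = \<bar>S p \<omega>\<bar> / sqrt s * \<bar>d - 1\<bar>"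
        using s by (simp add: abs_mult abs_divide)
      ultimately have 1: "\<bar>S p \<omega> / sqrt s * (d - 1)\<bar> \<le> \<epsilon> / 3" by linarith
      have 2: "\<bar>(S p \<omega> - G p \<omega>) / sqrt s\<bar> \<le> \<epsilon> / 3" using nB2[OF tc(1)] s by (simp add: abs_divide divide_le_eq)
      have 3: "\<bar>(G p \<omega> - G q \<omega>) / sqrt s\<bar> \<le> \<epsilon> / 3" using G s by (simp add: abs_divide divide_le_eq)
      have eq: "student n ?z t - G q \<omega> / sqrt s =
        S p \<omega> / sqrt s * (d - 1) + (S p \<omega> - G p \<omega>) / sqrt s + (G p \<omega> - G q \<omega>) / sqrt s"
        unfolding d(1) S_def by (simp add: algebra_simps diff_divide_distrib)
      have "\<bar>x + y + u\<bar> \<le> \<epsilon>" if "\<bar>x\<bar> \<le> \<epsilon> / 3" "\<bar>y\<bar> \<le> \<epsilon> / 3" "\<bar>u\<bar> \<le> \<epsilon> / 3" for x y u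
        using that by linarith
      from this[OF 1 2 3] have "\<bar>student n ?z t - G q \<omega> / sqrt s\<bar> \<le> \<epsilon>" by (simp only: eq)
      then show False using t(3) by (simp add: q_def)
    qed
    have "prob {\<omega>\<in>space M. \<exists>t\<in>{0..1}. deviation n t \<omega> > \<epsilon>}
      \<le> prob ((B1 \<union> B2) \<union> (B3 \<union> B4))"
      using sub ev1 ev by (intro finite_measure_mono) auto
    also have "\<dots> \<le> prob (B1 \<union> B2) + prob (B3 \<union> B4)" using ev1 ev by (intro measure_Un_le) auto
    also have "\<dots> \<le> (prob B1 + prob B2) + (prob B3 + prob B4)" using ev1 ev by (intro add_mono measure_Un_le) auto
    also have "\<dots> < \<kappa>" using elim(1-3) p4 unfolding B1_def[symmetric] B2_def[symmetric] B3_def[symmetric] by simp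
    finally show ?case by (simp add: measure_nonneg)
  qed
qed

end

section \<open>Step paths\<close>

text \<open>Common form of the two clocks, so that the regularity of step paths is proved once for
  both.\<close>

definition time_index :: "nat \<Rightarrow> (nat \<Rightarrow> real) \<Rightarrow> real \<Rightarrow> nat" where
  "time_index n f t = Max {m\<in>{0..n}. f m \<le> t * f n}"

lemma time_var_index: "time_var M Z n = time_index n (sum_var M Z)"
  by (simp add: time_var_def time_index_def fun_eq_iff)

lemma time_data_index: "time_data n z = time_index n (centred_squares n z)"
  by (simp add: time_data_def time_index_def centred_squares_def fun_eq_iff)

lemma centred_squares_simps: "centred_squares n z 0 = 0" "centred_squares n z m \<ge> 0"
  by (auto simp: centred_squares_def intro!: sum_nonneg)

lemma time_index_le:
  assumes "f 0 = 0" "f n \<ge> 0" "t \<ge> 0"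
  shows "time_index n f t \<le> n"
  unfolding time_index_def using Max_index(1)[OF assms] .

text \<open>Each of the finitely many tests \<open>f m \<le> u * f n\<close> is eventually constant
  as \<open>u\<close> decreases to \<open>t\<close>: a true test stays true as \<open>u\<close>
  grows, a false one is a strict inequality and survives small changes.\<close>

lemma time_index_right:
  assumes "f n \<ge> 0"
  shows "eventually (\<lambda>u. time_index n f u = time_index n f t) (at_right t)"
proof -
  have "eventually (\<lambda>u. (f m \<le> u * f n) = (f m \<le> t * f n)) (at_right t)" for m
  proof (cases "f m \<le> t * f n")
    case True
    have "eventually (\<lambda>u. u > t) (at_right t)" by (simp add: eventually_at_right_less)
    then show ?thesis
    proof eventually_elim
      case (elim u)
      then have "t * f n \<le> u * f n" using assms by (intro mult_right_mono) auto
      then show ?case using True by simp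
    qed
  next
    case False
    have "((\<lambda>u. u * f n) \<longlongrightarrow> t * f n) (at_right t)" by (intro tendsto_intros)
    then have "eventually (\<lambda>u. u * f n < f m) (at_right t)"
      using False by (intro order_tendstoD(2)) auto
    then show ?thesis by eventually_elim (use False in auto)
  qed
  then have "eventually (\<lambda>u. \<forall>m\<in>{0..n}. (f m \<le> u * f n) = (f m \<le> t * f n)) (at_right t)"
    by (intro eventually_ball_finite) auto
  then show ?thesis
    by eventually_elim (auto simp: time_index_def intro!: arg_cong[where f=Max])
qed

text \<open>From the left the tests are again eventually constant, but possibly with another value
  than at \<open>t\<close>: for \<open>f n > 0\<close> an equality at \<open>t\<close> is false just
  before. If \<open>f n = 0\<close> the tests do not depend on \<open>u\<close>.\<close>

lemma time_index_left:
  assumes "f n \<ge> 0"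
  shows "\<exists>k. eventually (\<lambda>u. time_index n f u = k) (at_left t)"
proof -
  have ex: "\<exists>b. eventually (\<lambda>u. (f m \<le> u * f n) = b) (at_left t)" for m
  proof (cases "f m < t * f n \<or> f n = 0")
    case True
    then show ?thesis
    proof
      assume "f m < t * f n"
      moreover have "((\<lambda>u. u * f n) \<longlongrightarrow> t * f n) (at_left t)" by (intro tendsto_intros)
      ultimately have "eventually (\<lambda>u. f m < u * f n) (at_left t)" by (intro order_tendstoD(1)) auto
      then have "eventually (\<lambda>u. (f m \<le> u * f n) = True) (at_left t)" by eventually_elim auto
      then show ?thesis by blast
    qed auto
  next
    case False
    have "eventually (\<lambda>u. u \<in> {t - 1<..<t}) (at_left t)" by (rule eventually_at_left_real) simp
    then have "eventually (\<lambda>u. (f m \<le> u * f n) = False) (at_left t)"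
    proof eventually_elim
      case (elim u)
      then have "u * f n < t * f n" using assms False by (intro mult_strict_right_mono) auto
      then show ?case using False by simp
    qed
    then show ?thesis by blast
  qed
  obtain b where "\<And>m. eventually (\<lambda>u. (f m \<le> u * f n) = b m) (at_left t)"
    using choice[of "\<lambda>m b. eventually (\<lambda>u. (f m \<le> u * f n) = b) (at_left t)"] ex by blast
  then have "eventually (\<lambda>u. \<forall>m\<in>{0..n}. (f m \<le> u * f n) = b m) (at_left t)"
    by (intro eventually_ball_finite) auto
  then have "eventually (\<lambda>u. time_index n f u = Max {m\<in>{0..n}. b m}) (at_left t)"
    by eventually_elim (auto simp: time_index_def intro!: arg_cong[where f=Max])
  then show ?thesis by blast
qed

lemma step_path_D01:
  assumes "f n \<ge> 0"
  shows "(\<lambda>t\<in>{0..1}. g (time_index n f t)) \<in> D01"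
  unfolding D01_def
proof (intro CollectI conjI ballI)
  let ?p = "\<lambda>t\<in>{0..1}. g (time_index n f t)"
  show "(?p \<longlongrightarrow> ?p t) (at_right t)" if t: "t \<in> {0..<1}" for t
  proof (rule tendsto_eventually)
    have "eventually (\<lambda>u. u \<in> {t<..<1}) (at_right t)" using t by (intro eventually_at_right_real) auto
    then show "eventually (\<lambda>u. ?p u = ?p t) (at_right t)"
      using time_index_right[of f n t, OF assms] by eventually_elim (use t in auto)
  qed
  show "\<exists>l. (?p \<longlongrightarrow> l) (at_left t)" if t: "t \<in> {0<..1}" for t
  proof -
    obtain k where k: "eventually (\<lambda>u. time_index n f u = k) (at_left t)"
      using time_index_left[of f n t, OF assms] by blast
    have "eventually (\<lambda>u. u \<in> {0<..<t}) (at_left t)" using t by (intro eventually_at_left_real) auto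
    then have "eventually (\<lambda>u. ?p u = g k) (at_left t)"
      using k by eventually_elim (use t in auto)
    then show ?thesis using tendsto_eventually by blast
  qed
qed auto

text \<open>One rational time slightly to the right serves both clocks by right-continuity; at
  \<open>t = 1\<close>, where there is no room, 1 itself is rational.\<close>

lemma time_index_rational:
  assumes "f n \<ge> 0" "f' n \<ge> 0" "t \<in> {0..1}"
  obtains u where "u \<in> {0..1} \<inter> \<rat>" "time_index n f u = time_index n f t" "time_index n f' u = time_index n f' t"
proof (cases "t = 1")
  case True
  then show ?thesis using that[of 1] by simp
next
  case False
  have "eventually (\<lambda>u. time_index n f u = time_index n f t \<and> time_index n f' u = time_index n f' t) (at_right t)"
    using time_index_right[of f n t] time_index_right[of f' n t] assms by (auto intro: eventually_conj)
  then obtain b where b: "b > t" "\<And>u. t < u \<Longrightarrow> u < b \<Longrightarrow> time_index n f u = time_index n f t \<and> time_index n f' u = time_index n f' t"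
    unfolding eventually_at_right_field by blast
  have "t < min b 1" using b False assms(3) by auto
  then obtain u where "u \<in> \<rat>" "t < u" "u < min b 1" using Rats_dense_in_real by blast
  then show ?thesis using that[of u] b(2)[of u] assms(3) by auto
qed

lemma student_eq:
  "student n z t = (\<lambda>k. (\<Sum>i=1..k. z i / sqrt (real n))
     / sqrt ((\<Sum>i=1..n. (z i - sample_mean n z)\<^sup>2) / (real n - 1))) (time_index n (centred_squares n z) t)"
  by (simp add: student_def time_data_index)

lemma student_path_D01: "(\<lambda>t\<in>{0..1}. student n z t) \<in> D01"
  unfolding student_eq by (rule step_path_D01) (rule centred_squares_simps)

lemma student_measurable:
  assumes X: "\<And>i. i \<ge> 1 \<Longrightarrow> X i \<in> borel_measurable M" and t: "t \<in> {0..1}"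
  shows "(\<lambda>\<omega>. student n (\<lambda>i. X i \<omega>) t) \<in> borel_measurable M"
proof -
  \<comment> \<open>Measurability is given from index 1 on; a constant at index 0 makes every
    coordinate measurable without changing the process.\<close>
  define X' where "X' i = (if i \<ge> 1 then X i else (\<lambda>_. 0))" for i
  have [measurable]: "X' i \<in> borel_measurable M" for i using X by (simp add: X'_def)
  have eq: "student n (\<lambda>i. X i \<omega>) t = student n (\<lambda>i. X' i \<omega>) t" for \<omega>
    by (simp add: student_def time_data_def sample_mean_def X'_def cong: sum.cong_simp)
  have [measurable]: "(\<lambda>\<omega>. sample_mean n (\<lambda>i. X' i \<omega>)) \<in> borel_measurable M"
    unfolding sample_mean_def by measurable
  have K: "(\<lambda>\<omega>. time_data n (\<lambda>i. X' i \<omega>) t) \<in> M \<rightarrow>\<^sub>M count_space UNIV"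
    unfolding time_data_def by measurable
  have "(\<lambda>\<omega>. \<Sum>i=1..time_data n (\<lambda>i. X' i \<omega>) t. X' i \<omega> / sqrt (real n)) \<in> borel_measurable M"
    \<comment> \<open>The random summation limit takes countably many values, so each fixed limit
      can be treated separately.\<close>
    by (rule measurable_compose_countable[OF _ K]) measurable
  then show ?thesis unfolding eq unfolding student_def by measurable
qed

text \<open>The sigma-algebra on paths is generated by finite-dimensional sets, so measurability of
  the evaluations suffices.\<close>

lemma path_measurable:
  assumes "\<And>\<omega>. \<omega> \<in> space M \<Longrightarrow> X \<omega> \<in> D01"
    and "\<And>t. t \<in> {0..1} \<Longrightarrow> (\<lambda>\<omega>. X \<omega> t) \<in> borel_measurable M"
  shows "X \<in> M \<rightarrow>\<^sub>M D01_algebra"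
  unfolding D01_algebra_def
proof (rule measurable_measure_of)
  fix S assume "S \<in> {{f \<in> D01. restrict f J \<in> B} | J B. finite J \<and> J \<subseteq> {0..1} \<and> B \<in> sets (Pi\<^sub>M J (\<lambda>_. borel))}"
  then obtain J B where S: "S = {f \<in> D01. restrict f J \<in> B}" and J: "J \<subseteq> {0..1}" and B: "B \<in> sets (Pi\<^sub>M J (\<lambda>_. borel))"
    by blast
  have "(\<lambda>\<omega>. restrict (X \<omega>) J) \<in> M \<rightarrow>\<^sub>M Pi\<^sub>M J (\<lambda>_. borel)"
    using J assms(2) by (intro measurable_restrict) auto
  from measurable_sets[OF this B] show "X -` S \<inter> space M \<in> sets M"
    using assms(1) by (simp add: S vimage_def Int_def conj_commute cong: conj_cong)
qed (use assms(1) in auto)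

text \<open>Both processes are right-continuous step functions, so rational times suffice.\<close>

lemma
  fixes X Y :: "nat \<Rightarrow> 'a \<Rightarrow> real" and s :: "nat \<Rightarrow> real"
  assumes X: "\<And>i. i \<ge> 1 \<Longrightarrow> X i \<in> borel_measurable M"
    and G: "\<And>k. G k \<in> borel_measurable M" and s: "s 0 = 0" "s n \<ge> 0"
  defines "\<Delta> \<equiv> \<lambda>\<omega> t. \<bar>student n (\<lambda>i. X i \<omega>) t - G (time_index n s t) \<omega>\<bar>"
  shows student_distance_measurable: "(\<lambda>\<omega>. SUP t\<in>{0..1}. \<Delta> \<omega> t) \<in> borel_measurable M"
    and student_distance_less: "\<epsilon> < (SUP t\<in>{0..1}. \<Delta> \<omega> t) \<longleftrightarrow> (\<exists>t\<in>{0..1}. \<epsilon> < \<Delta> \<omega> t)"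
    and student_distance_nonneg: "0 \<le> (SUP t\<in>{0..1}. \<Delta> \<omega> t)"
proof -
  define g where "g \<omega> k = (\<Sum>i=1..k. X i \<omega> / sqrt (real n))
     / sqrt ((\<Sum>i=1..n. (X i \<omega> - sample_mean n (\<lambda>i. X i \<omega>))\<^sup>2) / (real n - 1))" for \<omega> k
  define f where "f \<omega> = centred_squares n (\<lambda>i. X i \<omega>)" for \<omega>
  have \<Delta>: "\<Delta> \<omega> t = \<bar>g \<omega> (time_index n (f \<omega>) t) - G (time_index n s t) \<omega>\<bar>" for \<omega> t
    by (simp add: \<Delta>_def student_eq g_def f_def)
  have f: "f \<omega> 0 = 0" "f \<omega> n \<ge> 0" for \<omega> by (simp_all add: f_def centred_squares_simps)
  \<comment> \<open>Each clock takes at most \<open>n + 1\<close> values. This supplies the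
    boundedness without which a real supremum says nothing.\<close>
  have fin: "finite (\<Delta> \<omega> ` {0..1})" for \<omega>
  proof (rule finite_subset)
    show "\<Delta> \<omega> ` {0..1} \<subseteq> (\<lambda>(p, q). \<bar>g \<omega> p - G q \<omega>\<bar>) ` ({..n} \<times> {..n})"
    proof
      fix x assume "x \<in> \<Delta> \<omega> ` {0..1}"
      then obtain t where t: "t \<in> {0..1}" "x = \<bar>g \<omega> (time_index n (f \<omega>) t) - G (time_index n s t) \<omega>\<bar>"
        by (auto simp: \<Delta>)
      moreover have "time_index n (f \<omega>) t \<le> n" "time_index n s t \<le> n"
        using time_index_le f s t by auto
      ultimately show "x \<in> (\<lambda>(p, q). \<bar>g \<omega> p - G q \<omega>\<bar>) ` ({..n} \<times> {..n})" by force
    qed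
  qed auto
  have rat: "\<Delta> \<omega> ` {0..1} = \<Delta> \<omega> ` ({0..1} \<inter> \<rat>)" for \<omega>
  proof (intro equalityI subsetI)
    fix x assume "x \<in> \<Delta> \<omega> ` {0..1}"
    then obtain t where t: "t \<in> {0..1}" "x = \<Delta> \<omega> t" by auto
    obtain u where "u \<in> {0..1} \<inter> \<rat>" "time_index n (f \<omega>) u = time_index n (f \<omega>) t" "time_index n s u = time_index n s t"
      using time_index_rational[where f="f \<omega>" and f'=s and n=n and t=t] f s t by blast
    then have "x = \<Delta> \<omega> u" by (simp add: t \<Delta>)
    then show "x \<in> \<Delta> \<omega> ` ({0..1} \<inter> \<rat>)" using \<open>u \<in> _\<close> by blast
  qed auto
  have "(\<lambda>\<omega>. SUP t\<in>{0..1} \<inter> \<rat>. \<Delta> \<omega> t) \<in> borel_measurable M"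
  proof (rule borel_measurable_cSUP)
    show "countable ({0..1} \<inter> \<rat> :: real set)" using countable_rat by blast
    show "(\<lambda>\<omega>. \<Delta> \<omega> t) \<in> borel_measurable M" if "t \<in> {0..1} \<inter> \<rat>" for t
      unfolding \<Delta>_def using student_measurable[where X=X and t=t and n=n, OF X] G that by auto
    show "bdd_above ((\<lambda>i. \<Delta> \<omega> i) ` ({0..1} \<inter> \<rat>))" for \<omega>
      using fin[of \<omega>] unfolding rat by (rule bdd_above_finite)
  qed
  then show "(\<lambda>\<omega>. SUP t\<in>{0..1}. \<Delta> \<omega> t) \<in> borel_measurable M" by (simp only: rat)
  have bdd: "bdd_above (\<Delta> \<omega> ` {0..1})" using fin by (rule bdd_above_finite)
  show "\<epsilon> < (SUP t\<in>{0..1}. \<Delta> \<omega> t) \<longleftrightarrow> (\<exists>t\<in>{0..1}. \<epsilon> < \<Delta> \<omega> t)"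
    by (rule less_cSUP_iff) (use bdd in auto)
  have "0 \<le> \<Delta> \<omega> 0" by (simp add: \<Delta>)
  also have "\<Delta> \<omega> 0 \<le> (SUP t\<in>{0..1}. \<Delta> \<omega> t)" by (rule cSUP_upper[OF _ bdd]) auto
  finally show "0 \<le> (SUP t\<in>{0..1}. \<Delta> \<omega> t)" .
qed

section \<open>Convergence at a fixed time\<close>

lemma (in prob_space) distr_borel_distributed:
  assumes "distributed M lborel X f"
  shows "distr M borel X = density lborel f"
proof -
  have "distr M borel X = distr M lborel X" by (intro distr_cong) auto
  then show ?thesis using assms by (simp add: distributed_def)
qed

lemma (in prob_space) char_normal:
  assumes X: "distributed M lborel X (normal_density 0 \<sigma>)" and \<sigma>: "\<sigma> > 0"
  shows "char (distr M borel X) t = exp (- (\<sigma>\<^sup>2 * t\<^sup>2 / 2))"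
proof -
  have Xm[measurable]: "X \<in> borel_measurable M" using distributed_measurable[OF X] by simp
  have "distributed M lborel (\<lambda>x. X x / \<sigma>) std_normal_density"
    using X normal_standard_normal_convert[OF \<sigma>, of X 0] by simp
  then have d: "distr M borel (\<lambda>x. X x / \<sigma>) = std_normal_distribution"
    by (rule distr_borel_distributed)
  have "char (distr M borel X) t = (CLINT x|M. iexp (t * X x))"
    unfolding char_def by (subst integral_distr) auto
  also have "\<dots> = (CLINT x|M. iexp ((t * \<sigma>) * (X x / \<sigma>)))" using \<sigma> by simp
  also have "\<dots> = char (distr M borel (\<lambda>x. X x / \<sigma>)) (t * \<sigma>)"
    unfolding char_def by (subst integral_distr) auto
  also have "\<dots> = exp (- (\<sigma>\<^sup>2 * t\<^sup>2 / 2))"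
    unfolding d char_std_normal_distribution by (simp add: power_mult_distrib mult.commute)
  finally show ?thesis .
qed

lemma norm_iexp_diff_le: "norm (iexp (t * x) - iexp (t * y)) \<le> \<bar>t\<bar> * \<bar>x - y\<bar>" "norm (iexp (t * x) - iexp (t * y)) \<le> 2"
proof -
  have "iexp (t * x) - iexp (t * y) = iexp (t * y) * (iexp (t * (x - y)) - 1)"
  proof -
    have "\<i> * complex_of_real (t * y) + \<i> * complex_of_real (t * (x - y)) = \<i> * complex_of_real (t * x)"
      by (simp add: algebra_simps)
    then have "iexp (t * x) = iexp (t * y) * iexp (t * (x - y))" by (simp only: exp_add[symmetric])
    then show ?thesis by (simp only: right_diff_distrib mult_1_right)
  qed
  then have "norm (iexp (t * x) - iexp (t * y)) = norm (iexp (t * (x - y)) - 1)"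
    by (simp add: norm_mult)
  also have "\<dots> \<le> \<bar>t * (x - y)\<bar>" using iexp_approx1[of "t * (x - y)" 0] by simp
  finally show "norm (iexp (t * x) - iexp (t * y)) \<le> \<bar>t\<bar> * \<bar>x - y\<bar>" by (simp add: abs_mult)
  show "norm (iexp (t * x) - iexp (t * y)) \<le> 2"
    by (rule order_trans[OF norm_triangle_ineq4]) simp
qed

text \<open>Slutsky's theorem through characteristic functions: \<open>iexp\<close> is Lipschitz
  where the variables are within \<open>\<epsilon>\<close> of each other, and its differences are at
  most 2 on the exceptional event.\<close>

lemma (in prob_space) weak_conv_close:
  fixes X B :: "nat \<Rightarrow> 'a \<Rightarrow> real"
  assumes X[measurable]: "\<And>n. X n \<in> borel_measurable M" and B[measurable]: "\<And>n. B n \<in> borel_measurable M"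
    and L: "real_distribution L" and conv: "weak_conv_m (\<lambda>n. distr M borel (B n)) L"
    and close: "\<And>\<epsilon>. \<epsilon> > 0 \<Longrightarrow> (\<lambda>n. prob {\<omega>\<in>space M. \<bar>X n \<omega> - B n \<omega>\<bar> > \<epsilon>}) \<longlonglongrightarrow> 0"
  shows "weak_conv_m (\<lambda>n. distr M borel (X n)) L"
proof (rule levy_continuity)
  fix t
  have B_lim: "(\<lambda>n. char (distr M borel (B n)) t) \<longlonglongrightarrow> char L t"
    by (rule levy_continuity1[OF _ L conv]) auto
  have bound: "norm (char (distr M borel (X n)) t - char (distr M borel (B n)) t) \<le>
    \<bar>t\<bar> * \<epsilon> + 2 * prob {\<omega>\<in>space M. \<bar>X n \<omega> - B n \<omega>\<bar> > \<epsilon>}" if "\<epsilon> > 0" for \<epsilon> n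
  proof -
    let ?A = "{\<omega>\<in>space M. \<bar>X n \<omega> - B n \<omega>\<bar> > \<epsilon>}"
    have A[measurable]: "?A \<in> events" by measurable
    have "char (distr M borel (X n)) t - char (distr M borel (B n)) t =
      (CLINT \<omega>|M. iexp (t * X n \<omega>)) - (CLINT \<omega>|M. iexp (t * B n \<omega>))"
      unfolding char_def by (subst (1 2) integral_distr) auto
    also have "\<dots> = (CLINT \<omega>|M. iexp (t * X n \<omega>) - iexp (t * B n \<omega>))"
      by (intro Bochner_Integration.integral_diff[symmetric] integrable_iexp) auto
    finally have "norm (char (distr M borel (X n)) t - char (distr M borel (B n)) t) \<le>
      (\<integral>\<omega>. norm (iexp (t * X n \<omega>) - iexp (t * B n \<omega>)) \<partial>M)"
      by (simp only: integral_norm_bound)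
    also have "\<dots> \<le> (\<integral>\<omega>. \<bar>t\<bar> * \<epsilon> + 2 * indicator ?A \<omega> \<partial>M)"
    proof (rule integral_mono)
      show "integrable M (\<lambda>\<omega>. norm (iexp (t * X n \<omega>) - iexp (t * B n \<omega>)))"
        by (intro integrable_norm Bochner_Integration.integrable_diff integrable_iexp) auto
      show "integrable M (\<lambda>\<omega>. \<bar>t\<bar> * \<epsilon> + 2 * indicator ?A \<omega> :: real)"
        by (intro Bochner_Integration.integrable_add integrable_mult_right) (auto simp: emeasure_eq_measure)
      fix \<omega> assume w: "\<omega> \<in> space M"
      show "norm (iexp (t * X n \<omega>) - iexp (t * B n \<omega>)) \<le> \<bar>t\<bar> * \<epsilon> + 2 * indicator ?A \<omega>"
      proof (cases "\<omega> \<in> ?A")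
        case True
        have "0 \<le> \<bar>t\<bar> * \<epsilon>" using that by simp
        then show ?thesis using True norm_iexp_diff_le(2)[of t "X n \<omega>" "B n \<omega>"] by simp
      next
        case False
        then have "\<bar>t\<bar> * \<bar>X n \<omega> - B n \<omega>\<bar> \<le> \<bar>t\<bar> * \<epsilon>" using w by (intro mult_left_mono) auto
        then show ?thesis using False norm_iexp_diff_le(1)[of t "X n \<omega>" "B n \<omega>"] by simp
      qed
    qed
    also have "\<dots> = \<bar>t\<bar> * \<epsilon> + 2 * prob ?A"
      by (subst Bochner_Integration.integral_add) (auto simp: prob_space emeasure_eq_measure)
    finally show ?thesis .
  qed
  have "(\<lambda>n. char (distr M borel (X n)) t - char (distr M borel (B n)) t) \<longlonglongrightarrow> 0"
  proof (rule LIMSEQ_eventuallyI)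
    fix r :: real assume r: "r > 0"
    define \<epsilon> where "\<epsilon> = r / (2 * (\<bar>t\<bar> + 1))"
    have \<epsilon>: "\<epsilon> > 0" using r by (simp add: \<epsilon>_def)
    have "\<bar>t\<bar> * \<epsilon> \<le> (\<bar>t\<bar> + 1) * \<epsilon>" using \<epsilon> by (intro mult_right_mono) auto
    also have "\<dots> = r / 2" by (simp add: \<epsilon>_def divide_simps)
    finally have te: "\<bar>t\<bar> * \<epsilon> \<le> r / 2" .
    have "eventually (\<lambda>n. prob {\<omega>\<in>space M. \<bar>X n \<omega> - B n \<omega>\<bar> > \<epsilon>} < r / 4) sequentially"
      using order_tendstoD(2)[OF close[OF \<epsilon>], of "r / 4"] r by simp
    then show "eventually (\<lambda>n. norm (char (distr M borel (X n)) t - char (distr M borel (B n)) t - 0) < r) sequentially"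
    proof eventually_elim
      case (elim n)
      show ?case using bound[OF \<epsilon>, of n] te elim by simp
    qed
  qed
  from tendsto_add[OF this B_lim] show "(\<lambda>n. char (distr M borel (X n)) t) \<longlonglongrightarrow> char L t" by simp
qed (use L in auto)

context lindeberg_sequence
begin

text \<open>The clock lags behind \<open>t\<close> by at most one relative jump, which
  \<open>feller\<close> bounds independently of \<open>t\<close>.\<close>

lemma time_var_uniform:
  assumes "\<delta> > 0"
  shows "eventually (\<lambda>n. \<forall>t\<in>{0..1}. \<bar>s2 (time_var M Z n t) / s2 n - t\<bar> \<le> \<delta>) sequentially"
  using feller[OF assms] eventually_ge_at_top[of 1]
proof eventually_elim
  case (elim n)
  have s: "s2 n > 0" by (rule sum_var_pos[OF elim(2)])
  show ?case
  proof
    fix t :: real assume t: "t \<in> {0..1}"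
    then have t': "0 \<le> t" "t \<le> 1" by auto
    define q where "q = time_var M Z n t"
    have q_eq: "q = Max {m\<in>{0..n}. s2 m \<le> t * s2 n}" by (simp add: q_def time_var_def)
    note q = Max_index[of s2 n t, OF sum_var_0 sum_var_nonneg t'(1), folded q_eq]
    have "s2 q \<ge> t * s2 n - \<delta> * s2 n"
    proof (cases "q = n")
      case True
      have "t * s2 n \<le> s2 n" using t' s by (simp add: mult_left_le_one_le)
      moreover have "\<delta> * s2 n > 0" using assms s by simp
      ultimately show ?thesis using True by simp
    next
      case False
      then have "q < n" using q(1) by simp
      then have "\<sigma>2 (Suc q) \<le> \<delta> * s2 n" using elim(1) by auto
      then show ?thesis using q(3)[OF \<open>q < n\<close>] by (simp add: sum_var_Suc)
    qed
    then have "\<bar>s2 q - t * s2 n\<bar> \<le> \<delta> * s2 n" using q(2) by (auto simp: abs_le_iff)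
    moreover have "s2 q / s2 n - t = (s2 q - t * s2 n) / s2 n" using s by (simp add: field_simps)
    ultimately show "\<bar>s2 (time_var M Z n t) / s2 n - t\<bar> \<le> \<delta>"
      using s by (simp add: q_def[symmetric] abs_divide divide_le_eq)
  qed
qed

lemma time_var_le: "t \<in> {0..1} \<Longrightarrow> time_var M Z n t \<le> n"
  unfolding time_var_index by (rule time_index_le) (auto simp: sum_var_0 sum_var_nonneg)

text \<open>Means, variances and truncated moments depend only on the marginal laws, so the copy is
  a Lindeberg sequence with the same \<open>s2\<close>. The joint laws agree because both sequences
  are independent: each joint law is the product of the same marginals.\<close>

lemma coupling_space:
  obtains N :: "(nat \<Rightarrow> (nat \<Rightarrow> real) \<times> (nat \<Rightarrow> real)) measure"
    and Z' Y :: "nat \<Rightarrow> (nat \<Rightarrow> (nat \<Rightarrow> real) \<times> (nat \<Rightarrow> real)) \<Rightarrow> real" and r \<eta>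
  where "lindeberg_coupling N Z' Y r \<eta>"
    "distr N (Pi\<^sub>M {1..} (\<lambda>_. borel)) (\<lambda>\<omega>. \<lambda>i\<in>{1..}. Z' i \<omega>) =
     distr M (Pi\<^sub>M {1..} (\<lambda>_. borel)) (\<lambda>\<omega>. \<lambda>i\<in>{1..}. Z i \<omega>)"
    "\<And>i. i \<ge> 1 \<Longrightarrow> prob_space.variance N (Z' i) = \<sigma>2 i"
    "sum_var N Z' = s2"
proof -
  obtain N :: "(nat \<Rightarrow> (nat \<Rightarrow> real) \<times> (nat \<Rightarrow> real)) measure" and Z' Y r \<eta>
    where N: "prob_space N"
    and Z'_ind: "prob_space.indep_vars N (\<lambda>_. borel) Z' {1..}"
    and Z'_d: "\<And>i. i \<ge> 1 \<Longrightarrow> distr N borel (Z' i) = distr M borel (Z i)"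
    and Y: "prob_space.indep_vars N (\<lambda>_. borel) Y {1..}"
      "\<And>i. i \<ge> 1 \<Longrightarrow> distributed N lborel (Y i) std_normal_density"
    and r: "strict_mono r" "r 0 = 0"
      "(\<lambda>k. (s2 (r (Suc k)) - s2 (r k)) / s2 (r (Suc k))) \<longlonglongrightarrow> 0"
    and D: "prob_space.indep_vars N (\<lambda>_. borel)
       (\<lambda>k \<omega>. \<Sum>i\<in>{r k<..r (Suc k)}. Z' i \<omega> - sqrt (\<sigma>2 i) * Y i \<omega>) UNIV"
      "\<And>k. integrable N (\<lambda>\<omega>. (\<Sum>i\<in>{r k<..r (Suc k)}. Z' i \<omega> - sqrt (\<sigma>2 i) * Y i \<omega>)\<^sup>2)"
      "\<And>k. (\<integral>\<omega>. (\<Sum>i\<in>{r k<..r (Suc k)}. Z' i \<omega> - sqrt (\<sigma>2 i) * Y i \<omega>)\<^sup>2 \<partial>N)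
       \<le> \<eta> k * (s2 (r (Suc k)) - s2 (r k))"
    and \<eta>: "\<eta> \<longlonglongrightarrow> 0"
    by (rule coupling_exists) blast
  interpret N: prob_space N by fact
  have Z'_rv[measurable]: "Z' i \<in> borel_measurable N" if "i \<ge> 1" for i
    using N.indep_vars_rv[OF Z'_ind] that by auto
  have int_eq: "integrable N (\<lambda>\<omega>. g (Z' i \<omega>)) \<longleftrightarrow> integrable M (\<lambda>\<omega>. g (Z i \<omega>))"
    and exp_eq: "N.expectation (\<lambda>\<omega>. g (Z' i \<omega>)) = expectation (\<lambda>\<omega>. g (Z i \<omega>))"
    if i: "i \<ge> 1" and g: "g \<in> borel_measurable borel" for i and g :: "real \<Rightarrow> real"
  proof -
    note [measurable] = Z'_rv[OF i] rv[OF i] g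
    show "integrable N (\<lambda>\<omega>. g (Z' i \<omega>)) \<longleftrightarrow> integrable M (\<lambda>\<omega>. g (Z i \<omega>))"
      using arg_cong[OF Z'_d[OF i], of "\<lambda>D. integrable D g"] by (simp add: integrable_distr_eq)
    show "N.expectation (\<lambda>\<omega>. g (Z' i \<omega>)) = expectation (\<lambda>\<omega>. g (Z i \<omega>))"
      using arg_cong[OF Z'_d[OF i], of "\<lambda>D. integral\<^sup>L D g"] by (simp add: integral_distr)
  qed
  have mean': "N.expectation (Z' i) = 0" if "i \<ge> 1" for i
    using exp_eq[OF that, of "\<lambda>x. x"] mean[OF that] by simp
  have var': "N.variance (Z' i) = \<sigma>2 i" if "i \<ge> 1" for i
    using exp_eq[OF that, of "\<lambda>x. x\<^sup>2"] by (simp add: mean'[OF that] mean[OF that])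
  have sv: "sum_var N Z' = s2"
    unfolding sum_var_def fun_eq_iff using var' by (auto intro!: sum.cong)
  have var_block: "N.variance (Z' i) = \<sigma>2 i" if "i \<in> {r k<..r (Suc k)}" for i k
    using that by (intro var') auto
  have D_eq: "(\<lambda>\<omega>. \<Sum>i\<in>{r k<..r (Suc k)}. Z' i \<omega> - sqrt (N.variance (Z' i)) * Y i \<omega>) =
    (\<lambda>\<omega>. \<Sum>i\<in>{r k<..r (Suc k)}. Z' i \<omega> - sqrt (\<sigma>2 i) * Y i \<omega>)" for k
    by (intro ext sum.cong refl) (simp only: var_block)
  have lind': "lindeberg N Z'"
  proof -
    have "N.expectation (\<lambda>\<omega>. (Z' i \<omega>)\<^sup>2 * indicator {\<omega>. \<bar>Z' i \<omega>\<bar> \<ge> c} \<omega>) =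
      expectation (\<lambda>\<omega>. (Z i \<omega>)\<^sup>2 * indicator {\<omega>. \<bar>Z i \<omega>\<bar> \<ge> c} \<omega>)" if "i \<ge> 1" for i c
      using exp_eq[OF that, of "\<lambda>x. x\<^sup>2 * indicator {x. \<bar>x\<bar> \<ge> c} x"] by (simp add: indicator_def)
    then have "(\<Sum>i=1..n. N.expectation (\<lambda>\<omega>. (Z' i \<omega>)\<^sup>2 * indicator {\<omega>. \<bar>Z' i \<omega>\<bar> \<ge> c} \<omega>)) =
      (\<Sum>i=1..n. expectation (\<lambda>\<omega>. (Z i \<omega>)\<^sup>2 * indicator {\<omega>. \<bar>Z i \<omega>\<bar> \<ge> c} \<omega>))" for n c
      by (intro sum.cong) auto
    then show ?thesis using lindeberg unfolding lindeberg_def sv by (simp only:)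
  qed
  have "lindeberg_coupling N Z' Y r \<eta>"
  proof unfold_locales
    show "N.indep_vars (\<lambda>_. borel) Z' {1..}" by (rule Z'_ind)
    show "N.expectation (Z' i) = 0" "N.variance (Z' i) > 0" if "i \<ge> 1" for i
      using mean'[OF that] var'[OF that] variance_pos[OF that] by auto
    show "integrable N (\<lambda>\<omega>. (Z' i \<omega>)\<^sup>2)" if "i \<ge> 1" for i
      using int_eq[OF that, of "\<lambda>x. x\<^sup>2"] square_integrable[OF that] by simp
    show "lindeberg N Z'" by (rule lind')
    show "N.indep_vars (\<lambda>_. borel) Y {1..}" by (rule Y)
    show "distributed N lborel (Y i) std_normal_density" if "i \<ge> 1" for i using Y(2)[OF that] .
    show "strict_mono r" "r 0 = 0" "\<eta> \<longlonglongrightarrow> 0" by (fact r(1) r(2) \<eta>)+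
    show "(\<lambda>k. (sum_var N Z' (r (Suc k)) - sum_var N Z' (r k)) / sum_var N Z' (r (Suc k))) \<longlonglongrightarrow> 0"
      unfolding sv by (rule r)
    show "N.indep_vars (\<lambda>_. borel)
       (\<lambda>k \<omega>. \<Sum>i\<in>{r k<..r (Suc k)}. Z' i \<omega> - sqrt (N.variance (Z' i)) * Y i \<omega>) UNIV"
      unfolding D_eq by (rule D(1))
    show "integrable N (\<lambda>\<omega>. (\<Sum>i\<in>{r k<..r (Suc k)}. Z' i \<omega> - sqrt (N.variance (Z' i)) * Y i \<omega>)\<^sup>2)" for k
      using D(2)[of k] fun_cong[OF D_eq[of k]] by simp
    show "N.expectation (\<lambda>\<omega>. (\<Sum>i\<in>{r k<..r (Suc k)}. Z' i \<omega> - sqrt (N.variance (Z' i)) * Y i \<omega>)\<^sup>2)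
       \<le> \<eta> k * (sum_var N Z' (r (Suc k)) - sum_var N Z' (r k))" for k
      unfolding sv using D(3)[of k] fun_cong[OF D_eq[of k]] by simp
  qed
  moreover have "distr N (Pi\<^sub>M {1..} (\<lambda>_. borel)) (\<lambda>\<omega>. \<lambda>i\<in>{1..}. Z' i \<omega>) =
     distr M (Pi\<^sub>M {1..} (\<lambda>_. borel)) (\<lambda>\<omega>. \<lambda>i\<in>{1..}. Z i \<omega>)"
  proof -
    have "distr N (Pi\<^sub>M {1..} (\<lambda>_. borel)) (\<lambda>\<omega>. \<lambda>i\<in>{1..}. Z' i \<omega>) = (\<Pi>\<^sub>M i\<in>{1..}. distr N borel (Z' i))"
      using Z'_ind Z'_rv by (subst (asm) N.indep_vars_iff_distr_eq_PiM') auto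
    also have "\<dots> = (\<Pi>\<^sub>M i\<in>{1..}. distr M borel (Z i))" by (intro PiM_cong) (auto simp: Z'_d)
    also have "\<dots> = distr M (Pi\<^sub>M {1..} (\<lambda>_. borel)) (\<lambda>\<omega>. \<lambda>i\<in>{1..}. Z i \<omega>)"
      using indep rv by (subst (asm) indep_vars_iff_distr_eq_PiM') auto
    finally show ?thesis .
  qed
  ultimately show ?thesis using that var' sv by blast
qed

end

context lindeberg_coupling
begin

text \<open>The event is an uncountable union over times; it is measurable because it can be written
  through the supremum, a measurable function.\<close>

lemma student_distance_event:
  "{\<omega>\<in>space M. \<exists>t\<in>{0..1}. deviation n t \<omega> > \<epsilon>} \<in> events"
proof -
  have [measurable]: "(\<lambda>\<omega>. SUP t\<in>{0..1}. \<bar>student n (\<lambda>i. Z i \<omega>) t - G (time_index n s2 t) \<omega> / sqrt (s2 n)\<bar>) \<in> borel_measurable M"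
    using student_distance_measurable[where X=Z and G="\<lambda>k \<omega>. G k \<omega> / sqrt (s2 n)" and s=s2 and n=n and M=M] rv sum_var_0 sum_var_nonneg by simp
  have "{\<omega>\<in>space M. \<exists>t\<in>{0..1}. deviation n t \<omega> > \<epsilon>} =
    {\<omega>\<in>space M. \<epsilon> < (SUP t\<in>{0..1}. \<bar>student n (\<lambda>i. Z i \<omega>) t - G (time_index n s2 t) \<omega> / sqrt (s2 n)\<bar>)}"
    using student_distance_less[where X=Z and G="\<lambda>k \<omega>. G k \<omega> / sqrt (s2 n)" and s=s2 and n=n and M=M] rv sum_var_0 sum_var_nonneg
    by (simp add: time_var_index)
  also have "\<dots> \<in> events" by measurable
  finally show ?thesis .
qed

text \<open>The normal sum at the variance-based index is itself normal or constant 0, and its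
  variance \<open>s2 (time_var M Z n t\<^sub>0) / s2 n\<close> tends to \<open>t\<^sub>0\<close>.
  The Student process differs from it by a term vanishing in probability.\<close>

lemma student_clt:
  assumes t0: "t\<^sub>0 \<in> {0<..1}"
  shows "weak_conv_m (\<lambda>n. distr M borel (\<lambda>\<omega>. student n (\<lambda>i. Z i \<omega>) t\<^sub>0))
    (density lborel (normal_density 0 (sqrt t\<^sub>0)))"
proof (rule weak_conv_close)
  let ?L = "density lborel (normal_density 0 (sqrt t\<^sub>0))"
  let ?B = "\<lambda>n \<omega>. G (time_var M Z n t\<^sub>0) \<omega> / sqrt (s2 n)"
  have t0': "t\<^sub>0 \<in> {0..1}" "t\<^sub>0 > 0" using t0 by auto
  show "(\<lambda>\<omega>. student n (\<lambda>i. Z i \<omega>) t\<^sub>0) \<in> borel_measurable M" for n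
    using rv t0' by (intro student_measurable) auto
  show B: "?B n \<in> borel_measurable M" for n by measurable
  have PL: "prob_space ?L" using t0' by (intro prob_space_normal_density) auto
  then show L: "real_distribution ?L" by (auto simp: real_distribution_def real_distribution_axioms_def)
  interpret L: prob_space ?L by (rule PL)
  have char_L: "char ?L t = exp (- (t\<^sub>0 * t\<^sup>2 / 2))" for t
  proof -
    have "distr ?L lborel (\<lambda>x. x) = ?L" by (rule distr_id2) simp
    then have "distributed ?L lborel (\<lambda>x. x) (normal_density 0 (sqrt t\<^sub>0))"
      by (simp add: distributed_def)
    from L.char_normal[OF this, of t] have "char (distr ?L borel (\<lambda>x. x)) t = exp (- (t\<^sub>0 * t\<^sup>2 / 2))" using t0' by simp
    moreover have "distr ?L borel (\<lambda>x. x) = ?L" by (rule distr_id2) simp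
    ultimately show ?thesis by simp
  qed
  \<comment> \<open>The index may be 0. The sum is then the constant 0, whose law has no density, so
    its characteristic function is computed directly.\<close>
  have char_B: "char (distr M borel (?B n)) t = exp (- ((s2 (time_var M Z n t\<^sub>0) / s2 n) * t\<^sup>2 / 2))" if n: "n \<ge> 1" for n t
  proof (cases "time_var M Z n t\<^sub>0 = 0")
    case True
    then show ?thesis by (simp add: G_def sum_var_0 char_def prob_space distr_const integral_return)
  next
    case False
    define q where "q = time_var M Z n t\<^sub>0"
    have q: "0 < q" using False by (simp add: q_def)
    have s: "s2 n > 0" "s2 q > 0" using sum_var_pos n q by auto
    have I: "{0<..q} = {1..q}" by auto
    have "distributed M lborel (G q) (normal_density 0 (sqrt (s2 q)))"
      using normal_block[OF prob_space_axioms Y_indep Y_normal q] unfolding G_def[abs_def] I by (simp add: sum_var_0)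
    from normal_density_affine[OF this, of "1 / sqrt (s2 n)" 0] s
    have "distributed M lborel (\<lambda>\<omega>. G q \<omega> / sqrt (s2 n)) (normal_density 0 (sqrt (s2 q) / sqrt (s2 n)))"
      by simp
    from char_normal[OF this, of t] s show ?thesis by (simp add: q_def[symmetric] power_divide)
  qed
  show "weak_conv_m (\<lambda>n. distr M borel (?B n)) ?L"
  proof (rule levy_continuity[OF _ L])
    show "real_distribution (distr M borel (?B n))" for n using B by auto
    fix t
    have "(\<lambda>n. s2 (time_var M Z n t\<^sub>0) / s2 n) \<longlonglongrightarrow> t\<^sub>0"
    proof (rule LIMSEQ_eventuallyI)
      fix \<delta> :: real assume "\<delta> > 0"
      then have "eventually (\<lambda>n. \<forall>t\<in>{0..1}. \<bar>s2 (time_var M Z n t) / s2 n - t\<bar> \<le> \<delta> / 2) sequentially"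
        by (intro time_var_uniform) auto
      then show "eventually (\<lambda>n. norm (s2 (time_var M Z n t\<^sub>0) / s2 n - t\<^sub>0) < \<delta>) sequentially"
      proof eventually_elim
        case (elim n)
        then have "\<bar>s2 (time_var M Z n t\<^sub>0) / s2 n - t\<^sub>0\<bar> \<le> \<delta> / 2" using t0' by blast
        then show ?case using \<open>\<delta> > 0\<close> by simp
      qed
    qed
    then have "(\<lambda>n. exp (- ((s2 (time_var M Z n t\<^sub>0) / s2 n) * t\<^sup>2 / 2))) \<longlonglongrightarrow> exp (- (t\<^sub>0 * t\<^sup>2 / 2))"
      by (intro tendsto_intros) auto
    then have "(\<lambda>n. complex_of_real (exp (- ((s2 (time_var M Z n t\<^sub>0) / s2 n) * t\<^sup>2 / 2)))) \<longlonglongrightarrow> complex_of_real (exp (- (t\<^sub>0 * t\<^sup>2 / 2)))"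
      by (rule tendsto_of_real)
    moreover have "eventually (\<lambda>n. complex_of_real (exp (- ((s2 (time_var M Z n t\<^sub>0) / s2 n) * t\<^sup>2 / 2))) = char (distr M borel (?B n)) t) sequentially"
      using eventually_ge_at_top[of 1] by eventually_elim (simp add: char_B)
    ultimately show "(\<lambda>n. char (distr M borel (?B n)) t) \<longlonglongrightarrow> char ?L t"
      unfolding char_L by (rule Lim_transform_eventually)
  qed
  show "(\<lambda>n. prob {\<omega>\<in>space M. \<bar>student n (\<lambda>i. Z i \<omega>) t\<^sub>0 - ?B n \<omega>\<bar> > \<epsilon>}) \<longlonglongrightarrow> 0" if \<epsilon>: "\<epsilon> > 0" for \<epsilon>
  proof (rule tendsto_sandwich[OF _ _ tendsto_const student_close[OF \<epsilon>]])
    show "eventually (\<lambda>n. prob {\<omega>\<in>space M. \<bar>student n (\<lambda>i. Z i \<omega>) t\<^sub>0 - ?B n \<omega>\<bar> > \<epsilon>} \<le>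
      prob {\<omega>\<in>space M. \<exists>t\<in>{0..1}. deviation n t \<omega> > \<epsilon>}) sequentially"
    proof (intro always_eventually allI finite_measure_mono)
      fix n
      show "{\<omega>\<in>space M. \<bar>student n (\<lambda>i. Z i \<omega>) t\<^sub>0 - ?B n \<omega>\<bar> > \<epsilon>} \<subseteq>
        {\<omega>\<in>space M. \<exists>t\<in>{0..1}. deviation n t \<omega> > \<epsilon>}"
        using t0' by blast
    qed (rule student_distance_event)
  qed (auto simp: measure_nonneg)
qed

end

section \<open>The functional limit theorem\<close>

text \<open>The path with jumps \<open>y i\<close> along the clock \<open>\<kappa>\<close>. The
  normal sums and the sampled Wiener process are images of their increments under this same map, so
  only laws of increments have to be compared.\<close>

definition step_sum :: "(real \<Rightarrow> nat) \<Rightarrow> (nat \<Rightarrow> real) \<Rightarrow> real \<Rightarrow> real" where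
  "step_sum \<kappa> y t = (\<Sum>i<\<kappa> t. y i)"

text \<open>A uniform bound \<open>d\<close> strictly below \<open>\<delta>\<close> replaces a
  condition on the supremum: no boundedness is at stake, and the remaining slack gives
  openness.\<close>

definition sup_nbhd :: "(real \<Rightarrow> real) set \<Rightarrow> real \<Rightarrow> (real \<Rightarrow> real) set" where
  "sup_nbhd A \<delta> = {f. \<exists>g\<in>A. \<exists>d<\<delta>. \<forall>t\<in>{0..1}. \<bar>f t - g t\<bar> \<le> d}"

text \<open>
  A sup-norm neighbourhood of an arbitrary set need not belong to the projection \<open>\<sigma>\<close>-algebra, but
  its trace on step functions with finitely many jumps is open in the jump heights.
\<close>

lemma open_sup_nbhd_step_sum:
  assumes \<kappa>: "\<And>t. t \<in> {0..1} \<Longrightarrow> \<kappa> t \<le> n"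
  shows "open {y. step_sum \<kappa> y \<in> sup_nbhd A \<delta>}"
proof (rule Topological_Spaces.openI)
  fix y assume "y \<in> {y. step_sum \<kappa> y \<in> sup_nbhd A \<delta>}"
  then obtain g d where g: "g \<in> A" "d < \<delta>" "\<And>t. t \<in> {0..1} \<Longrightarrow> \<bar>step_sum \<kappa> y t - g t\<bar> \<le> d"
    unfolding sup_nbhd_def by blast
  \<comment> \<open>At most \<open>n\<close> jumps contribute, so moving each by
    \<open>\<eta>\<close> consumes at most half of the slack; \<open>n + 1\<close> avoids division
    by 0.\<close>
  define \<eta> where "\<eta> = (\<delta> - d) / (2 * (real n + 1))"
  have \<eta>: "\<eta> > 0" using g by (simp add: \<eta>_def)
  define U where "U = (\<Inter>i\<in>{..<n}. (\<lambda>x. x i) -` ball (y i) \<eta>)"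
  have "open U" unfolding U_def
    by (intro open_INT ballI open_vimage[OF open_ball continuous_on_product_coordinates]) auto
  moreover have "y \<in> U" using \<eta> by (simp add: U_def)
  moreover have "U \<subseteq> {y. step_sum \<kappa> y \<in> sup_nbhd A \<delta>}"
  proof (rule subsetI)
    fix x assume x: "x \<in> U"
    have "\<bar>step_sum \<kappa> x t - g t\<bar> \<le> d + (\<delta> - d) / 2" if t: "t \<in> {0..1}" for t
    proof -
      have "\<bar>step_sum \<kappa> x t - step_sum \<kappa> y t\<bar> = \<bar>\<Sum>i<\<kappa> t. x i - y i\<bar>"
        by (simp add: step_sum_def sum_subtractf)
      also have "\<dots> \<le> (\<Sum>i<\<kappa> t. \<bar>x i - y i\<bar>)" by (rule sum_abs)
      also have "\<dots> \<le> (\<Sum>i<\<kappa> t. \<eta>)"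
      proof (rule sum_mono)
        fix i assume "i \<in> {..<\<kappa> t}"
        then have "i \<in> {..<n}" using \<kappa>[OF t] by simp
        then have "x i \<in> ball (y i) \<eta>" using x unfolding U_def by blast
        then show "\<bar>x i - y i\<bar> \<le> \<eta>" by (simp add: dist_real_def abs_minus_commute)
      qed
      also have "\<dots> \<le> (real n + 1) * \<eta>" using \<kappa>[OF t] \<eta> by (simp add: mult_right_mono)
      also have "\<dots> = (\<delta> - d) / 2" by (simp add: \<eta>_def field_simps)
      finally show ?thesis using g(3)[OF t] by linarith
    qed
    moreover have "d + (\<delta> - d) / 2 < \<delta>" using g(2) by (simp add: field_simps)
    ultimately show "x \<in> {y. step_sum \<kappa> y \<in> sup_nbhd A \<delta>}" unfolding sup_nbhd_def using g(1) by blast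
  qed
  ultimately show "\<exists>T. open T \<and> y \<in> T \<and> T \<subseteq> {y. step_sum \<kappa> y \<in> sup_nbhd A \<delta>}"
    by blast
qed

lemma sup_nbhd_mono: "\<delta> \<le> \<delta>' \<Longrightarrow> sup_nbhd A \<delta> \<subseteq> sup_nbhd A \<delta>'"
  unfolding sup_nbhd_def by (blast intro: less_le_trans)

text \<open>Padding with zeros puts the finite families on sequences over all of \<open>nat\<close>,
  where the product sigma-algebra consists of the Borel sets of the product topology and so contains
  open sets of jump heights.\<close>

lemma (in prob_space) distr_indep_lessThan:
  fixes X :: "nat \<Rightarrow> 'a \<Rightarrow> real"
  assumes n: "n \<ge> 1" and ind: "indep_vars (\<lambda>_. borel) X {..<n}"
  shows "distr M (Pi\<^sub>M UNIV (\<lambda>_. borel)) (\<lambda>\<omega> i. if i < n then X i \<omega> else 0) =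
    distr (\<Pi>\<^sub>M i\<in>{..<n}. distr M borel (X i)) (Pi\<^sub>M UNIV (\<lambda>_. borel)) (\<lambda>z i. if i < n then z i else 0)"
proof -
  have X: "X i \<in> borel_measurable M" if "i < n" for i using indep_vars_rv[OF ind] that by auto
  have e: "(\<lambda>z i. if i < n then z i else 0) \<in> Pi\<^sub>M {..<n} (\<lambda>_. borel) \<rightarrow>\<^sub>M Pi\<^sub>M UNIV (\<lambda>_. borel :: real measure)"
  proof (rule measurable_abs_UNIV)
    show "(\<lambda>z. if i < n then z i else 0) \<in> Pi\<^sub>M {..<n} (\<lambda>_. borel) \<rightarrow>\<^sub>M (borel :: real measure)" for i
      by (cases "i < n") auto
  qed
  have r: "(\<lambda>\<omega>. \<lambda>i\<in>{..<n}. X i \<omega>) \<in> M \<rightarrow>\<^sub>M Pi\<^sub>M {..<n} (\<lambda>_. borel)"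
    using X by (intro measurable_restrict) auto
  have "(\<Pi>\<^sub>M i\<in>{..<n}. distr M borel (X i)) = distr M (Pi\<^sub>M {..<n} (\<lambda>_. borel)) (\<lambda>\<omega>. \<lambda>i\<in>{..<n}. X i \<omega>)"
    using ind X n by (subst (asm) indep_vars_iff_distr_eq_PiM') (auto simp: lessThan_empty_iff)
  then have "distr (\<Pi>\<^sub>M i\<in>{..<n}. distr M borel (X i)) (Pi\<^sub>M UNIV (\<lambda>_. borel)) (\<lambda>z i. if i < n then z i else 0) =
    distr M (Pi\<^sub>M UNIV (\<lambda>_. borel)) ((\<lambda>z i. if i < n then z i else 0) \<circ> (\<lambda>\<omega>. \<lambda>i\<in>{..<n}. X i \<omega>))"
    using distr_distr[OF e r] by simp
  also have "(\<lambda>z i. if i < n then z i else 0) \<circ> (\<lambda>\<omega>. \<lambda>i\<in>{..<n}. X i \<omega>) = (\<lambda>\<omega> i. if i < n then X i \<omega> else 0)"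
    by (auto simp: fun_eq_iff)
  finally show ?thesis by simp
qed

lemma wiener_path_measurable:
  assumes "wiener_process N W"
  shows "(\<lambda>\<omega>. \<lambda>t\<in>{0..1}. W t \<omega>) \<in> N \<rightarrow>\<^sub>M D01_algebra"
proof (rule path_measurable)
  show "(\<lambda>\<omega>. (\<lambda>t\<in>{0..1}. W t \<omega>) t) \<in> borel_measurable N" if "t \<in> {0..1}" for t
    using that assms unfolding wiener_process_def by simp
qed (use assms in \<open>auto simp: wiener_process_def\<close>)

context lindeberg_coupling
begin

lemma student_path_measurable: "(\<lambda>\<omega>. \<lambda>t\<in>{0..1}. student n (\<lambda>i. Z i \<omega>) t) \<in> M \<rightarrow>\<^sub>M D01_algebra"
proof (rule path_measurable)
  show "(\<lambda>\<omega>. (\<lambda>t\<in>{0..1}. student n (\<lambda>i. Z i \<omega>) t) t) \<in> borel_measurable M" if "t \<in> {0..1}" for t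
    using that student_measurable[where X=Z and t=t and n=n and M=M, OF rv] by simp
qed (rule student_path_D01)

text \<open>Both families are independent and centred normal with variances
  \<open>\<tau> (Suc i) - \<tau> i\<close>: the grid of the Wiener process is chosen to be the
  normalised variance clock.\<close>

lemma increments_same_law:
  assumes W: "wiener_process N W" and n: "n \<ge> 1"
  defines "\<tau> \<equiv> \<lambda>i. s2 i / s2 n"
  shows "distr M (Pi\<^sub>M UNIV (\<lambda>_. borel)) (\<lambda>\<omega> i. if i < n then sqrt (\<sigma>2 (Suc i)) * Y (Suc i) \<omega> / sqrt (s2 n) else 0) =
    distr N (Pi\<^sub>M UNIV (\<lambda>_. borel)) (\<lambda>\<omega> i. if i < n then W (\<tau> (Suc i)) \<omega> - W (\<tau> i) \<omega> else 0)"
    (is "distr M ?P (\<lambda>\<omega> i. if i < n then ?y i \<omega> else 0) = distr N ?P (\<lambda>\<omega> i. if i < n then ?w i \<omega> else 0)")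
proof -
  interpret N: prob_space N using W by (simp add: wiener_process_def)
  have s: "s2 n > 0" by (rule sum_var_pos[OF n])
  have \<tau>: "0 \<le> \<tau> i" "\<tau> i < \<tau> (Suc i)" for i
    using s sum_var_nonneg strict_monoD[OF sum_var_strict_mono, of i "Suc i"] by (auto simp: \<tau>_def divide_strict_right_mono)
  have \<tau>1: "\<tau> i \<le> 1" if "i \<le> n" for i using s sum_var_mono[OF that] by (simp add: \<tau>_def)
  have ind_w: "N.indep_vars (\<lambda>_. borel) ?w {..<n}"
  proof -
    have "mono_on {..n} \<tau>"
      using s by (auto simp: mono_on_def \<tau>_def intro!: divide_right_mono sum_var_mono)
    moreover have "\<tau> ` {..n} \<subseteq> {0..1}" using \<tau> \<tau>1 by auto
    ultimately show ?thesis using W unfolding wiener_process_def by blast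
  qed
  have ind_y: "indep_vars (\<lambda>_. borel) ?y {..<n}"
  proof -
    have d: "disjoint_family_on (\<lambda>i. {Suc i}) {..<n}" by (auto simp: disjoint_family_on_def)
    have "indep_vars (\<lambda>j. Pi\<^sub>M {Suc j} (\<lambda>_. borel)) (\<lambda>j \<omega>. restrict (\<lambda>i. Y i \<omega>) {Suc j}) {..<n}"
      by (rule indep_vars_restrict[OF Y_indep _ d]) auto
    from indep_vars_compose2[OF this, of "\<lambda>j x. sqrt (\<sigma>2 (Suc j)) * x (Suc j) / sqrt (s2 n)" "\<lambda>_. borel"]
    show ?thesis by simp
  qed
  have "distr M borel (?y i) = distr N borel (?w i)" if i: "i < n" for i
  proof -
    define v where "v = \<sigma>2 (Suc i)"
    have v: "v > 0" unfolding v_def by (rule variance_pos) simp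
    have "distributed M lborel (\<lambda>\<omega>. 0 + (sqrt v / sqrt (s2 n)) * Y (Suc i) \<omega>)
      (normal_density (0 + (sqrt v / sqrt (s2 n)) * 0) (\<bar>sqrt v / sqrt (s2 n)\<bar> * 1))"
      using v s by (intro normal_density_affine Y_normal) auto
    then have "distributed M lborel (?y i) (normal_density 0 (sqrt (v / s2 n)))"
      using v s by (simp add: v_def[symmetric] real_sqrt_divide)
    moreover have "distributed N lborel (?w i) (normal_density 0 (sqrt (\<tau> (Suc i) - \<tau> i)))"
      using W \<tau>[of i] \<tau>1[of "Suc i"] i unfolding wiener_process_def by auto
    moreover have "\<tau> (Suc i) - \<tau> i = v / s2 n"
      by (simp add: \<tau>_def v_def sum_var_Suc diff_divide_distrib[symmetric])
    ultimately show ?thesis by (simp add: distr_borel_distributed N.distr_borel_distributed)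
  qed
  then have "(\<Pi>\<^sub>M i\<in>{..<n}. distr M borel (?y i)) = (\<Pi>\<^sub>M i\<in>{..<n}. distr N borel (?w i))"
    by (intro PiM_cong) auto
  then show ?thesis
    unfolding distr_indep_lessThan[OF n ind_y] N.distr_indep_lessThan[OF n ind_w] by simp
qed

text \<open>The half of the portmanteau theorem for closed sets. If the Student path maps into
  \<open>F\<close>, the nearby normal step path lies in a neighbourhood of \<open>A\<close>, and
  this has the probability that \<open>W\<close>, sampled on the grid, lies there. As all samples
  come from one \<open>W\<close>, these probabilities are dominated by that of a limsup of events.
  On a continuous path in the limsup for all radii, elements of \<open>A\<close> come arbitrarily
  close, and continuity of \<open>h\<close> there together with closedness of \<open>F\<close> gives
  the claim.\<close>

lemma student_limsup_closed:
  fixes F :: "real set"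
  assumes W: "wiener_process N W" and h: "h \<in> borel_measurable D01_algebra"
    and cont: "AE f in distr N D01_algebra (\<lambda>\<omega>. \<lambda>t\<in>{0..1}. W t \<omega>). rho_continuous_at h f"
    and F: "closed F" and c: "c > 0"
  shows "eventually (\<lambda>n. prob {\<omega>\<in>space M. h (\<lambda>t\<in>{0..1}. student n (\<lambda>i. Z i \<omega>) t) \<in> F} <
    measure N {\<omega>\<in>space N. h (\<lambda>t\<in>{0..1}. W t \<omega>) \<in> F} + c) sequentially"
proof -
  interpret N: prob_space N using W by (simp add: wiener_process_def)
  define A where "A = {f\<in>D01. h f \<in> F}"
  define \<kappa> where "\<kappa> n = time_var M Z n" for n
  define \<tau> where "\<tau> n i = s2 i / s2 n" for n i
  define y where "y n \<omega> i = (if i < n then sqrt (\<sigma>2 (Suc i)) * Y (Suc i) \<omega> / sqrt (s2 n) else 0)" for n \<omega> i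
  define w where "w n \<omega> i = (if i < n then W (\<tau> n (Suc i)) \<omega> - W (\<tau> n i) \<omega> else 0)" for n \<omega> i
  define E where "E n \<delta> = {y. step_sum (\<kappa> n) y \<in> sup_nbhd A \<delta>}" for n \<delta>
  define V where "V n \<delta> = {\<omega>\<in>space N. w n \<omega> \<in> E n \<delta>}" for n \<delta>
  define X where "X n \<omega> = (\<lambda>t\<in>{0..1}. student n (\<lambda>i. Z i \<omega>) t)" for n \<omega>
  define H where "H = {\<omega>\<in>space N. h (\<lambda>t\<in>{0..1}. W t \<omega>) \<in> F}"
  have Wm: "W t \<in> borel_measurable N" if "t \<in> {0..1}" for t using W that by (simp add: wiener_process_def)
  have \<kappa>: "\<kappa> n t \<le> n" if "t \<in> {0..1}" for n t unfolding \<kappa>_def by (rule time_var_le[OF that])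
  have \<tau>01: "\<tau> n i \<in> {0..1}" if "i \<le> n" for n i
  proof (cases "n = 0")
    case True then show ?thesis using that by (simp add: \<tau>_def sum_var_0)
  next
    case False
    then have "s2 n > 0" by (intro sum_var_pos) simp
    then show ?thesis using that sum_var_mono[OF that] sum_var_nonneg[of i] by (simp add: \<tau>_def)
  qed
  have E_sets: "E n \<delta> \<in> sets (Pi\<^sub>M UNIV (\<lambda>_. borel))" for n \<delta>
    unfolding E_def sets_PiM_equal_borel using open_sup_nbhd_step_sum[of "\<kappa> n" n, OF \<kappa>] by (rule borel_open)
  have y_meas: "y n \<in> M \<rightarrow>\<^sub>M Pi\<^sub>M UNIV (\<lambda>_. borel)" for n
  proof (rule measurable_abs_UNIV[of "\<lambda>i \<omega>. y n \<omega> i", simplified])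
    show "(\<lambda>\<omega>. y n \<omega> i) \<in> borel_measurable M" for i
      using Y_rv[of "Suc i"] by (cases "i < n") (auto simp: y_def)
  qed
  have w_meas: "w n \<in> N \<rightarrow>\<^sub>M Pi\<^sub>M UNIV (\<lambda>_. borel)" for n
  proof (rule measurable_abs_UNIV[of "\<lambda>i \<omega>. w n \<omega> i", simplified])
    show "(\<lambda>\<omega>. w n \<omega> i) \<in> borel_measurable N" for i
      using Wm[OF \<tau>01[of "Suc i" n]] Wm[OF \<tau>01[of i n]] by (cases "i < n") (auto simp: w_def)
  qed
  have V_ev: "V n \<delta> \<in> sets N" for n \<delta>
    using measurable_sets[OF w_meas E_sets, of n n \<delta>] by (simp add: V_def vimage_def Int_def conj_commute)
  have yE_ev: "{\<omega>\<in>space M. y n \<omega> \<in> E n \<delta>} \<in> events" for n \<delta>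
    using measurable_sets[OF y_meas E_sets, of n n \<delta>] by (simp add: vimage_def Int_def conj_commute)
  have law: "prob {\<omega>\<in>space M. y n \<omega> \<in> E n \<delta>} = N.prob (V n \<delta>)" if n: "n \<ge> 1" for n \<delta>
  proof -
    have eq: "distr M (Pi\<^sub>M UNIV (\<lambda>_. borel)) (y n) = distr N (Pi\<^sub>M UNIV (\<lambda>_. borel)) (w n)"
      unfolding y_def w_def \<tau>_def by (rule increments_same_law[OF W n])
    have "prob {\<omega>\<in>space M. y n \<omega> \<in> E n \<delta>} = measure (distr M (Pi\<^sub>M UNIV (\<lambda>_. borel)) (y n)) (E n \<delta>)"
      using measure_distr[OF y_meas E_sets] by (simp add: vimage_def Int_def conj_commute)
    also have "\<dots> = N.prob (V n \<delta>)"
      unfolding eq V_def using measure_distr[OF w_meas E_sets] by (simp add: vimage_def Int_def conj_commute)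
    finally show ?thesis .
  qed
  have step_y: "step_sum (\<kappa> n) (y n \<omega>) t = G (\<kappa> n t) \<omega> / sqrt (s2 n)" if t: "t \<in> {0..1}" for n \<omega> t
  proof -
    have "step_sum (\<kappa> n) (y n \<omega>) t = (\<Sum>i<\<kappa> n t. sqrt (\<sigma>2 (Suc i)) * Y (Suc i) \<omega> / sqrt (s2 n))"
      unfolding step_sum_def using \<kappa>[OF t, of n] by (intro sum.cong) (auto simp: y_def)
    then show ?thesis by (simp add: G_def sum.atLeast1_atMost_eq sum_divide_distrib)
  qed
  \<comment> \<open>The starting value \<open>W 0\<close> has to be kept, because it vanishes only
    almost surely.\<close>
  have step_w: "step_sum (\<kappa> n) (w n \<omega>) t = W (\<tau> n (\<kappa> n t)) \<omega> - W 0 \<omega>" if t: "t \<in> {0..1}" for n \<omega> t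
  proof -
    have "step_sum (\<kappa> n) (w n \<omega>) t = (\<Sum>i<\<kappa> n t. W (\<tau> n (Suc i)) \<omega> - W (\<tau> n i) \<omega>)"
      unfolding step_sum_def using \<kappa>[OF t, of n] by (intro sum.cong) (auto simp: w_def)
    also have "\<dots> = W (\<tau> n (\<kappa> n t)) \<omega> - W (\<tau> n 0) \<omega>" by (rule sum_lessThan_telescope)
    finally show ?thesis by (simp add: \<tau>_def sum_var_0)
  qed
  have X_D01: "X n \<omega> \<in> D01" for n \<omega> unfolding X_def by (rule student_path_D01)
  have upper: "prob {\<omega>\<in>space M. h (X n \<omega>) \<in> F} \<le>
    prob {\<omega>\<in>space M. \<exists>t\<in>{0..1}. deviation n t \<omega> > \<delta> / 2} + N.prob (V n \<delta>)"
    if n: "n \<ge> 1" and \<delta>: "\<delta> > 0" for n \<delta>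
  proof -
    let ?B = "{\<omega>\<in>space M. \<exists>t\<in>{0..1}. deviation n t \<omega> > \<delta> / 2}"
    have "{\<omega>\<in>space M. h (X n \<omega>) \<in> F} \<subseteq> ?B \<union> {\<omega>\<in>space M. y n \<omega> \<in> E n \<delta>}"
    proof
      fix \<omega> assume w: "\<omega> \<in> {\<omega>\<in>space M. h (X n \<omega>) \<in> F}"
      show "\<omega> \<in> ?B \<union> {\<omega>\<in>space M. y n \<omega> \<in> E n \<delta>}"
      proof (cases "\<omega> \<in> ?B")
        case False
        have "\<bar>step_sum (\<kappa> n) (y n \<omega>) t - X n \<omega> t\<bar> \<le> \<delta> / 2" if t: "t \<in> {0..1}" for t
        proof -
          have "deviation n t \<omega> \<le> \<delta> / 2"
            using False w t by force
          then show ?thesis unfolding step_y[OF t] using t by (simp add: X_def \<kappa>_def abs_minus_commute)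
        qed
        moreover have "X n \<omega> \<in> A" using w X_D01 by (simp add: A_def)
        moreover have "\<delta> / 2 < \<delta>" using \<delta> by simp
        ultimately have "y n \<omega> \<in> E n \<delta>" unfolding E_def sup_nbhd_def by blast
        then show ?thesis using w by simp
      qed simp
    qed
    then have "prob {\<omega>\<in>space M. h (X n \<omega>) \<in> F} \<le> prob (?B \<union> {\<omega>\<in>space M. y n \<omega> \<in> E n \<delta>})"
      by (intro finite_measure_mono sets.Un student_distance_event yE_ev)
    also have "\<dots> \<le> prob ?B + prob {\<omega>\<in>space M. y n \<omega> \<in> E n \<delta>}"
      by (intro measure_Un_le student_distance_event yE_ev)
    finally show ?thesis by (simp add: law[OF n])
  qed
  \<comment> \<open>\<open>J j\<close> is the limsup over \<open>n\<close> of the events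
    \<open>V n\<close> with radius \<open>1 / (j + 1)\<close>. A sequence of radii keeps all
    operations countable and hence measurable.\<close>
  define U where "U m \<delta> = (\<Union>n\<in>{m..}. V n \<delta>)" for m \<delta>
  define J where "J j = (\<Inter>m. U m (1 / real (Suc j)))" for j
  have U_ev: "U m \<delta> \<in> sets N" for m \<delta> unfolding U_def using V_ev by auto
  have J_ev: "J j \<in> sets N" for j unfolding J_def using U_ev by auto
  have U_lim: "(\<lambda>m. N.prob (U m (1 / real (Suc j)))) \<longlonglongrightarrow> N.prob (J j)" for j
    unfolding J_def
  proof (intro N.finite_Lim_measure_decseq)
    show "decseq (\<lambda>m. U m (1 / real (Suc j)))"
      unfolding decseq_def U_def by (intro allI impI UN_mono) auto
  qed (use U_ev in auto)
  have V_mono: "V n \<delta> \<subseteq> V n \<delta>'" if "\<delta> \<le> \<delta>'" for n \<delta> \<delta>'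
    unfolding V_def E_def using sup_nbhd_mono[OF that] by blast
  have J_lim: "(\<lambda>j. N.prob (J j)) \<longlonglongrightarrow> N.prob (\<Inter>j. J j)"
  proof (intro N.finite_Lim_measure_decseq)
    show "decseq J" unfolding decseq_def
    proof (intro allI impI)
      fix i j :: nat assume "i \<le> j"
      then have "1 / real (Suc j) \<le> 1 / real (Suc i)" by (simp add: frac_le)
      from V_mono[OF this] show "J j \<subseteq> J i" unfolding J_def U_def by blast
    qed
  qed (use J_ev in auto)
  have path_m: "(\<lambda>\<omega>. \<lambda>t\<in>{0..1}. W t \<omega>) \<in> N \<rightarrow>\<^sub>M D01_algebra" by (rule wiener_path_measurable[OF W])
  have H_ev: "H \<in> sets N"
  proof -
    have "(\<lambda>\<omega>. h (\<lambda>t\<in>{0..1}. W t \<omega>)) \<in> borel_measurable N" by (rule measurable_compose[OF path_m h])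
    from measurable_sets[OF this borel_closed[OF F]] show ?thesis
      by (simp add: H_def vimage_def Int_def conj_commute)
  qed
  have "AE \<omega> in N. rho_continuous_at h (\<lambda>t\<in>{0..1}. W t \<omega>)" by (rule AE_distrD[OF path_m cont])
  moreover have "AE \<omega> in N. W 0 \<omega> = 0" "AE \<omega> in N. continuous_on {0..1} (\<lambda>t. W t \<omega>)"
    using W by (auto simp: wiener_process_def)
  ultimately have JH: "AE \<omega> in N. \<omega> \<in> (\<Inter>j. J j) \<longrightarrow> \<omega> \<in> H"
    using AE_space
  proof eventually_elim
    case (elim \<omega>)
    let ?W = "\<lambda>t\<in>{0..1}. W t \<omega>"
    show ?case
    proof (intro impI; rule ccontr)
      assume in_J: "\<omega> \<in> (\<Inter>j. J j)" and "\<omega> \<notin> H"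
      then have "h ?W \<in> - F" using elim(4) by (simp add: H_def)
      then obtain e where e: "e > 0" "ball (h ?W) e \<subseteq> - F"
        using F open_contains_ball[of "- F"] by (auto simp: closed_def)
      obtain d where d: "d > 0" "\<And>g. g \<in> D01 \<Longrightarrow> rho g ?W < d \<Longrightarrow> \<bar>h g - h ?W\<bar> < e"
        using elim(1) e(1) unfolding rho_continuous_at_def by blast
      have "uniformly_continuous_on {0..1} (\<lambda>t. W t \<omega>)"
        using elim(3) by (rule compact_uniformly_continuous) simp
      then obtain b where b: "b > 0" "\<And>t u. t \<in> {0..1} \<Longrightarrow> u \<in> {0..1} \<Longrightarrow> dist u t < b \<Longrightarrow> dist (W u \<omega>) (W t \<omega>) < d / 4"
        unfolding uniformly_continuous_on_def using d(1) by (metis zero_less_divide_iff zero_less_numeral)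
      have "eventually (\<lambda>n. \<forall>t\<in>{0..1}. \<bar>s2 (time_var M Z n t) / s2 n - t\<bar> \<le> b / 2) sequentially"
        using b by (intro time_var_uniform) auto
      then obtain m where m: "\<And>n t. n \<ge> m \<Longrightarrow> t \<in> {0..1} \<Longrightarrow> \<bar>\<tau> n (\<kappa> n t) - t\<bar> \<le> b / 2"
        unfolding eventually_sequentially \<tau>_def \<kappa>_def by blast
      obtain j where j: "1 / real (Suc j) < d / 2"
        using reals_Archimedean[of "d / 2"] d by (auto simp: inverse_eq_divide)
      have "\<omega> \<in> U m (1 / real (Suc j))" using in_J by (auto simp: J_def)
      then obtain n where n: "n \<ge> m" "\<omega> \<in> V n (1 / real (Suc j))" by (auto simp: U_def)
      then obtain g d' where g: "g \<in> A" "d' < 1 / real (Suc j)"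
        "\<And>t. t \<in> {0..1} \<Longrightarrow> \<bar>step_sum (\<kappa> n) (w n \<omega>) t - g t\<bar> \<le> d'"
        unfolding V_def E_def sup_nbhd_def by blast
      \<comment> \<open>The radius accounts for \<open>d / 2\<close> and the sampling on the grid
        for \<open>d / 4\<close>; what is left of \<open>d\<close> makes the inequality for
        \<open>rho\<close> strict.\<close>
      have "\<bar>g t - ?W t\<bar> \<le> 3 / 4 * d" if t: "t \<in> {0..1}" for t
      proof -
        have "dist (\<tau> n (\<kappa> n t)) t < b" using m[OF n(1) t] b(1) by (simp add: dist_real_def)
        then have "dist (W (\<tau> n (\<kappa> n t)) \<omega>) (W t \<omega>) < d / 4" by (rule b(2)[OF t \<tau>01[OF \<kappa>[OF t]]])
        then have "\<bar>step_sum (\<kappa> n) (w n \<omega>) t - W t \<omega>\<bar> < d / 4"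
          by (simp add: step_w[OF t] elim(2) dist_real_def)
        then have "\<bar>g t - W t \<omega>\<bar> \<le> 3 / 4 * d" using g(3)[OF t] g(2) j by linarith
        then show ?thesis using t by simp
      qed
      then have "rho g ?W \<le> 3 / 4 * d" unfolding rho_def by (intro cSUP_least) auto
      then have "rho g ?W < d" using d(1) by simp
      moreover have "g \<in> D01" "h g \<in> F" using g(1) by (auto simp: A_def)
      ultimately have "\<bar>h g - h ?W\<bar> < e" using d(2) by blast
      then have "h g \<in> - F" using e(2) by (auto simp: dist_real_def abs_minus_commute)
      then show False using \<open>h g \<in> F\<close> by simp
    qed
  qed
  have PJ: "N.prob (\<Inter>j. J j) \<le> N.prob H"
    by (rule N.finite_measure_mono_AE[OF JH H_ev])
  have "eventually (\<lambda>j. N.prob (J j) < N.prob H + c / 3) sequentially"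
    using order_tendstoD(2)[OF J_lim, of "N.prob H + c / 3"] PJ c by simp
  then obtain j where j: "N.prob (J j) < N.prob H + c / 3" by (auto simp: eventually_sequentially)
  define \<delta> where "\<delta> = 1 / real (Suc j)"
  have \<delta>: "\<delta> > 0" by (simp add: \<delta>_def)
  have "eventually (\<lambda>m. N.prob (U m \<delta>) < N.prob (J j) + c / 3) sequentially"
    using order_tendstoD(2)[OF U_lim, of j "N.prob (J j) + c / 3"] c by (simp add: \<delta>_def)
  then obtain m where m: "N.prob (U m \<delta>) < N.prob (J j) + c / 3" by (auto simp: eventually_sequentially)
  have "eventually (\<lambda>n. prob {\<omega>\<in>space M. \<exists>t\<in>{0..1}. deviation n t \<omega> > \<delta> / 2} < c / 3) sequentially"
    using order_tendstoD(2)[OF student_close[of "\<delta> / 2"], of "c / 3"] \<delta> c by simp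
  then show ?thesis
    using eventually_ge_at_top[of "max 1 m"]
  proof eventually_elim
    case (elim n)
    have n: "n \<ge> 1" "n \<ge> m" using elim(2) by auto
    have "N.prob (V n \<delta>) \<le> N.prob (U m \<delta>)"
      using n U_ev by (intro N.finite_measure_mono) (auto simp: U_def)
    then show ?case using upper[OF n(1) \<delta>] elim(1) m j unfolding X_def H_def by simp
  qed
qed

text \<open>The bound for closed sets is used for \<open>{..x}\<close> and for \<open>{x..}\<close>,
  which brackets the distribution function from both sides. At a continuity point the two sets
  overlap in a null event of the limit law.\<close>

lemma student_fclt:
  assumes W: "wiener_process N W"
  shows "conv_distr_D01 M (\<lambda>n \<omega>. \<lambda>t\<in>{0..1}. student n (\<lambda>i. Z i \<omega>) t) N (\<lambda>\<omega>. \<lambda>t\<in>{0..1}. W t \<omega>)"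
  unfolding conv_distr_D01_def weak_conv_m_def weak_conv_def
proof (intro ballI impI allI)
  fix h x
  assume h: "h \<in> borel_measurable D01_algebra"
    and cont: "AE f in distr N D01_algebra (\<lambda>\<omega>. \<lambda>t\<in>{0..1}. W t \<omega>). rho_continuous_at h f"
  let ?X = "\<lambda>n \<omega>. h (\<lambda>t\<in>{0..1}. student n (\<lambda>i. Z i \<omega>) t)"
  let ?W = "\<lambda>\<omega>. h (\<lambda>t\<in>{0..1}. W t \<omega>)"
  interpret N: prob_space N using W by (simp add: wiener_process_def)
  have Xm[measurable]: "?X n \<in> borel_measurable M" for n
    by (rule measurable_compose[OF student_path_measurable h])
  have Wm[measurable]: "?W \<in> borel_measurable N"
    by (rule measurable_compose[OF wiener_path_measurable[OF W] h])
  interpret D: real_distribution "distr N borel ?W" using Wm by (rule N.real_distribution_distr)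
  assume "isCont (cdf (distr N borel ?W)) x"
  then have zero: "N.prob {\<omega>\<in>space N. ?W \<omega> = x} = 0"
    by (simp add: D.isCont_cdf measure_distr vimage_def Int_def conj_commute)
  have cdfX: "cdf (distr M borel (?X n)) x = prob {\<omega>\<in>space M. ?X n \<omega> \<in> {..x}}" for n
    by (simp add: cdf_def measure_distr vimage_def Int_def conj_commute)
  have cdfW: "cdf (distr N borel ?W) x = N.prob {\<omega>\<in>space N. ?W \<omega> \<in> {..x}}"
    by (simp add: cdf_def measure_distr vimage_def Int_def conj_commute)
  have geW: "N.prob {\<omega>\<in>space N. ?W \<omega> \<in> {x..}} = 1 - N.prob {\<omega>\<in>space N. ?W \<omega> \<in> {..x}}"
  proof -
    have "N.prob {\<omega>\<in>space N. ?W \<omega> \<in> {x..}} + N.prob {\<omega>\<in>space N. ?W \<omega> < x} = N.prob (space N)"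
      by (subst N.finite_measure_Union[symmetric]) (auto intro!: arg_cong[where f=N.prob])
    moreover have "N.prob {\<omega>\<in>space N. ?W \<omega> \<in> {..x}} = N.prob {\<omega>\<in>space N. ?W \<omega> < x} + N.prob {\<omega>\<in>space N. ?W \<omega> = x}"
      by (subst N.finite_measure_Union[symmetric]) (auto intro!: arg_cong[where f=N.prob])
    ultimately show ?thesis by (simp add: zero N.prob_space)
  qed
  have geX: "1 - prob {\<omega>\<in>space M. ?X n \<omega> \<in> {x..}} \<le> prob {\<omega>\<in>space M. ?X n \<omega> \<in> {..x}}" for n
  proof -
    have "prob (space M) \<le> prob ({\<omega>\<in>space M. ?X n \<omega> \<in> {x..}} \<union> {\<omega>\<in>space M. ?X n \<omega> \<in> {..x}})"
      by (intro finite_measure_mono) auto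
    also have "\<dots> \<le> prob {\<omega>\<in>space M. ?X n \<omega> \<in> {x..}} + prob {\<omega>\<in>space M. ?X n \<omega> \<in> {..x}}"
      by (intro measure_Un_le) auto
    finally show ?thesis by (simp add: prob_space)
  qed
  show "(\<lambda>n. cdf (distr M borel (?X n)) x) \<longlonglongrightarrow> cdf (distr N borel ?W) x"
  proof (rule LIMSEQ_eventuallyI)
    fix c :: real assume c: "c > 0"
    show "eventually (\<lambda>n. norm (cdf (distr M borel (?X n)) x - cdf (distr N borel ?W) x) < c) sequentially"
      using student_limsup_closed[OF W h cont closed_atMost c, of x] student_limsup_closed[OF W h cont closed_atLeast c, of x]
    proof eventually_elim
      case (elim n)
      then show ?case using geX[of n] geW unfolding cdfX cdfW by (simp add: abs_less_iff)
    qed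
  qed
qed

end

section \<open>Transfer to the original space and to pairs of sequences\<close>

lemma student_restrict: "student n (\<lambda>i\<in>{1..}. z i) t = student n z t"
  by (simp add: student_def time_data_def sample_mean_def cong: sum.cong_simp)

theorem theorem1:
  fixes M :: "'a measure" and Z :: "nat \<Rightarrow> 'a \<Rightarrow> real"
  assumes "prob_space M"
    and "prob_space.indep_vars M (\<lambda>_. borel) Z {1..}"
    and "\<And>i. i \<ge> 1 \<Longrightarrow> integrable M (Z i)"
    and "\<And>i. i \<ge> 1 \<Longrightarrow> prob_space.expectation M (Z i) = 0"
    and "\<And>i. i \<ge> 1 \<Longrightarrow> integrable M (\<lambda>\<omega>. (Z i \<omega>)\<^sup>2)"
    and "\<And>i. i \<ge> 1 \<Longrightarrow> prob_space.variance M (Z i) > 0"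
    and "lindeberg M Z"
  shows
    "(\<forall>t\<^sub>0\<in>{0<..1}.
        weak_conv_m (\<lambda>n. distr M borel (\<lambda>\<omega>. student n (\<lambda>i. Z i \<omega>) t\<^sub>0))
                    (density lborel (normal_density 0 (sqrt t\<^sub>0)))) \<and>
     (\<forall>(N :: 'b measure) W. wiener_process N W \<longrightarrow>
        conv_distr_D01 M (\<lambda>n \<omega>. \<lambda>t\<in>{0..1}. student n (\<lambda>i. Z i \<omega>) t)
                       N (\<lambda>\<omega>. \<lambda>t\<in>{0..1}. W t \<omega>)) \<and>
     (\<exists>(N :: ((nat \<Rightarrow> real) \<times> (nat \<Rightarrow> real)) measure)
         (Z' :: nat \<Rightarrow> (nat \<Rightarrow> real) \<times> (nat \<Rightarrow> real) \<Rightarrow> real)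
         (Y :: nat \<Rightarrow> (nat \<Rightarrow> real) \<times> (nat \<Rightarrow> real) \<Rightarrow> real).
        prob_space N \<and>
        (\<forall>i\<ge>1. Z' i \<in> borel_measurable N) \<and>
        distr N (Pi\<^sub>M {1..} (\<lambda>_. borel)) (\<lambda>\<omega>. \<lambda>i\<in>{1..}. Z' i \<omega>) =
          distr M (Pi\<^sub>M {1..} (\<lambda>_. borel)) (\<lambda>\<omega>. \<lambda>i\<in>{1..}. Z i \<omega>) \<and>
        prob_space.indep_vars N (\<lambda>_. borel) Y {1..} \<and>
        (\<forall>i\<ge>1. distributed N lborel (Y i) std_normal_density) \<and>
        conv_prob_0 N (\<lambda>n \<omega>. SUP t\<in>{0..1}.
           \<bar>student n (\<lambda>i. Z' i \<omega>) t -
            (\<Sum>i=1..time_var M Z n t. sqrt (prob_space.variance M (Z i)) * Y i \<omega>)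
              / sqrt (sum_var M Z n)\<bar>))"
proof -
  interpret prob_space M by fact
  interpret lindeberg_sequence M Z by unfold_locales (use assms in auto)
  obtain N :: "(nat \<Rightarrow> (nat \<Rightarrow> real) \<times> (nat \<Rightarrow> real)) measure" and Z' Y r \<eta>
    where NC: "lindeberg_coupling N Z' Y r \<eta>"
    and law: "distr N (Pi\<^sub>M {1..} (\<lambda>_. borel)) (\<lambda>\<omega>. \<lambda>i\<in>{1..}. Z' i \<omega>) =
     distr M (Pi\<^sub>M {1..} (\<lambda>_. borel)) (\<lambda>\<omega>. \<lambda>i\<in>{1..}. Z i \<omega>)"
    and var: "\<And>i. i \<ge> 1 \<Longrightarrow> prob_space.variance N (Z' i) = variance (Z i)"
    and sv: "sum_var N Z' = sum_var M Z"
    by (rule coupling_space) blast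
  interpret C: lindeberg_coupling N Z' Y r \<eta> by (rule NC)
  let ?P = "Pi\<^sub>M {1::nat..} (\<lambda>_. borel :: real measure)"
  have Zseq: "(\<lambda>\<omega>. \<lambda>i\<in>{1..}. Z i \<omega>) \<in> M \<rightarrow>\<^sub>M ?P" and Z'seq: "(\<lambda>\<omega>. \<lambda>i\<in>{1..}. Z' i \<omega>) \<in> N \<rightarrow>\<^sub>M ?P"
    using rv C.rv by (auto intro!: measurable_restrict)
  \<comment> \<open>Claims (a) and (b) concern laws of functionals of the sequence only, so it
    suffices to prove them for the copy on \<open>N\<close>.\<close>
  have transfer_law: "distr M borel (\<lambda>\<omega>. \<Psi> (\<lambda>i\<in>{1..}. Z i \<omega>)) = distr N borel (\<lambda>\<omega>. \<Psi> (\<lambda>i\<in>{1..}. Z' i \<omega>))"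
    if "\<Psi> \<in> borel_measurable ?P" for \<Psi> :: "(nat \<Rightarrow> real) \<Rightarrow> real"
    using distr_distr[OF that Zseq] distr_distr[OF that Z'seq] law by (simp add: comp_def)
  have coord: "(\<lambda>z. student n z t) \<in> borel_measurable ?P" if "t \<in> {0..1}" for n t
    using student_measurable[where X="\<lambda>i z. z i" and M="?P" and t=t and n=n] that by simp
  have a: "weak_conv_m (\<lambda>n. distr M borel (\<lambda>\<omega>. student n (\<lambda>i. Z i \<omega>) t\<^sub>0))
      (density lborel (normal_density 0 (sqrt t\<^sub>0)))" if "t\<^sub>0 \<in> {0<..1}" for t\<^sub>0
  proof -
    have "distr M borel (\<lambda>\<omega>. student n (\<lambda>i. Z i \<omega>) t\<^sub>0) = distr N borel (\<lambda>\<omega>. student n (\<lambda>i. Z' i \<omega>) t\<^sub>0)" for n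
      using transfer_law[OF coord, of t\<^sub>0 n] that by (simp only: student_restrict) simp
    then show ?thesis using C.student_clt[OF that] by simp
  qed
  have b: "conv_distr_D01 M (\<lambda>n \<omega>. \<lambda>t\<in>{0..1}. student n (\<lambda>i. Z i \<omega>) t) N' (\<lambda>\<omega>. \<lambda>t\<in>{0..1}. W t \<omega>)"
    if W: "wiener_process N' W" for N' :: "'b measure" and W
    unfolding conv_distr_D01_def
  proof (intro ballI impI)
    fix h assume h: "h \<in> borel_measurable D01_algebra"
      and cont: "AE f in distr N' D01_algebra (\<lambda>\<omega>. \<lambda>t\<in>{0..1}. W t \<omega>). rho_continuous_at h f"
    have "(\<lambda>z. \<lambda>t\<in>{0..1}. student n z t) \<in> ?P \<rightarrow>\<^sub>M D01_algebra" for n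
      using coord by (intro path_measurable student_path_D01) auto
    from transfer_law[OF measurable_compose[OF this h]]
    have "distr M borel (\<lambda>\<omega>. h (\<lambda>t\<in>{0..1}. student n (\<lambda>i. Z i \<omega>) t)) =
      distr N borel (\<lambda>\<omega>. h (\<lambda>t\<in>{0..1}. student n (\<lambda>i. Z' i \<omega>) t))" for n
      by (simp only: student_restrict)
    then show "weak_conv_m (\<lambda>n. distr M borel (\<lambda>\<omega>. h (\<lambda>t\<in>{0..1}. student n (\<lambda>i. Z i \<omega>) t)))
      (distr N' borel (\<lambda>\<omega>. h (\<lambda>t\<in>{0..1}. W t \<omega>)))"
      using C.student_fclt[OF W] h cont unfolding conv_distr_D01_def by simp
  qed
  let ?U = "Pi\<^sub>M (UNIV :: nat set) (\<lambda>_. borel :: real measure)"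
  \<comment> \<open>The coupling space has one pair of sequences for every block, whereas the claim
    asks for a single pair; the joint law of \<open>Z'\<close> and \<open>Y\<close> is pushed
    forward. The value 0 at index 0 makes all coordinates measurable.\<close>
  define \<Phi> where "\<Phi> \<omega> = ((\<lambda>i. if i \<ge> 1 then Z' i \<omega> else 0), (\<lambda>i. if i \<ge> 1 then Y i \<omega> else 0))" for \<omega>
  have \<Phi>: "\<Phi> \<in> N \<rightarrow>\<^sub>M ?U \<Otimes>\<^sub>M ?U"
    unfolding \<Phi>_def
  proof (intro measurable_Pair measurable_abs_UNIV)
    show "(\<lambda>\<omega>. if i \<ge> 1 then Z' i \<omega> else 0) \<in> borel_measurable N" for i
      using C.rv[of i] by (cases "i \<ge> 1") auto
    show "(\<lambda>\<omega>. if i \<ge> 1 then Y i \<omega> else 0) \<in> borel_measurable N" for i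
      using C.Y_rv[of i] by (cases "i \<ge> 1") auto
  qed
  define Q where "Q = distr N (?U \<Otimes>\<^sub>M ?U) \<Phi>"
  interpret Q: prob_space Q unfolding Q_def by (rule C.prob_space_distr[OF \<Phi>])
  have sQ: "sets Q = sets (?U \<Otimes>\<^sub>M ?U)" by (simp add: Q_def)
  have Z''m: "(\<lambda>x. fst x i) \<in> borel_measurable (?U \<Otimes>\<^sub>M ?U)" and Y''m: "(\<lambda>x. snd x i) \<in> borel_measurable (?U \<Otimes>\<^sub>M ?U)" for i
    by measurable
  have Z''Q: "(\<lambda>x. fst x i) \<in> borel_measurable Q" and Y''Q: "(\<lambda>x. snd x i) \<in> borel_measurable Q" for i
    using Z''m Y''m by (simp_all add: measurable_cong_sets[OF sQ refl])
  have Z_law: "distr Q ?P (\<lambda>x. \<lambda>i\<in>{1..}. fst x i) = distr M ?P (\<lambda>\<omega>. \<lambda>i\<in>{1..}. Z i \<omega>)"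
  proof -
    have m: "(\<lambda>x. \<lambda>i\<in>{1..}. fst x i) \<in> ?U \<Otimes>\<^sub>M ?U \<rightarrow>\<^sub>M ?P" by (intro measurable_restrict Z''m)
    have "(\<lambda>x. \<lambda>i\<in>{1..}. fst x i) \<circ> \<Phi> = (\<lambda>\<omega>. \<lambda>i\<in>{1..}. Z' i \<omega>)" by (auto simp: \<Phi>_def fun_eq_iff)
    then show ?thesis using distr_distr[OF m \<Phi>] law by (simp add: Q_def)
  qed
  have Y_ind: "Q.indep_vars (\<lambda>_. borel) (\<lambda>i x. snd x i) {1..}"
    unfolding Q_def
  proof (subst C.indep_vars_distr_iff[OF _ \<Phi>])
    show "C.indep_vars (\<lambda>_. borel) (\<lambda>i \<omega>. snd (\<Phi> \<omega>) i) {1..}"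
      using C.Y_indep by (rule C.indep_vars_cong[THEN iffD1, rotated 3]) (auto simp: \<Phi>_def)
  qed (use Y''m in auto)
  have Y_dist: "distributed Q lborel (\<lambda>x. snd x i) std_normal_density" if "i \<ge> 1" for i
  proof -
    have m: "(\<lambda>x. snd x i) \<in> ?U \<Otimes>\<^sub>M ?U \<rightarrow>\<^sub>M lborel" using Y''m by simp
    have "(\<lambda>x. snd x i) \<circ> \<Phi> = Y i" using that by (auto simp: \<Phi>_def fun_eq_iff)
    then have "distr Q lborel (\<lambda>x. snd x i) = distr N lborel (Y i)"
      using distr_distr[OF m \<Phi>] by (simp add: Q_def)
    then show ?thesis using C.Y_normal[OF that] Y''Q by (simp add: distributed_def)
  qed
  define g where "g n k x = (\<Sum>i=1..k. sqrt (variance (Z i)) * snd x i) / sqrt (sum_var M Z n)"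
    for n k and x :: "(nat \<Rightarrow> real) \<times> (nat \<Rightarrow> real)"
  define R where "R n x = (SUP t\<in>{0..1}. \<bar>student n (\<lambda>i. fst x i) t - g n (time_index n (sum_var M Z) t) x\<bar>)" for n x
  have gm: "g n k \<in> borel_measurable Q" for n k
    unfolding g_def using Y''Q by (intro borel_measurable_divide borel_measurable_sum borel_measurable_times) auto
  note R = student_distance_measurable[where X="\<lambda>i x. fst x i" and M=Q and G="g n" and s="sum_var M Z" and n=n for n]
    student_distance_less[where X="\<lambda>i x. fst x i" and M=Q and G="g n" and s="sum_var M Z" and n=n for n]
    student_distance_nonneg[where X="\<lambda>i x. fst x i" and M=Q and G="g n" and s="sum_var M Z" and n=n for n]
  note R = R[OF Z''Q gm sum_var_0 sum_var_nonneg, folded R_def]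
  have "conv_prob_0 Q R"
    unfolding conv_prob_0_def
  proof (intro conjI allI impI)
    show "R n \<in> borel_measurable Q" for n using R(1)[of n] by (simp add: R_def[abs_def])
    then have ev: "{x\<in>space Q. \<bar>R n x\<bar> > \<epsilon>} \<in> sets (?U \<Otimes>\<^sub>M ?U)" for n \<epsilon> unfolding sQ[symmetric] by measurable
    fix \<epsilon> :: real assume \<epsilon>: "\<epsilon> > 0"
    \<comment> \<open>Pulled back along \<open>\<Phi>\<close>, the event becomes the deviation event
      on \<open>N\<close>, to which \<open>student_close\<close> applies.\<close>
    have "measure Q {x\<in>space Q. \<bar>R n x\<bar> > \<epsilon>} =
      C.prob {\<omega>\<in>space N. \<exists>t\<in>{0..1}. \<bar>student n (\<lambda>i. Z' i \<omega>) t - C.G (time_var N Z' n t) \<omega> / sqrt (sum_var N Z' n)\<bar> > \<epsilon>}" for n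
    proof -
      have st: "student n (\<lambda>i. fst (\<Phi> \<omega>) i) t = student n (\<lambda>i. Z' i \<omega>) t" for \<omega> t
        by (simp add: student_def time_data_def sample_mean_def \<Phi>_def cong: sum.cong_simp)
      have g: "g n k (\<Phi> \<omega>) = C.G k \<omega> / sqrt (sum_var N Z' n)" for k \<omega>
        unfolding g_def C.G_def sv by (intro arg_cong2[where f="(/)"] sum.cong refl) (auto simp: var \<Phi>_def)
      have "measure Q {x\<in>space Q. \<bar>R n x\<bar> > \<epsilon>} = C.prob (\<Phi> -` {x\<in>space Q. \<bar>R n x\<bar> > \<epsilon>} \<inter> space N)"
        unfolding Q_def by (rule measure_distr[OF \<Phi>]) (use ev in \<open>simp add: Q_def\<close>)
      also have "\<Phi> -` {x\<in>space Q. \<bar>R n x\<bar> > \<epsilon>} \<inter> space N = {\<omega>\<in>space N. \<epsilon> < R n (\<Phi> \<omega>)}"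
        using measurable_space[OF \<Phi>] R(3) by (auto simp: Q_def)
      also have "\<dots> = {\<omega>\<in>space N. \<exists>t\<in>{0..1}. \<bar>student n (\<lambda>i. Z' i \<omega>) t - C.G (time_var N Z' n t) \<omega> / sqrt (sum_var N Z' n)\<bar> > \<epsilon>}"
        unfolding R(2) st g time_var_index sv ..
      finally show ?thesis .
    qed
    then show "(\<lambda>n. measure Q {x\<in>space Q. \<bar>R n x\<bar> > \<epsilon>}) \<longlonglongrightarrow> 0"
      using C.student_close[OF \<epsilon>] by simp
  qed
  then have "conv_prob_0 Q (\<lambda>n x. SUP t\<in>{0..1}. \<bar>student n (\<lambda>i. fst x i) t -
      (\<Sum>i=1..time_var M Z n t. sqrt (variance (Z i)) * snd x i) / sqrt (sum_var M Z n)\<bar>)"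
    by (simp only: R_def[abs_def] g_def time_var_index)
  then show ?thesis
    using a b Q.prob_space_axioms Z''Q Z_law Y_ind Y_dist
    by (intro conjI ballI allI impI exI[of _ Q] exI[of _ "\<lambda>i x. fst x i"] exI[of _ "\<lambda>i x. snd x i"]) auto
qed

end
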